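(* Let $n\ge 2$, let $m\ge 1$ be an integer, let $0<\alpha\le 2$, and set $s:=m+\frac{\alpha}{2}$ (so $0<s<+\infty$). Let $-\infty<\sigma<n$, $0<q<+\infty$, and let $p$ satisfy $0<p<+\infty$ if $0<\alpha<2$, and $1\le p<+\infty$ if $\alpha=2$. Suppose that $u:\mathbb{R}^n\to[0,\infty)$ is a nonnegative classical solution of $$(-\Delta)^{s}u(x)=\left(\frac{1}{|x|^{\sigma}}\ast|u|^{p}\right)u^{q}(x)\qquad\text{in }\mathbb{R}^{n}.$$ Then, for every $i=0,1,\dots,m-1$, $$(-\Delta)^{i+\frac{\alpha}{2}}u(x)\ge 0,\qquad \forall\, x\in\mathbb{R}^{n}.$$
   Context: Convolution: $\left(\frac{1}{|x|^{\sigma}}\ast|u|^{p}\right)(x)=\int_{\mathbb{R}^n}\frac{|u(z)|^p}{|x-z|^{\sigma}}\,dz$. Fractional Laplacian: for $0<\alpha<2$, $$(-\Delta)^{\frac{\alpha}{2}}u(x)=C_{\alpha,n}\lim_{\epsilon\to0}\int_{|y-x|\ge\epsilon}\frac{u(x)-u(y)}{|x-y|^{n+\alpha}}\,dy,\qquad C_{\alpha,n}=\left(\int_{\mathbb{R}^{n}}\frac{1-\cos(2\pi\zeta_{1})}{|\zeta|^{n+\alpha}}d\zeta\right)^{-1},$$ defined for $u\in C^{[\alpha],\{\alpha\}+\epsilon}_{loc}(\mathbb{R}^n)\cap\mathcal{L}_{\alpha}(\mathbb{R}^{n})$ with some (arbitrarily small) $\epsilon>0$, where $[\alpha]$ is the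 integer part of $\alpha$, $\{\alpha\}=\alpha-[\alpha]$, and $\mathcal{L}_{\alpha}(\mathbb{R}^{n})=\{u:\mathbb{R}^n\to\mathbb{R} \mid \int_{\mathbb{R}^{n}}\frac{|u(x)|}{1+|x|^{n+\alpha}}dx<\infty\}$. For $\alpha=2$, $(-\Delta)^{\alpha/2}=-\Delta$. For an integer $i\ge0$, $(-\Delta)^{i+\frac{\alpha}{2}}u:=(-\Delta)^{i}(-\Delta)^{\frac{\alpha}{2}}u$. Classical solution: $u$ is a classical solution if $u\in C^{2m+2}(\mathbb{R}^n)$ when $\alpha=2$, respectively $u\in C^{2m+[\alpha],\{\alpha\}+\epsilon}_{loc}(\mathbb{R}^n)\cap\mathcal{L}_\alpha(\mathbb{R}^n)$ for some (arbitrarily small) $\epsilon>0$ when $0<\alpha<2$ (this guarantees $(-\Delta)^{\frac{\alpha}{2}}u\in C^{2m}(\mathbb{R}^n)$), and $u$ satisfies the equation pointwise at every $x\in\mathbb{R}^n$, with the convolution finite at every point. *)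

theory Defs
  imports "HOL-Analysis.Analysis"
begin

section \<open>Partial derivatives and spaces of differentiable functions\<close>

definition partial_deriv :: "'n::finite \<Rightarrow> (real ^ 'n \<Rightarrow> real) \<Rightarrow> real ^ 'n \<Rightarrow> real" where
  "partial_deriv i f x = deriv (\<lambda>t. f (x + t *\<^sub>R axis i 1)) 0"

definition has_partial_deriv :: "'n::finite \<Rightarrow> (real ^ 'n \<Rightarrow> real) \<Rightarrow> bool" where
  "has_partial_deriv i f \<longleftrightarrow>
     (\<forall>x. (\<lambda>t. f (x + t *\<^sub>R axis i 1)) field_differentiable at 0)"

text \<open>\<open>C_space k\<close> is $C^k(\mathbb{R}^n)$: all partial derivatives of order at most \<open>k\<close>
  exist everywhere and are continuous.\<close>

primrec C_space :: "nat \<Rightarrow> (real ^ 'n::finite \<Rightarrow> real) set" where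
  "C_space 0 = {f. continuous_on UNIV f}"
| "C_space (Suc k) =
     {f. continuous_on UNIV f \<and>
         (\<forall>i. has_partial_deriv i f \<and> partial_deriv i f \<in> C_space k)}"

definition locally_Hoelder :: "real \<Rightarrow> (real ^ 'n::finite \<Rightarrow> real) \<Rightarrow> bool" where
  "locally_Hoelder \<gamma> f \<longleftrightarrow>
     (\<forall>K. compact K \<longrightarrow>
        (\<exists>C. \<forall>x\<in>K. \<forall>y\<in>K. \<bar>f x - f y\<bar> \<le> C * norm (x - y) powr \<gamma>))"

text \<open>\<open>Hoelder_loc_space k \<gamma>\<close> is $C^{k,\gamma}_{loc}(\mathbb{R}^n)$. A list \<open>is\<close> of
  length \<open>k\<close> stands for an iterated partial derivative of order \<open>k\<close>.\<close>

definition Hoelder_loc_space :: "nat \<Rightarrow> real \<Rightarrow> (real ^ 'n::finite \<Rightarrow> real) set" where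
  "Hoelder_loc_space k \<gamma> =
     {f \<in> C_space k. \<forall>is. length is = k \<longrightarrow> locally_Hoelder \<gamma> (foldr partial_deriv is f)}"


section \<open>The operators\<close>

definition neg_laplacian :: "(real ^ 'n::finite \<Rightarrow> real) \<Rightarrow> real ^ 'n \<Rightarrow> real" where
  "neg_laplacian f x = - (\<Sum>i\<in>UNIV. partial_deriv i (partial_deriv i f) x)"

text \<open>The tail space $\mathcal{L}_\alpha(\mathbb{R}^n)$, where $n$ is \<open>CARD('n)\<close>.\<close>

definition L_space :: "real \<Rightarrow> (real ^ 'n::finite \<Rightarrow> real) set" where
  "L_space \<alpha> =
     {u. integrable lborel (\<lambda>x. \<bar>u x\<bar> / (1 + norm x powr (real CARD('n) + \<alpha>)))}"

text \<open>The normalising constant $C_{\alpha,n}$. The index type \<open>'n\<close> has no distinguished first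
  element, so an arbitrary coordinate plays the role of $\zeta_1$; by symmetry the choice does not
  matter, see \<open>frac_laplacian_const_eq\<close> below.\<close>

definition frac_laplacian_const :: "'n::finite itself \<Rightarrow> real \<Rightarrow> real" where
  "frac_laplacian_const _ \<alpha> =
     inverse (LINT \<zeta>::real^'n|lborel.
       (1 - cos (2 * pi * (\<zeta> $ (SOME i. True)))) / norm \<zeta> powr (real CARD('n) + \<alpha>))"

text \<open>The operator $(-\Delta)^{\alpha/2}$ for $0 < \alpha \le 2$. For $\alpha < 2$ it is a
  principal value; \<open>Lim\<close> is meaningful only where the limit exists, which is the case for
  functions in the domain $C^{[\alpha],\{\alpha\}+\epsilon}_{loc} \cap \mathcal{L}_\alpha$.\<close>

definition frac_laplacian :: "real \<Rightarrow> (real ^ 'n::finite \<Rightarrow> real) \<Rightarrow> real ^ 'n \<Rightarrow> real" where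
  "frac_laplacian \<alpha> u x =
     (if \<alpha> = 2 then neg_laplacian u x
      else frac_laplacian_const TYPE('n) \<alpha> *
        Lim (at_right 0) (\<lambda>\<epsilon>. LINT y:{y. \<epsilon> \<le> norm (y - x)}|lborel.
          (u x - u y) / norm (x - y) powr (real CARD('n) + \<alpha>)))"

text \<open>\<open>frac_laplacian_power i \<alpha>\<close> is $(-\Delta)^{i+\alpha/2} = (-\Delta)^i(-\Delta)^{\alpha/2}$.\<close>

definition frac_laplacian_power ::
    "nat \<Rightarrow> real \<Rightarrow> (real ^ 'n::finite \<Rightarrow> real) \<Rightarrow> real ^ 'n \<Rightarrow> real" where
  "frac_laplacian_power i \<alpha> u = (neg_laplacian ^^ i) (frac_laplacian \<alpha> u)"


section \<open>Classical solutions\<close>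

text \<open>The integrand of $(|x|^{-\sigma} \ast |u|^p)(x)$. Its value at \<open>z = x\<close> is \<open>0\<close> by
  convention, which is irrelevant for the integral.\<close>

definition riesz_integrand ::
    "real \<Rightarrow> real \<Rightarrow> (real ^ 'n::finite \<Rightarrow> real) \<Rightarrow> real ^ 'n \<Rightarrow> real ^ 'n \<Rightarrow> real" where
  "riesz_integrand \<sigma> p u x z = \<bar>u z\<bar> powr p / norm (x - z) powr \<sigma>"

definition riesz_convolution ::
    "real \<Rightarrow> real \<Rightarrow> (real ^ 'n::finite \<Rightarrow> real) \<Rightarrow> real ^ 'n \<Rightarrow> real" where
  "riesz_convolution \<sigma> p u x = (LINT z|lborel. riesz_integrand \<sigma> p u x z)"

text \<open>Since \<open>\<epsilon>\<close> may be taken arbitrarily small, requiring the Hoelder exponent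
  $\{\alpha\}+\epsilon$ to be below 1 is no restriction.\<close>

definition solution_regularity :: "nat \<Rightarrow> real \<Rightarrow> (real ^ 'n::finite \<Rightarrow> real) \<Rightarrow> bool" where
  "solution_regularity m \<alpha> u \<longleftrightarrow>
     (if \<alpha> = 2 then u \<in> C_space (2 * m + 2)
      else (\<exists>\<epsilon>>0. frac \<alpha> + \<epsilon> < 1 \<and>
              u \<in> Hoelder_loc_space (2 * m + nat \<lfloor>\<alpha>\<rfloor>) (frac \<alpha> + \<epsilon>) \<inter> L_space \<alpha>))"

definition classical_solution ::
    "nat \<Rightarrow> real \<Rightarrow> real \<Rightarrow> real \<Rightarrow> real \<Rightarrow> (real ^ 'n::finite \<Rightarrow> real) \<Rightarrow> bool" where
  "classical_solution m \<alpha> \<sigma> p q u \<longleftrightarrow>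
     solution_regularity m \<alpha> u \<and>
     (\<forall>x. integrable lborel (riesz_integrand \<sigma> p u x) \<and>
          frac_laplacian_power m \<alpha> u x = riesz_convolution \<sigma> p u x * u x powr q)"


section \<open>Independence of the chosen coordinate\<close>

lemma lborel_distr_permute_coords:
  fixes \<pi> :: "'n::finite \<Rightarrow> 'n"
  assumes inv: "\<And>k. \<pi> (\<pi> k) = k"
  shows "distr lborel borel (\<lambda>x::real^'n. \<chi> k. x $ \<pi> k) = lborel"
proof -
  let ?T = "\<lambda>x::real^'n. \<chi> k. x $ \<pi> k"
  have bij: "bij \<pi>" using inv by (metis bijI')
  have meas: "?T \<in> borel_measurable borel"
    by (intro borel_measurable_continuous_onI continuous_intros)
  have prod: "(\<Prod>b\<in>Basis. (v::real^'n) \<bullet> b) = (\<Prod>k\<in>UNIV. v $ k)" for v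
  proof -
    have B: "Basis = range (\<lambda>k::'n. axis k 1 :: real^'n)" by (auto simp: Basis_vec_def)
    have "inj (\<lambda>k::'n. axis k 1 :: real^'n)" by (auto simp: inj_def axis_eq_axis)
    then show ?thesis
      unfolding B by (subst prod.reindex) (auto simp: inner_axis)
  qed
  show ?thesis
  proof (rule lborel_eqI[symmetric])
    fix l u :: "real^'n"
    assume le: "\<And>b. b \<in> Basis \<Longrightarrow> l \<bullet> b \<le> u \<bullet> b"
    have le': "l $ k \<le> u $ k" for k
      using le[of "axis k 1"] by (simp add: inner_axis)
    have pre: "?T -` box l u = box (?T l) (?T u)"
      by (auto simp: mem_box_cart) (metis inv)+
    have leT: "?T l \<bullet> b \<le> ?T u \<bullet> b" if "b \<in> Basis" for b
      using that le' by (auto simp: Basis_vec_def inner_axis)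
    have "emeasure (distr lborel borel ?T) (box l u) = emeasure lborel (box (?T l) (?T u))"
      using meas by (subst emeasure_distr) (auto simp: pre)
    also have "\<dots> = ennreal (\<Prod>b\<in>Basis. (?T u - ?T l) \<bullet> b)"
      using leT by (subst emeasure_lborel_box) auto
    also have "(\<Prod>b\<in>Basis. (?T u - ?T l) \<bullet> b) = (\<Prod>k\<in>UNIV. (u - l) $ \<pi> k)"
      by (subst prod) simp
    also have "\<dots> = (\<Prod>b\<in>Basis. (u - l) \<bullet> b)"
      by (subst prod) (rule prod.reindex_bij_betw[OF bij])
    finally show "emeasure (distr lborel borel ?T) (box l u) = ennreal (\<Prod>b\<in>Basis. (u - l) \<bullet> b)" .
  qed simp
qed

lemma frac_laplacian_const_eq:
  fixes i :: "'n::finite"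
  shows "frac_laplacian_const TYPE('n) \<alpha> =
     inverse (LINT \<zeta>::real^'n|lborel.
       (1 - cos (2 * pi * (\<zeta> $ i))) / norm \<zeta> powr (real CARD('n) + \<alpha>))"
proof -
  define j :: 'n where "j = (SOME i. True)"
  define \<pi> where "\<pi> = Transposition.transpose i j"
  let ?T = "\<lambda>x::real^'n. \<chi> k. x $ \<pi> k"
  let ?f = "\<lambda>k \<zeta>::real^'n. (1 - cos (2 * pi * (\<zeta> $ k))) / norm \<zeta> powr (real CARD('n) + \<alpha>)"
  have inv: "\<pi> (\<pi> k) = k" for k by (simp add: \<pi>_def)
  have bij: "bij \<pi>" using inv by (metis bijI')
  have meas: "?T \<in> borel_measurable borel"
    by (intro borel_measurable_continuous_onI continuous_intros)
  have nrm: "norm (?T x) = norm x" for x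
    unfolding norm_vec_def L2_set_def
    using sum.reindex_bij_betw[OF bij, of "\<lambda>k. (norm (x $ k))\<^sup>2"] by simp
  have fm: "?f i \<in> borel_measurable borel"
    by measurable
  have "(LINT \<zeta>|lborel. ?f i \<zeta>) = (LINT \<zeta>|distr lborel borel ?T. ?f i \<zeta>)"
    using lborel_distr_permute_coords[of \<pi>] inv by simp
  also have "\<dots> = (LINT \<zeta>|lborel. ?f i (?T \<zeta>))"
    using meas fm by (subst integral_distr) auto
  also have "\<dots> = (LINT \<zeta>|lborel. ?f j \<zeta>)"
    by (simp only: nrm) (simp add: \<pi>_def)
  finally show ?thesis
    by (simp add: frac_laplacian_const_def j_def)
qed

end

theory Submission
  imports Defs
begin

text \<open>
  Put $u_0 = (-\Delta)^{\alpha/2} u$. Nonnegativity descends from $(-\Delta)^k u_0$ to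
  $v = (-\Delta)^{k-1} u_0$: a superharmonic $v$ with $v(a) < 0$ satisfies
  $\int v \, \phi_R \le -c R^{n+2M}$ for large $R$, where $\phi_R(x) = (R^2 - |x-a|^2)_+^M$,
  because the left-hand side divided by $R^{n+2M}$ is nonincreasing in $R$. On the other hand,
  $\int v \, \phi_R = \int u \, (-\Delta)^{k-1+\alpha/2} \phi_R = o(R^{n+2M})$. For $\alpha < 2$ this
  follows from $u \in \mathcal{L}_\alpha$ and the decay $|x|^{-n-\alpha}$ of $(-\Delta)^{\alpha/2} \phi_R$. For
  $\alpha = 2$ it follows from $\int_{B_R} u = O(R^n)$, a consequence of $u \le 1 + u^p$ and the
  finiteness of the convolution. Both signs of $(-1)^k$ are thus treated at once, without spherical
  means, Green functions or the precise form of the nonlinearity.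

  The integration by parts needs $u_0 \in C^{2m}$ when $\alpha < 2$. The singular kernel is split
  into a part supported in the unit ball, which commutes with derivatives of $u$, and a smooth
  part, which absorbs the derivatives itself.
\<close>

section \<open>Partial derivatives\<close>

text \<open>The profile (R^2 - |x - a|^2)_+^M is chosen because it is tied to the Laplacian: -Delta
  of the profile with exponent M + 3 is a combination of those with exponents M + 2 and M + 1, with
  coefficients depending only on R, and the R-derivative of the integral against exponent M + 2,
  divided by R^(n + 2(M + 2)), is the same combination up to a negative factor. The sign of -Delta v
  thus gives monotonicity at once. The price is that the exponent shifts, so the means have to be
  controlled for all large M.

  Derivatives of u have no prescribed growth at infinity, so every bound on a mean of an iterate is
  obtained by moving the operators onto the test function. Each Laplacian gains a factor R^(-2); for
  \<alpha> = 2 this turns bounded means of u into vanishing means of -Delta u. The same lack of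
  growth control forces the splitting of the kernel: far away no derivative may fall on u. A Taylor
  polynomial in |z|^2 at 1 continues |z|^(-n-\<alpha>) from outside the unit ball to a kernel with
  as many derivatives as required.\<close>

definition has_pd :: "'n::finite \<Rightarrow> (real ^ 'n \<Rightarrow> real) \<Rightarrow> (real ^ 'n \<Rightarrow> real) \<Rightarrow> bool" where
  "has_pd i f g \<longleftrightarrow>
     (\<forall>x. ((\<lambda>t. f (x + t *\<^sub>R axis i 1)) has_field_derivative g x) (at 0))"

text \<open>\<open>partial_deriv\<close> has some value even where no derivative exists. The
  relation \<open>has_pd\<close> carries existence along with the value, so that the calculus rules
  compose without side conditions on differentiability.\<close>

lemma has_pd_iff: "has_pd i f g \<longleftrightarrow> has_partial_deriv i f \<and> partial_deriv i f = g"
proof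
  assume h: "has_pd i f g"
  then show "has_partial_deriv i f \<and> partial_deriv i f = g"
    unfolding has_pd_def has_partial_deriv_def partial_deriv_def field_differentiable_def
    by (auto intro!: ext DERIV_imp_deriv)
next
  assume "has_partial_deriv i f \<and> partial_deriv i f = g"
  then show "has_pd i f g"
    unfolding has_pd_def has_partial_deriv_def partial_deriv_def
    by (auto simp: DERIV_deriv_iff_field_differentiable)
qed

lemma has_pd_along:
  assumes "has_pd i f g"
  shows "((\<lambda>t. f (x + t *\<^sub>R axis i 1)) has_field_derivative g (x + s *\<^sub>R axis i 1)) (at s)"
proof -
  have "((\<lambda>t. f ((x + s *\<^sub>R axis i 1) + t *\<^sub>R axis i 1)) has_field_derivative
          g (x + s *\<^sub>R axis i 1)) (at 0)"
    using assms by (auto simp: has_pd_def)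
  then have "((\<lambda>t. f (x + (s + t) *\<^sub>R axis i 1)) has_field_derivative
          g (x + s *\<^sub>R axis i 1)) (at 0)"
    by (simp add: algebra_simps)
  then show ?thesis
    using DERIV_shift[of "\<lambda>t. f (x + t *\<^sub>R axis i 1)" "g (x + s *\<^sub>R axis i 1)" 0 s]
    by (simp add: add.commute)
qed

lemma has_pd_add:
  assumes "has_pd i f f'" "has_pd i g g'"
  shows "has_pd i (\<lambda>x. f x + g x) (\<lambda>x. f' x + g' x)"
  using assms unfolding has_pd_def by (auto intro!: derivative_eq_intros)

lemma has_pd_cmult:
  assumes "has_pd i f f'"
  shows "has_pd i (\<lambda>x. c * f x) (\<lambda>x. c * f' x)"
  using assms unfolding has_pd_def by (auto intro!: derivative_eq_intros)

lemma has_pd_mult: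
  assumes "has_pd i f f'" "has_pd i g g'"
  shows "has_pd i (\<lambda>x. f x * g x) (\<lambda>x. f' x * g x + f x * g' x)"
  unfolding has_pd_def
proof
  fix x
  show "((\<lambda>t. f (x + t *\<^sub>R axis i 1) * g (x + t *\<^sub>R axis i 1)) has_field_derivative
      f' x * g x + f x * g' x) (at 0)"
    using assms unfolding has_pd_def by (auto intro!: derivative_eq_intros)
qed

lemma has_pd_const: "has_pd i (\<lambda>x. c) (\<lambda>x. 0)"
  unfolding has_pd_def by auto

lemma has_pd_mvt:
  assumes "has_pd i f g"
  obtains s where "\<bar>s\<bar> \<le> \<bar>t\<bar>" "f (x + t *\<^sub>R axis i 1) - f x = t * g (x + s *\<^sub>R axis i 1)"
proof -
  let ?F = "\<lambda>t. f (x + t *\<^sub>R axis i 1)"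
  note D = has_pd_along[OF assms, of x]
  consider "t > 0" | "t < 0" | "t = 0" by linarith
  then show ?thesis
  proof cases
    case 1
    obtain s where "0 < s" "s < t"
      "?F t - ?F 0 = (t - 0) * g (x + s *\<^sub>R axis i 1)"
      using MVT2[OF 1, of ?F "\<lambda>s. g (x + s *\<^sub>R axis i 1)"] D by blast
    then show ?thesis by (intro that[of s]) auto
  next
    case 2
    obtain s where "t < s" "s < 0"
      "?F 0 - ?F t = (0 - t) * g (x + s *\<^sub>R axis i 1)"
      using MVT2[OF 2, of ?F "\<lambda>s. g (x + s *\<^sub>R axis i 1)"] D by blast
    then show ?thesis by (intro that[of s]) auto
  next
    case 3
    then show ?thesis by (intro that[of 0]) auto
  qed
qed

lemma C_space_SucI:
  assumes "continuous_on UNIV f" "\<And>i. \<exists>g\<in>C_space k. has_pd i f g"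
  shows "f \<in> C_space (Suc k)"
  using assms by (auto simp: has_pd_iff)

lemma C_space_SucD:
  assumes "f \<in> C_space (Suc k)"
  shows "has_pd i f (partial_deriv i f)" "partial_deriv i f \<in> C_space k"
  using assms by (auto simp: has_pd_iff)

lemma C_space_continuous: "f \<in> C_space k \<Longrightarrow> continuous_on UNIV f"
  by (cases k) auto

lemma C_space_Suc_subset: "f \<in> C_space (Suc k) \<Longrightarrow> f \<in> C_space k"
proof (induction k arbitrary: f)
  case (Suc k)
  show ?case
  proof (rule C_space_SucI)
    show "\<exists>g\<in>C_space k. has_pd i f g" for i
      using Suc.IH C_space_SucD[OF Suc.prems] by blast
  qed (rule C_space_continuous[OF Suc.prems])
qed auto

lemma C_space_mono: "k \<le> l \<Longrightarrow> f \<in> C_space l \<Longrightarrow> f \<in> C_space k"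
  by (induction l rule: dec_induct) (auto simp del: C_space.simps intro: C_space_Suc_subset)

lemma C_space_add: "f \<in> C_space k \<Longrightarrow> g \<in> C_space k \<Longrightarrow> (\<lambda>x. f x + g x) \<in> C_space k"
proof (induction k arbitrary: f g)
  case (Suc k)
  show ?case
  proof (rule C_space_SucI)
    show "continuous_on UNIV (\<lambda>x. f x + g x)"
      using Suc.prems by (intro continuous_intros C_space_continuous)
    show "\<exists>h\<in>C_space k. has_pd i (\<lambda>x. f x + g x) h" for i
      using Suc.IH has_pd_add C_space_SucD[OF Suc.prems(1)] C_space_SucD[OF Suc.prems(2)] by blast
  qed
qed (auto intro: continuous_intros)

lemma C_space_cmult: "f \<in> C_space k \<Longrightarrow> (\<lambda>x. c * f x) \<in> C_space k"
proof (induction k arbitrary: f)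
  case (Suc k)
  show ?case
  proof (rule C_space_SucI)
    show "continuous_on UNIV (\<lambda>x. c * f x)"
      using Suc.prems by (intro continuous_intros C_space_continuous)
    show "\<exists>h\<in>C_space k. has_pd i (\<lambda>x. c * f x) h" for i
      using Suc.IH has_pd_cmult C_space_SucD[OF Suc.prems] by blast
  qed
qed (auto intro: continuous_intros)

lemma C_space_zero: "(\<lambda>x. 0) \<in> C_space k"
proof (induction k)
  case (Suc k)
  then show ?case by (intro C_space_SucI) (auto intro: has_pd_const simp del: C_space.simps)
qed auto

lemma C_space_sum:
  assumes "finite I" "\<And>i. i \<in> I \<Longrightarrow> f i \<in> C_space k"
  shows "(\<lambda>x. \<Sum>i\<in>I. f i x) \<in> C_space k"
  using assms by (induction I rule: finite_induct) (auto intro: C_space_zero C_space_add)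

lemma neg_laplacian_C_space:
  assumes "f \<in> C_space (Suc (Suc k))"
  shows "neg_laplacian f \<in> C_space k"
proof -
  have "(\<lambda>x. (-1) * (\<Sum>i\<in>UNIV. partial_deriv i (partial_deriv i f) x)) \<in> C_space k"
    using assms by (intro C_space_cmult C_space_sum) (auto simp del: C_space.simps intro: C_space_SucD)
  then show ?thesis
    by (simp add: neg_laplacian_def[abs_def])
qed

lemma neg_laplacian_power_C_space:
  assumes "f \<in> C_space (2 * i + k)"
  shows "(neg_laplacian ^^ i) f \<in> C_space k"
  using assms
proof (induction i arbitrary: k)
  case (Suc i)
  then show ?case using neg_laplacian_C_space[of "(neg_laplacian ^^ i) f" k] by (auto simp del: C_space.simps)
qed auto

text \<open>The increment is taken along a path parallel to the coordinate axes.\<close>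

lemma increment_bound:
  fixes f :: "real ^ 'n::finite \<Rightarrow> real"
  assumes pd: "\<And>i. has_pd i f (g i)"
    and bd: "\<And>i y. norm (y - x) \<le> norm z \<Longrightarrow> \<bar>g i y - c i\<bar> \<le> \<eta>"
  shows "\<bar>f (x + z) - f x - (\<Sum>i\<in>UNIV. z $ i * c i)\<bar> \<le> real CARD('n) * norm z * \<eta>"
proof -
  have eta: "0 \<le> \<eta>" using bd[of x undefined] by auto
  \<comment> \<open>\<open>x + w S\<close> is the corner of the path reached after the moves along
    the coordinates in \<open>S\<close>.\<close>
  define w where "w S = (\<chi> i. if i \<in> S then z $ i else 0)" for S
  have "\<bar>f (x + w S) - f x - (\<Sum>i\<in>S. z $ i * c i)\<bar> \<le> real (card S) * norm z * \<eta>" if "finite S" for S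
    using that
  proof (induction S rule: finite_induct)
    case empty
    have "w {} = 0" by (simp add: w_def vec_eq_iff)
    then show ?case by simp
  next
    case (insert j S)
    have w: "w (insert j S) = w S + (z $ j) *\<^sub>R axis j 1"
      using insert by (auto simp: w_def vec_eq_iff axis_def)
    obtain s where s: "\<bar>s\<bar> \<le> \<bar>z $ j\<bar>"
      "f ((x + w S) + (z $ j) *\<^sub>R axis j 1) - f (x + w S) = (z $ j) * g j ((x + w S) + s *\<^sub>R axis j 1)"
      by (rule has_pd_mvt[OF pd])
    let ?y = "(x + w S) + s *\<^sub>R axis j 1"
    \<comment> \<open>Each component of \<open>?y - x\<close> is bounded by the corresponding one of
      \<open>z\<close>, so the path never leaves the ball where \<open>bd\<close> holds.\<close>
    have "norm (?y - x) \<le> norm z"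
      using s(1) insert.hyps by (intro norm_le_componentwise_cart) (auto simp: w_def axis_def)
    then have "\<bar>g j ?y - c j\<bar> \<le> \<eta>" by (rule bd)
    then have A: "\<bar>z $ j * (g j ?y - c j)\<bar> \<le> norm z * \<eta>"
      unfolding abs_mult by (intro mult_mono component_le_norm_cart) auto
    have "f (x + w (insert j S)) - f x - (\<Sum>i\<in>insert j S. z $ i * c i)
       = (f (x + w S) - f x - (\<Sum>i\<in>S. z $ i * c i)) + z $ j * (g j ?y - c j)"
      using s(2) insert.hyps by (simp add: w algebra_simps)
    also have "\<bar>\<dots>\<bar> \<le> real (card S) * norm z * \<eta> + norm z * \<eta>"
      by (rule order_trans[OF abs_triangle_ineq add_mono[OF insert.IH A]])
    also have "\<dots> = real (card (insert j S)) * norm z * \<eta>"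
      using insert.hyps by (simp add: algebra_simps)
    finally show ?case .
  qed
  from this[of UNIV] show ?thesis by (simp add: w_def vec_lambda_beta)
qed

lemma continuous_bounded_on_cball:
  fixes f :: "'a::heine_borel \<Rightarrow> real"
  assumes "continuous_on UNIV f"
  obtains C where "0 \<le> C" "\<And>x. x \<in> cball a r \<Longrightarrow> \<bar>f x\<bar> \<le> C"
proof -
  have "compact (f ` cball a r)"
    using assms by (intro compact_continuous_image compact_cball) (auto intro: continuous_on_subset)
  then obtain C where "\<And>y. y \<in> f ` cball a r \<Longrightarrow> norm y \<le> C"
    using compact_imp_bounded bounded_iff by metis
  then show ?thesis by (intro that[of "max 0 C"]) (auto simp: le_max_iff_disj)
qed

section \<open>Differentiation under the integral sign\<close>

text \<open>By the mean value theorem each difference quotient is a value of \<open>G\<close> at an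
  intermediate parameter, so the one function \<open>h\<close> dominates all of them.\<close>

lemma has_field_derivative_integral:
  fixes F G :: "real \<Rightarrow> 'a \<Rightarrow> real"
  assumes d: "d > 0"
    and int: "\<And>t. \<bar>t\<bar> < d \<Longrightarrow> integrable M (F t)"
    and der: "\<And>t z. \<bar>t\<bar> < d \<Longrightarrow> ((\<lambda>t. F t z) has_field_derivative G t z) (at t)"
    and bd: "\<And>t z. \<bar>t\<bar> < d \<Longrightarrow> \<bar>G t z\<bar> \<le> h z"
    and h: "integrable M h"
  shows "((\<lambda>t. integral\<^sup>L M (F t)) has_field_derivative integral\<^sup>L M (G 0)) (at 0)"
    and "integrable M (G 0)"
proof -
  define Q where "Q t z = (F t z - F 0 z) / t" for t z
  have Qbd: "\<bar>Q t z\<bar> \<le> h z" if t: "\<bar>t\<bar> < d" "t \<noteq> 0" for t z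
  proof -
    have "\<exists>s. \<bar>s\<bar> < d \<and> F t z - F 0 z = t * G s z"
    proof (cases "t > 0")
      case True
      have "\<And>x. 0 \<le> x \<Longrightarrow> x \<le> t \<Longrightarrow> ((\<lambda>t. F t z) has_field_derivative G x z) (at x)"
        using der t by auto
      from MVT2[OF True this] obtain s where "0 < s" "s < t" "F t z - F 0 z = (t - 0) * G s z" by auto
      then show ?thesis using t by (intro exI[of _ s]) auto
    next
      case False
      then have neg: "t < 0" using t by auto
      have "\<And>x. t \<le> x \<Longrightarrow> x \<le> 0 \<Longrightarrow> ((\<lambda>t. F t z) has_field_derivative G x z) (at x)"
        using der t by auto
      from MVT2[OF neg this] obtain s where "t < s" "s < 0" "F 0 z - F t z = (0 - t) * G s z" by auto
      then show ?thesis using t by (intro exI[of _ s]) auto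
    qed
    then obtain s where "\<bar>s\<bar> < d" "F t z - F 0 z = t * G s z" by blast
    then show ?thesis using t bd[of s z] by (simp add: Q_def)
  qed
  have lim: "(\<lambda>k. Q (X k) z) \<longlonglongrightarrow> G 0 z" if "\<And>k. X k \<noteq> 0" "X \<longlonglongrightarrow> 0" for X z
  proof -
    have "((\<lambda>t. Q t z) \<longlongrightarrow> G 0 z) (at 0)"
      using der[of 0 z] d unfolding DERIV_def Q_def by simp
    then show ?thesis using that
      by (auto simp: tendsto_at_iff_sequentially comp_def)
  qed
  have measF: "F t \<in> borel_measurable M" if "\<bar>t\<bar> < d" for t using int[OF that] by auto
  have measG: "G 0 \<in> borel_measurable M"
  proof (rule borel_measurable_LIMSEQ_real)
    \<comment> \<open>Measurability of \<open>G 0\<close> comes from difference quotients along this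
      sequence. The denominators start at 2 because \<open>\<bar>t\<bar> < d\<close> is strict and
      \<open>d\<close> itself is excluded.\<close>
    let ?X = "\<lambda>k. d / real (Suc (Suc k))"
    have "(\<lambda>k. ?X k) \<longlonglongrightarrow> 0" by real_asymp
    then show "(\<lambda>k. Q (?X k) z) \<longlonglongrightarrow> G 0 z" for z
      using d by (intro lim) auto
    show "Q (?X k) \<in> borel_measurable M" for k
      unfolding Q_def using d
      by (intro borel_measurable_divide borel_measurable_diff measF)
         (auto simp: field_simps intro!: add_pos_nonneg)
  qed
  show "integrable M (G 0)"
    by (rule Bochner_Integration.integrable_bound[OF h measG]) (use bd[of 0] d in \<open>auto intro!: AE_I2 intro: order_trans[OF _ abs_ge_self]\<close>)
  have main: "(\<lambda>k. integral\<^sup>L M (Q (X k))) \<longlonglongrightarrow> integral\<^sup>L M (G 0)"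
    if X: "\<And>k. X k \<noteq> 0" "X \<longlonglongrightarrow> 0" "\<And>k. \<bar>X k\<bar> < d" for X
  proof (rule integral_dominated_convergence[OF measG _ h])
    show "Q (X k) \<in> borel_measurable M" for k
      unfolding Q_def using d X by (intro borel_measurable_divide borel_measurable_diff measF) auto
    show "AE z in M. (\<lambda>k. Q (X k) z) \<longlonglongrightarrow> G 0 z" using lim X by auto
    show "AE z in M. norm (Q (X k) z) \<le> h z" for k using Qbd X by auto
  qed
  have eq: "integral\<^sup>L M (Q t) = (integral\<^sup>L M (F t) - integral\<^sup>L M (F 0)) / t" if "\<bar>t\<bar> < d" for t
    unfolding Q_def using int[OF that] int[of 0] d by simp
  have "((\<lambda>t. (integral\<^sup>L M (F t) - integral\<^sup>L M (F 0)) / t) \<longlongrightarrow> integral\<^sup>L M (G 0)) (at 0)"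
    unfolding tendsto_at_iff_sequentially comp_def
  proof (intro allI impI)
    fix X :: "nat \<Rightarrow> real" assume X: "\<forall>i. X i \<in> UNIV - {0}" "X \<longlonglongrightarrow> 0"
    from X(2) d have "eventually (\<lambda>k. \<bar>X k\<bar> < d) sequentially"
      by (auto simp: tendsto_iff)
    then obtain k0 where k0: "\<And>k. k \<ge> k0 \<Longrightarrow> \<bar>X k\<bar> < d" by (auto simp: eventually_sequentially)
    have "(\<lambda>k. integral\<^sup>L M (Q (X (k + k0)))) \<longlonglongrightarrow> integral\<^sup>L M (G 0)"
      using X k0 by (intro main) (auto intro: LIMSEQ_ignore_initial_segment)
    then have "(\<lambda>k. (integral\<^sup>L M (F (X (k + k0))) - integral\<^sup>L M (F 0)) / X (k + k0)) \<longlonglongrightarrow> integral\<^sup>L M (G 0)"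
      using k0 eq by simp
    then show "(\<lambda>k. (integral\<^sup>L M (F (X k)) - integral\<^sup>L M (F 0)) / X k) \<longlonglongrightarrow> integral\<^sup>L M (G 0)"
      by (rule LIMSEQ_offset)
  qed
  then show "((\<lambda>t. integral\<^sup>L M (F t)) has_field_derivative integral\<^sup>L M (G 0)) (at 0)"
    by (simp add: DERIV_def)
qed

lemma continuous_on_integral_dominated:
  fixes F :: "'a::metric_space \<Rightarrow> 'b \<Rightarrow> real"
  assumes meas: "\<And>x. F x \<in> borel_measurable M"
    and cont: "\<And>z. continuous_on UNIV (\<lambda>x. F x z)"
    and bd: "\<And>x0. \<exists>h. integrable M h \<and> (\<forall>x\<in>ball x0 1. \<forall>z. \<bar>F x z\<bar> \<le> h z)"
  shows "continuous_on UNIV (\<lambda>x. integral\<^sup>L M (F x))"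
  unfolding continuous_on_sequentially
proof (intro allI ballI impI)
  fix X :: "nat \<Rightarrow> 'a" and x0 assume X: "(\<forall>n. X n \<in> UNIV) \<and> X \<longlonglongrightarrow> x0"
  obtain h where h: "integrable M h" "\<And>x z. x \<in> ball x0 1 \<Longrightarrow> \<bar>F x z\<bar> \<le> h z" using bd[of x0] by blast
  have "eventually (\<lambda>k. X k \<in> ball x0 1) sequentially"
    using X by (auto simp: tendsto_iff dist_commute)
  then obtain k0 where k0: "\<And>k. k \<ge> k0 \<Longrightarrow> X k \<in> ball x0 1" by (auto simp: eventually_sequentially)
  have "(\<lambda>k. integral\<^sup>L M (F (X (k + k0)))) \<longlonglongrightarrow> integral\<^sup>L M (F x0)"
  proof (rule integral_dominated_convergence[OF meas meas h(1)])
    have "(\<lambda>k. F (X k) z) \<longlonglongrightarrow> F x0 z" for z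
      using cont[of z] X unfolding continuous_on_sequentially comp_def by auto
    then show "AE z in M. (\<lambda>k. F (X (k + k0)) z) \<longlonglongrightarrow> F x0 z"
      by (auto intro!: LIMSEQ_ignore_initial_segment)
    show "AE z in M. norm (F (X (k + k0)) z) \<le> h z" for k
      using h(2) k0 by auto
  qed
  then show "((\<lambda>x. integral\<^sup>L M (F x)) \<circ> X) \<longlonglongrightarrow> integral\<^sup>L M (F x0)"
    unfolding comp_def by (rule LIMSEQ_offset)
qed

section \<open>Radial test functions\<close>

text \<open>A polynomial profile in place of a smooth cutoff: its derivatives stay in the same
  family up to polynomial factors. For \<open>M \<ge> 1\<close> it is only of class C^(M-1), so
  \<open>M\<close> measures the smoothness that differentiation consumes.\<close>

definition bump :: "real ^ 'n::finite \<Rightarrow> nat \<Rightarrow> real \<Rightarrow> real ^ 'n \<Rightarrow> real" where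
  "bump a M R x = max 0 (R\<^sup>2 - (norm (x - a))\<^sup>2) ^ M"

lemma has_field_derivative_pos_part_power:
  fixes t :: real
  shows "((\<lambda>t. max 0 t ^ Suc (Suc M)) has_field_derivative real (Suc (Suc M)) * max 0 t ^ Suc M) (at t)"
proof -
  consider "t > 0" | "t < 0" | "t = 0" by linarith
  then show ?thesis
  proof cases
    case 1
    have "((\<lambda>t. t ^ Suc (Suc M)) has_field_derivative real (Suc (Suc M)) * t ^ Suc M) (at t)"
      using DERIV_pow[of "Suc (Suc M)" t UNIV] by (simp del: power_Suc of_nat_Suc)
    then have "((\<lambda>t. max 0 t ^ Suc (Suc M)) has_field_derivative real (Suc (Suc M)) * t ^ Suc M) (at t)"
      by (rule has_field_derivative_transform_within[where d = t]) (use 1 in \<open>auto simp: dist_real_def\<close>)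
    then show ?thesis using 1 by simp
  next
    case 2
    have "((\<lambda>t. 0) has_field_derivative 0) (at t)" by simp
    then have "((\<lambda>t. max 0 t ^ Suc (Suc M)) has_field_derivative 0) (at t)"
      by (rule has_field_derivative_transform_within[where d = "-t"]) (use 2 in \<open>auto simp: dist_real_def\<close>)
    then show ?thesis using 2 by simp
  next
    case 3
    \<comment> \<open>At the kink the difference quotient equals \<open>max 0 h ^ Suc M\<close>,
      whose exponent is still positive.\<close>
    have "((\<lambda>h::real. max 0 h ^ Suc M) \<longlongrightarrow> max 0 0 ^ Suc M) (at 0)"
      by (intro tendsto_intros)
    then have "((\<lambda>h::real. max 0 h ^ Suc M) \<longlongrightarrow> 0) (at 0)" by simp
    then have "((\<lambda>h::real. max 0 h ^ Suc (Suc M) / h) \<longlongrightarrow> 0) (at 0)"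
      by (rule Lim_transform_eventually) (auto simp: eventually_at max_def field_simps intro!: exI[of _ 1])
    then show ?thesis using 3 by (simp add: DERIV_def)
  qed
qed

lemma bump_nonneg: "0 \<le> bump a M R x"
  by (simp add: bump_def)

text \<open>For \<open>M = 0\<close> the power is 1 everywhere, so compact support requires
  \<open>0 < M\<close>.\<close>

lemma bump_eq_0: "0 < M \<Longrightarrow> 0 \<le> R \<Longrightarrow> R \<le> norm (x - a) \<Longrightarrow> bump a M R x = 0"
  by (auto simp: bump_def max_def power_mono)

lemma bump_le: "bump a M R x \<le> R ^ (2 * M)"
  unfolding bump_def power_mult by (intro power_mono) auto

lemma continuous_on_bump [continuous_intros]: "continuous_on A (bump a M R)"
  unfolding bump_def by (intro continuous_intros)

lemma borel_measurable_bump [measurable]: "bump a M R \<in> borel_measurable borel"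
  by (rule borel_measurable_continuous_onI[OF continuous_on_bump])

lemma norm_add_axis_power2:
  fixes y :: "real ^ 'n::finite"
  shows "(norm (y + t *\<^sub>R axis i 1))\<^sup>2 = (norm y)\<^sup>2 + 2 * t * y $ i + t\<^sup>2"
  unfolding power2_norm_eq_inner
  by (simp add: inner_left_distrib inner_right_distrib inner_axis inner_axis' algebra_simps power2_eq_square)

lemma has_pd_norm_power2:
  "has_pd i (\<lambda>x. (norm (x - a))\<^sup>2) (\<lambda>x. 2 * (x - a) $ i)"
proof -
  have "(norm (x + t *\<^sub>R axis i 1 - a))\<^sup>2 = (norm (x - a))\<^sup>2 + 2 * t * (x - a) $ i + t\<^sup>2" for x t
    using norm_add_axis_power2[of "x - a" t i] by (simp add: algebra_simps)
  then show ?thesis unfolding has_pd_def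
    by (auto intro!: derivative_eq_intros)
qed

lemma has_pd_compose:
  assumes "has_pd i f f'" "\<And>x. (g has_field_derivative g' (f x)) (at (f x))"
  shows "has_pd i (\<lambda>x. g (f x)) (\<lambda>x. g' (f x) * f' x)"
  unfolding has_pd_def
proof
  fix x
  have "((\<lambda>t. f (x + t *\<^sub>R axis i 1)) has_field_derivative f' x) (at 0)"
    using assms(1) by (auto simp: has_pd_def)
  moreover have "(g has_field_derivative g' (f x)) (at (f (x + 0 *\<^sub>R axis i 1)))"
    using assms(2)[of x] by simp
  ultimately show "((\<lambda>t. g (f (x + t *\<^sub>R axis i 1))) has_field_derivative g' (f x) * f' x) (at 0)"
    by (intro DERIV_chain2)
qed

lemma has_pd_bump:
  "has_pd i (bump a (Suc (Suc M)) R) (\<lambda>x. (- 2 * real (Suc (Suc M))) * ((x - a) $ i * bump a (Suc M) R x))"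
proof -
  have 1: "has_pd i (\<lambda>x. R\<^sup>2 + (-1) * (norm (x - a))\<^sup>2) (\<lambda>x. 0 + (-1) * (2 * (x - a) $ i))"
    by (intro has_pd_add has_pd_const has_pd_cmult has_pd_norm_power2)
  have "has_pd i (\<lambda>x. max 0 (R\<^sup>2 + (-1) * (norm (x - a))\<^sup>2) ^ Suc (Suc M))
     (\<lambda>x. (real (Suc (Suc M)) * max 0 (R\<^sup>2 + (-1) * (norm (x - a))\<^sup>2) ^ Suc M) * (0 + (-1) * (2 * (x - a) $ i)))"
    by (rule has_pd_compose[OF 1 has_field_derivative_pos_part_power])
  moreover have "bump a (Suc (Suc M)) R = (\<lambda>x. max 0 (R\<^sup>2 + (-1) * (norm (x - a))\<^sup>2) ^ Suc (Suc M))"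
    by (auto simp: bump_def)
  moreover have "(\<lambda>x. (real (Suc (Suc M)) * max 0 (R\<^sup>2 + (-1) * (norm (x - a))\<^sup>2) ^ Suc M) * (0 + (-1) * (2 * (x - a) $ i)))
     = (\<lambda>x. (- 2 * real (Suc (Suc M))) * ((x - a) $ i * bump a (Suc M) R x))"
    unfolding bump_def by (auto simp: algebra_simps)
  ultimately show ?thesis by simp
qed

lemma has_pd_component: "has_pd i (\<lambda>x. (x - a) $ j) (\<lambda>x. if i = j then 1 else 0)"
proof -
  have "(x + t *\<^sub>R axis i 1 - a) $ j = (x - a) $ j + t * (if i = j then 1 else 0)" for x t
    by (auto simp: axis_def)
  then show ?thesis unfolding has_pd_def by (simp only:) (auto intro!: derivative_eq_intros)
qed

lemma has_pd_bump2:
  "has_pd i (\<lambda>x. (- 2 * real (Suc (Suc (Suc M)))) * ((x - a) $ i * bump a (Suc (Suc M)) R x))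
    (\<lambda>x. (- 2 * real (Suc (Suc (Suc M)))) * (bump a (Suc (Suc M)) R x
       - 2 * real (Suc (Suc M)) * ((x - a) $ i)\<^sup>2 * bump a (Suc M) R x))"
proof -
  have "has_pd i (\<lambda>x. (- 2 * real (Suc (Suc (Suc M)))) * ((x - a) $ i * bump a (Suc (Suc M)) R x))
     (\<lambda>x. (- 2 * real (Suc (Suc (Suc M)))) * ((if i = i then 1 else 0) * bump a (Suc (Suc M)) R x
       + (x - a) $ i * ((- 2 * real (Suc (Suc M))) * ((x - a) $ i * bump a (Suc M) R x))))"
    by (intro has_pd_cmult has_pd_mult has_pd_component has_pd_bump)
  then show ?thesis by (simp add: algebra_simps power2_eq_square)
qed

lemma sum_components_power2: "(\<Sum>i\<in>UNIV. (y $ i)\<^sup>2) = (norm (y::real^'n::finite))\<^sup>2"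
  by (simp add: norm_vec_def L2_set_def sum_nonneg)

text \<open>The factor |x - a|^2 left by the second derivatives is R^2 - (R^2 - |x - a|^2) on the
  support. It is thereby absorbed into the bumps, and only powers of R remain as
  coefficients.\<close>

lemma laplacian_bump:
  fixes a :: "real ^ 'n::finite"
  shows "(\<Sum>i\<in>UNIV. (- 2 * real (Suc (Suc (Suc M)))) * (bump a (Suc (Suc M)) R x
       - 2 * real (Suc (Suc M)) * ((x - a) $ i)\<^sup>2 * bump a (Suc M) R x))
    = 4 * real (M + 3) * real (M + 2) * R\<^sup>2 * bump a (Suc M) R x
      - 2 * real (M + 3) * real (CARD('n) + 2 * M + 4) * bump a (Suc (Suc M)) R x"
proof -
  have key: "(norm (x - a))\<^sup>2 * bump a (Suc M) R x = R\<^sup>2 * bump a (Suc M) R x - bump a (Suc (Suc M)) R x"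
    unfolding bump_def by (auto simp: max_def algebra_simps)
  have "(\<Sum>i\<in>UNIV. (bump a (Suc (Suc M)) R x
       - 2 * real (Suc (Suc M)) * ((x - a) $ i)\<^sup>2 * bump a (Suc M) R x))
     = real CARD('n) * bump a (Suc (Suc M)) R x
       - 2 * real (Suc (Suc M)) * ((\<Sum>i\<in>UNIV. ((x - a) $ i)\<^sup>2) * bump a (Suc M) R x)"
    by (simp add: sum_subtractf sum_distrib_left sum_distrib_right mult_ac)
  also have "\<dots> = real CARD('n) * bump a (Suc (Suc M)) R x
       - 2 * real (Suc (Suc M)) * (R\<^sup>2 * bump a (Suc M) R x - bump a (Suc (Suc M)) R x)"
    unfolding sum_components_power2 key ..
  finally have S: "(\<Sum>i\<in>UNIV. (bump a (Suc (Suc M)) R x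
       - 2 * real (Suc (Suc M)) * ((x - a) $ i)\<^sup>2 * bump a (Suc M) R x)) = \<dots>" .
  show ?thesis
    unfolding sum_distrib_left[symmetric] S by (simp add: algebra_simps)
qed

section \<open>Integration by parts against a test function\<close>

lemma integrable_bounded_support:
  fixes f :: "real ^ 'n::finite \<Rightarrow> real"
  assumes "continuous_on UNIV f" "\<And>x. norm (x - a) > R \<Longrightarrow> f x = 0"
  shows "integrable lborel f"
proof -
  have "integrable lborel (\<lambda>x. indicator (cball a R) x *\<^sub>R f x)"
    using assms(1) by (intro borel_integrable_compact) (auto intro: continuous_on_subset)
  also have "(\<lambda>x. indicator (cball a R) x *\<^sub>R f x) = f"
    using assms(2) by (auto simp: fun_eq_iff indicator_def dist_norm norm_minus_commute not_le)
  finally show ?thesis .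
qed

lemma lborel_integral_translate:
  fixes f :: "'a::euclidean_space \<Rightarrow> real"
  assumes [measurable]: "f \<in> borel_measurable borel"
  shows "(LINT x|lborel. f (x + c)) = (LINT x|lborel. f x)"
proof -
  have "(LINT x|lborel. f x) = (LINT x|distr lborel borel ((+) c). f x)"
    by (simp add: lborel_distr_plus)
  also have "\<dots> = (LINT x|lborel. f (c + x))"
    by (rule integral_distr) auto
  finally show ?thesis by (simp add: add.commute)
qed

lemma lborel_integrable_translate:
  fixes f :: "'a::euclidean_space \<Rightarrow> real"
  assumes "integrable lborel f"
  shows "integrable lborel (\<lambda>x. f (x + c))"
proof -
  have "integrable (distr lborel borel ((+) c)) f"
    by (simp add: lborel_distr_plus assms)
  then show ?thesis
    by (subst (asm) integrable_distr_eq) (use assms in \<open>auto simp: add.commute\<close>)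
qed

text \<open>The integral of \<open>f (x + t *\<^sub>R axis i 1)\<close> over x does not depend on t
  by translation invariance; its derivative at t = 0 is the integral of \<open>f'\<close>.\<close>

lemma integral_pd_eq_0:
  fixes f :: "real ^ 'n::finite \<Rightarrow> real"
  assumes pd: "has_pd i f f'" and c: "continuous_on UNIV f" "continuous_on UNIV f'"
    and supp: "\<And>x. norm (x - a) > R \<Longrightarrow> f x = 0" "\<And>x. norm (x - a) > R \<Longrightarrow> f' x = 0"
  shows "(LINT x|lborel. f' x) = 0"
proof -
  obtain C where C0: "0 \<le> C" and C: "\<And>x. x \<in> cball a R \<Longrightarrow> \<bar>f' x\<bar> \<le> C"
    using continuous_bounded_on_cball[OF c(2), of a R] by blast
  have bm: "f \<in> borel_measurable borel" using c by (auto intro: borel_measurable_continuous_onI)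
  have int: "integrable lborel f" by (rule integrable_bounded_support[OF c(1) supp(1)])
  have "((\<lambda>t. LINT x|lborel. f (x + t *\<^sub>R axis i 1)) has_field_derivative
      (LINT x|lborel. f' (x + 0 *\<^sub>R axis i 1))) (at 0)"
  \<comment> \<open>Translations of length below 1 keep the support within radius
    \<open>R + 1\<close>.\<close>
  proof (rule has_field_derivative_integral(1)[where d = 1 and h = "\<lambda>x. indicator (cball a (R + 1)) x * C"])
    show "integrable lborel (\<lambda>x. f (x + t *\<^sub>R axis i 1))" for t
      by (rule lborel_integrable_translate[OF int])
    show "((\<lambda>t. f (x + t *\<^sub>R axis i 1)) has_field_derivative f' (x + t *\<^sub>R axis i 1)) (at t)" for x t
      by (rule has_pd_along[OF pd])
    have "integrable lborel (\<lambda>x::real^'n. indicator (cball a (R + 1)) x *\<^sub>R C)"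
      by (intro borel_integrable_compact) auto
    then show "integrable lborel (\<lambda>x::real^'n. indicator (cball a (R + 1)) x * C)" by simp
    fix t :: real and x :: "real ^ 'n"
    assume t: "\<bar>t\<bar> < 1"
    let ?y = "x + t *\<^sub>R axis i 1"
    show "\<bar>f' ?y\<bar> \<le> indicator (cball a (R + 1)) x * C"
    proof (cases "norm (?y - a) > R")
      case True
      then show ?thesis using supp(2)[of ?y] C0 by (auto simp: indicator_def)
    next
      case False
      have "norm (x - a) \<le> norm (?y - a) + norm (t *\<^sub>R axis i (1::real))"
        using norm_triangle_ineq4[of "?y - a" "t *\<^sub>R axis i 1"] by simp
      also have "\<dots> \<le> R + 1" using False t by simp
      finally show ?thesis using C[of ?y] False
        by (simp add: indicator_def dist_norm norm_minus_commute)
    qed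
  qed simp
  moreover have "(\<lambda>t. LINT x|lborel. f (x + t *\<^sub>R axis i 1)) = (\<lambda>t. LINT x|lborel. f x)"
    using lborel_integral_translate[OF bm] by auto
  ultimately have "((\<lambda>t::real. LINT x|lborel. f x) has_field_derivative (LINT x|lborel. f' x)) (at 0)"
    by simp
  then show ?thesis using DERIV_unique[OF DERIV_const] by metis
qed

lemma integral_by_parts:
  fixes f :: "real ^ 'n::finite \<Rightarrow> real"
  assumes pd: "has_pd i f f'" "has_pd i g g'"
    and c: "continuous_on UNIV f" "continuous_on UNIV f'" "continuous_on UNIV g" "continuous_on UNIV g'"
    and supp: "\<And>x. norm (x - a) > R \<Longrightarrow> g x = 0" "\<And>x. norm (x - a) > R \<Longrightarrow> g' x = 0"
  shows "(LINT x|lborel. f' x * g x) = - (LINT x|lborel. f x * g' x)"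
proof -
  have "(LINT x|lborel. f' x * g x + f x * g' x) = 0"
    by (rule integral_pd_eq_0[OF has_pd_mult[OF pd], where a = a and R = R]) (use c supp in \<open>auto intro!: continuous_intros\<close>)
  moreover have "integrable lborel (\<lambda>x. f' x * g x)" "integrable lborel (\<lambda>x. f x * g' x)"
    by (rule integrable_bounded_support[where a = a and R = R]; use c supp in \<open>auto intro!: continuous_intros\<close>)+
  ultimately show ?thesis by simp
qed

lemma integrable_mult_bump:
  assumes "continuous_on UNIV f" "0 < M" "0 \<le> R"
  shows "integrable lborel (\<lambda>x. f x * bump a M R x)"
  using assms by (intro integrable_bounded_support[where a = a and R = R]) (auto intro!: continuous_intros bump_eq_0)

definition bump_integral :: "real ^ 'n::finite \<Rightarrow> nat \<Rightarrow> (real ^ 'n \<Rightarrow> real) \<Rightarrow> real \<Rightarrow> real" where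
  "bump_integral a M f R = (LINT x|lborel. f x * bump a M R x)"

text \<open>Two integrations by parts followed by \<open>laplacian_bump\<close>. The exponent
  \<open>M + 3\<close> leaves at least one power after two differentiations, so the second
  derivatives of the test function are continuous and vanish off the ball.\<close>

lemma bump_integral_neg_laplacian:
  fixes f :: "real ^ 'n::finite \<Rightarrow> real"
  assumes f: "f \<in> C_space (Suc (Suc 0))" and R: "0 \<le> R"
  shows "bump_integral a (M + 3) (neg_laplacian f) R
     = 2 * real (M + 3) * real (CARD('n) + 2 * M + 4) * bump_integral a (M + 2) f R
       - 4 * real (M + 3) * real (M + 2) * R\<^sup>2 * bump_integral a (M + 1) f R"
proof -
  let ?b = "bump a (Suc (Suc (Suc M))) R"
  let ?b1 = "\<lambda>i x. (- 2 * real (Suc (Suc (Suc M)))) * ((x - a) $ i * bump a (Suc (Suc M)) R x)"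
  let ?b2 = "\<lambda>i x. (- 2 * real (Suc (Suc (Suc M)))) * (bump a (Suc (Suc M)) R x
       - 2 * real (Suc (Suc M)) * ((x - a) $ i)\<^sup>2 * bump a (Suc M) R x)"
  have b0: "bump a (Suc (Suc M)) R x = 0" "bump a (Suc M) R x = 0" if "norm (x - a) > R" for x
    using that R by (auto intro!: bump_eq_0)
  have cf: "continuous_on UNIV f" by (rule C_space_continuous[OF f])
  have f1: "has_pd i f (partial_deriv i f)" "continuous_on UNIV (partial_deriv i f)"
    "has_pd i (partial_deriv i f) (partial_deriv i (partial_deriv i f))"
    "continuous_on UNIV (partial_deriv i (partial_deriv i f))" for i
    using C_space_SucD[OF f] C_space_SucD[OF C_space_SucD(2)[OF f]] C_space_continuous by blast+
  have 1: "(LINT x|lborel. partial_deriv i (partial_deriv i f) x * ?b x)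
     = - (LINT x|lborel. partial_deriv i f x * ?b1 i x)" for i
    by (rule integral_by_parts[OF f1(3) has_pd_bump f1(2,4), where a = a and R = R])
       (use R in \<open>auto intro!: continuous_intros bump_eq_0\<close>)
  have 2: "(LINT x|lborel. partial_deriv i f x * ?b1 i x) = - (LINT x|lborel. f x * ?b2 i x)" for i
    by (rule integral_by_parts[OF f1(1) has_pd_bump2 cf f1(2), where a = a and R = R])
       (auto intro!: continuous_intros simp: b0)
  have int1: "integrable lborel (\<lambda>x. partial_deriv i (partial_deriv i f) x * ?b x)" for i
    using R f1 by (intro integrable_mult_bump) auto
  have int2: "integrable lborel (\<lambda>x. f x * ?b2 i x)" for i
    using cf by (intro integrable_bounded_support[where a = a and R = R])
      (auto intro!: continuous_intros simp: b0)
  have "bump_integral a (Suc (Suc (Suc M))) (neg_laplacian f) R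
      = - (LINT x|lborel. (\<Sum>i\<in>UNIV. partial_deriv i (partial_deriv i f) x * ?b x))"
    unfolding bump_integral_def neg_laplacian_def by (simp add: sum_distrib_right)
  also have "\<dots> = - (\<Sum>i\<in>UNIV. LINT x|lborel. partial_deriv i (partial_deriv i f) x * ?b x)"
    by (subst Bochner_Integration.integral_sum) (use int1 in auto)
  also have "\<dots> = - (\<Sum>i\<in>UNIV. LINT x|lborel. f x * ?b2 i x)"
    unfolding 1 2 by simp
  also have "\<dots> = - (LINT x|lborel. (\<Sum>i\<in>UNIV. f x * ?b2 i x))"
    by (subst Bochner_Integration.integral_sum) (use int2 in auto)
  also have "\<dots> = - (LINT x|lborel. f x * (4 * real (M + 3) * real (M + 2) * R\<^sup>2 * bump a (Suc M) R x
      - 2 * real (M + 3) * real (CARD('n) + 2 * M + 4) * bump a (Suc (Suc M)) R x))"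
    unfolding sum_distrib_left[symmetric, of "f _"] laplacian_bump ..
  also have "\<dots> = - (LINT x|lborel. (4 * real (M + 3) * real (M + 2) * R\<^sup>2) * (f x * bump a (Suc M) R x)
      - (2 * real (M + 3) * real (CARD('n) + 2 * M + 4)) * (f x * bump a (Suc (Suc M)) R x))"
    by (intro arg_cong[of _ _ uminus] Bochner_Integration.integral_cong refl) (simp add: right_diff_distrib mult_ac)
  also have "\<dots> = - ((4 * real (M + 3) * real (M + 2) * R\<^sup>2) * bump_integral a (Suc M) f R
      - (2 * real (M + 3) * real (CARD('n) + 2 * M + 4)) * bump_integral a (Suc (Suc M)) f R)"
    unfolding bump_integral_def
    using integrable_mult_bump[OF cf _ R, of "Suc M" a] integrable_mult_bump[OF cf _ R, of "Suc (Suc M)" a]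
    by simp
  finally show ?thesis by (simp add: numeral_eq_Suc)
qed

section \<open>Monotonicity in R, normalised means and the descent\<close>

lemma has_field_derivative_bump_integral:
  fixes f :: "real ^ 'n::finite \<Rightarrow> real"
  assumes f: "continuous_on UNIV f" and R: "0 < R"
  shows "(bump_integral a (M + 2) f has_field_derivative 2 * real (M + 2) * R * bump_integral a (M + 1) f R) (at R)"
proof -
  \<comment> \<open>For \<open>\<bar>t\<bar> < R\<close> the radius \<open>R + t\<close> is below
    \<open>2 * R\<close>, so a single ball and a single bound serve for all t.\<close>
  let ?h = "\<lambda>x. indicator (cball a (2 * R)) x * (\<bar>f x\<bar> * (2 * real (M + 2) * (2 * R) * (2 * R) ^ (2 * (M + 1))))"
  have "((\<lambda>t. LINT x|lborel. f x * bump a (M + 2) (R + t) x) has_field_derivative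
      (LINT x|lborel. f x * (2 * real (M + 2) * (R + 0) * bump a (M + 1) (R + 0) x))) (at 0)"
  proof (rule has_field_derivative_integral(1)[where d = R and h = ?h])
    show "integrable lborel (\<lambda>x. f x * bump a (M + 2) (R + t) x)" if "\<bar>t\<bar> < R" for t
      using that R by (intro integrable_mult_bump f) auto
    have "((\<lambda>t. max 0 ((R + t)\<^sup>2 - (norm (x - a))\<^sup>2) ^ Suc (Suc M)) has_field_derivative
        (real (Suc (Suc M)) * max 0 ((R + t)\<^sup>2 - (norm (x - a))\<^sup>2) ^ Suc M) * (2 * (R + t))) (at t)" for x t
      by (rule DERIV_chain2[OF has_field_derivative_pos_part_power]) (auto intro!: derivative_eq_intros)
    then have "((\<lambda>t. bump a (M + 2) (R + t) x) has_field_derivative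
        (2 * real (M + 2) * (R + t) * bump a (M + 1) (R + t) x)) (at t)" for x t
      unfolding bump_def add_2_eq_Suc' Suc_eq_plus1[symmetric] by (rule DERIV_cong) (simp only: mult_ac)
    then show "((\<lambda>t. f x * bump a (M + 2) (R + t) x) has_field_derivative
        f x * (2 * real (M + 2) * (R + t) * bump a (M + 1) (R + t) x)) (at t)" for x t
      by (rule DERIV_cmult)
    have "integrable lborel (\<lambda>x. indicator (cball a (2 * R)) x *\<^sub>R (\<bar>f x\<bar> * (2 * real (M + 2) * (2 * R) * (2 * R) ^ (2 * (M + 1)))))"
      using f by (intro borel_integrable_compact continuous_intros) (auto intro: continuous_on_subset)
    then show "integrable lborel ?h" by simp
    fix t x assume t: "\<bar>t\<bar> < R"
    show "\<bar>f x * (2 * real (M + 2) * (R + t) * bump a (M + 1) (R + t) x)\<bar> \<le> ?h x"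
    proof (cases "x \<in> cball a (2 * R)")
      case True
      have "bump a (M + 1) (R + t) x \<le> (R + t) ^ (2 * (M + 1))" by (rule bump_le)
      also have "\<dots> \<le> (2 * R) ^ (2 * (M + 1))" using t by (intro power_mono) auto
      finally have b: "bump a (M + 1) (R + t) x \<le> (2 * R) ^ (2 * (M + 1))" .
      have "2 * real (M + 2) * (R + t) \<le> 2 * real (M + 2) * (2 * R)"
        using t by (intro mult_left_mono) auto
      then have "(2 * real (M + 2) * (R + t)) * bump a (M + 1) (R + t) x
          \<le> (2 * real (M + 2) * (2 * R)) * (2 * R) ^ (2 * (M + 1))"
        by (rule mult_mono[OF _ b]) (use R in \<open>auto simp: bump_nonneg\<close>)
      then show ?thesis using True t
        by (auto simp: abs_mult bump_nonneg abs_of_nonneg intro!: mult_left_mono)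
    next
      case False
      then have "bump a (M + 1) (R + t) x = 0" using t
        by (intro bump_eq_0) (auto simp: dist_norm norm_minus_commute)
      then show ?thesis using False by simp
    qed
  qed (use R in auto)
  then have "((\<lambda>t. bump_integral a (M + 2) f (R + t)) has_field_derivative
      2 * real (M + 2) * R * bump_integral a (M + 1) f R) (at 0)"
    unfolding bump_integral_def by (simp add: mult_ac flip: Bochner_Integration.integral_mult_right_zero)
  then show ?thesis
    using DERIV_shift[of "bump_integral a (M + 2) f" _ 0 R] by (simp add: add.commute)
qed

text \<open>The derivative in \<open>R\<close> is a negative multiple of \<open>bump_integral a (M + 3) (neg_laplacian f) R\<close>;
  the test functions are chosen such that this holds.\<close>

lemma superharmonic_bump_integral_antimono:
  fixes f :: "real ^ 'n::finite \<Rightarrow> real"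
  assumes f: "f \<in> C_space (Suc (Suc 0))" and sh: "\<And>x. 0 \<le> neg_laplacian f x"
    and r: "0 < r" "r \<le> R"
  shows "bump_integral a (M + 2) f R / R ^ (CARD('n) + 2 * M + 4)
    \<le> bump_integral a (M + 2) f r / r ^ (CARD('n) + 2 * M + 4)"
proof -
  let ?p = "CARD('n) + 2 * M + 4"
  let ?G = "\<lambda>R. bump_integral a (M + 2) f R / R ^ ?p"
  have "\<exists>y. (?G has_field_derivative y) (at \<rho>) \<and> y \<le> 0" if "r \<le> \<rho>" "\<rho> \<le> R" for \<rho>
  proof -
    have pos: "\<rho> > 0" using that r by simp
    let ?D = "2 * real (M + 2) * \<rho> * bump_integral a (M + 1) f \<rho>"
    let ?y = "(?D * \<rho> ^ ?p - bump_integral a (M + 2) f \<rho> * (real ?p * \<rho> ^ (?p - 1))) / (\<rho> ^ ?p * \<rho> ^ ?p)"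
    have "((\<lambda>R. R ^ ?p) has_field_derivative real ?p * \<rho> ^ (?p - 1)) (at \<rho>)"
      using DERIV_pow[of ?p \<rho> UNIV] by simp
    then have D: "(?G has_field_derivative ?y) (at \<rho>)"
      using pos by (intro DERIV_divide has_field_derivative_bump_integral C_space_continuous[OF f]) auto
    have "0 \<le> bump_integral a (M + 3) (neg_laplacian f) \<rho>"
      unfolding bump_integral_def using sh by (intro integral_nonneg_AE) (auto simp: bump_nonneg)
    then have "0 \<le> 2 * real (M + 3) * (real ?p * bump_integral a (M + 2) f \<rho>
        - 2 * real (M + 2) * \<rho>\<^sup>2 * bump_integral a (M + 1) f \<rho>)"
      using pos by (subst (asm) bump_integral_neg_laplacian[OF f]) (auto simp: algebra_simps)
    then have "0 \<le> real ?p * bump_integral a (M + 2) f \<rho>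
        - 2 * real (M + 2) * \<rho>\<^sup>2 * bump_integral a (M + 1) f \<rho>"
      by (subst (asm) zero_le_mult_iff) auto
    then have "?D * \<rho> ^ ?p - bump_integral a (M + 2) f \<rho> * (real ?p * \<rho> ^ (?p - 1)) \<le> 0"
    proof -
      have "\<rho> ^ ?p = \<rho> * \<rho> ^ (?p - 1)" by (simp add: add_ac flip: power_Suc)
      then have "?D * \<rho> ^ ?p - bump_integral a (M + 2) f \<rho> * (real ?p * \<rho> ^ (?p - 1))
        = - (\<rho> ^ (?p - 1) * (real ?p * bump_integral a (M + 2) f \<rho>
          - 2 * real (M + 2) * \<rho>\<^sup>2 * bump_integral a (M + 1) f \<rho>))"
        by (simp add: algebra_simps power2_eq_square)
      also have "\<dots> \<le> 0" using \<open>0 \<le> real ?p * _ - _\<close> pos by (simp only: neg_le_0_iff_le) (intro mult_nonneg_nonneg, auto)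
      finally show ?thesis .
    qed
    then have "?y \<le> 0" using pos by (intro divide_nonpos_pos) auto
    then show ?thesis using D by blast
  qed
  then show ?thesis by (rule DERIV_nonpos_imp_nonincreasing[OF r(2)])
qed

text \<open>By continuity \<open>f\<close> stays below \<open>f a / 2\<close> on a small ball, so
  the quotient is negative at its radius \<open>r\<close>; monotonicity then keeps it below that
  value for every larger R.\<close>

lemma superharmonic_negative_bump_integral:
  fixes f :: "real ^ 'n::finite \<Rightarrow> real"
  assumes f: "f \<in> C_space (Suc (Suc 0))" and sh: "\<And>x. 0 \<le> neg_laplacian f x"
    and neg: "f a < 0"
  shows "\<exists>c>0. \<exists>r>0. \<forall>R\<ge>r. bump_integral a (M + 2) f R / R ^ (CARD('n) + 2 * M + 4) \<le> - c"
proof -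
  have cf: "continuous_on UNIV f" by (rule C_space_continuous[OF f])
  then have "isCont f a" by (simp add: continuous_on_eq_continuous_at)
  then have "eventually (\<lambda>x. f x < f a / 2) (nhds a)"
    unfolding isCont_def tendsto_at_iff_tendsto_nhds by (rule order_tendstoD) (use neg in auto)
  then obtain r where r: "r > 0" "\<And>x. dist x a < r \<Longrightarrow> f x < f a / 2"
    by (auto simp: eventually_nhds_metric)
  let ?b = "bump a (M + 2) r"
  have intb: "integrable lborel ?b"
    using integrable_mult_bump[of "\<lambda>x. 1" "M + 2" r a] r by auto
  have "0 < (LINT x|lborel. ?b x)"
  proof -
    \<comment> \<open>On the half ball r^2 - |x - a|^2 is at least r^2 - r^2/4.\<close>
    have "(LINT x|lborel. indicator (ball a (r / 2)) x *\<^sub>R (3 * r\<^sup>2 / 4) ^ (M + 2)) \<le> (LINT x|lborel. ?b x)"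
    proof (rule integral_mono[OF _ intb])
      show "integrable lborel (\<lambda>x. indicator (ball a (r / 2)) x *\<^sub>R (3 * r\<^sup>2 / 4) ^ (M + 2))"
        using emeasure_lborel_ball_finite[of a "r / 2"] by (intro integrable_indicator) (auto simp: less_top)
      show "indicator (ball a (r / 2)) x *\<^sub>R (3 * r\<^sup>2 / 4) ^ (M + 2) \<le> ?b x" for x
      proof (cases "x \<in> ball a (r / 2)")
        case True
        then have "(norm (x - a))\<^sup>2 \<le> (r / 2)\<^sup>2"
          by (intro power_mono) (auto simp: dist_norm norm_minus_commute)
        then have "3 * r\<^sup>2 / 4 \<le> max 0 (r\<^sup>2 - (norm (x - a))\<^sup>2)"
          by (intro max.coboundedI2) (simp add: power_divide)
        then have "(3 * r\<^sup>2 / 4) ^ (M + 2) \<le> ?b x"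
          unfolding bump_def by (rule power_mono) auto
        then show ?thesis using True by simp
      qed (auto simp: bump_nonneg)
    qed
    moreover have "0 < (LINT x|lborel. indicator (ball a (r / 2)) x *\<^sub>R (3 * r\<^sup>2 / 4) ^ (M + 2))"
      using r by (simp add: content_ball_pos del: power_Suc power_add)
    ultimately show ?thesis by (rule order.strict_trans2[rotated])
  qed
  moreover have "bump_integral a (M + 2) f r \<le> (f a / 2) * (LINT x|lborel. ?b x)"
  proof -
    have "bump_integral a (M + 2) f r \<le> (LINT x|lborel. (f a / 2) * ?b x)"
      unfolding bump_integral_def
    proof (rule integral_mono)
      show "integrable lborel (\<lambda>x. f x * ?b x)" using r by (intro integrable_mult_bump cf) auto
      show "integrable lborel (\<lambda>x. (f a / 2) * ?b x)" using intb by simp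
      show "f x * ?b x \<le> (f a / 2) * ?b x" for x
      proof (cases "dist x a < r")
        case True
        then show ?thesis using r(2)[of x] by (intro mult_right_mono) (auto simp: bump_nonneg)
      next
        case False
        then have "?b x = 0" using r by (intro bump_eq_0) (auto simp: dist_norm)
        then show ?thesis by simp
      qed
    qed
    then show ?thesis by simp
  qed
  ultimately have neg': "bump_integral a (M + 2) f r < 0"
    using mult_neg_pos[of "f a / 2"] neg by force
  let ?c = "- (bump_integral a (M + 2) f r / r ^ (CARD('n) + 2 * M + 4))"
  have "?c > 0" using neg' r by (simp add: divide_neg_pos)
  moreover have "\<forall>R\<ge>r. bump_integral a (M + 2) f R / R ^ (CARD('n) + 2 * M + 4) \<le> - ?c"
    using superharmonic_bump_integral_antimono[OF f sh r(1)] by simp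
  ultimately show ?thesis using r(1) by blast
qed

text \<open>Up to a constant factor, the quotient is a mean of \<open>f\<close> over the ball of radius \<open>R\<close> about \<open>a\<close>,
  smoothened at the boundary. Each use of the Laplacian costs smoothness of the test function,
  hence the freedom in \<open>M0\<close>.\<close>

definition mean_bounded :: "real ^ 'n::finite \<Rightarrow> (real ^ 'n \<Rightarrow> real) \<Rightarrow> bool" where
  "mean_bounded a f \<longleftrightarrow> (\<exists>M0. \<forall>M\<ge>M0. \<exists>C. \<forall>\<^sub>F R in at_top.
     \<bar>bump_integral a M f R / R ^ (CARD('n) + 2 * M)\<bar> \<le> C)"

definition mean_vanishing :: "real ^ 'n::finite \<Rightarrow> (real ^ 'n \<Rightarrow> real) \<Rightarrow> bool" where
  "mean_vanishing a f \<longleftrightarrow> (\<exists>M0. \<forall>M\<ge>M0.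
     ((\<lambda>R. bump_integral a M f R / R ^ (CARD('n) + 2 * M)) \<longlongrightarrow> 0) at_top)"

lemma mean_vanishing_imp_bounded: "mean_vanishing a f \<Longrightarrow> mean_bounded a f"
proof -
  have "\<exists>C. \<forall>\<^sub>F R in at_top. \<bar>g R\<bar> \<le> C" if "(g \<longlongrightarrow> 0) at_top" for g :: "real \<Rightarrow> real"
  proof -
    have "\<forall>\<^sub>F R in at_top. dist (g R) 0 < 1" using that by (auto simp: tendsto_iff)
    then show ?thesis by (intro exI[of _ 1]) (auto elim: eventually_mono)
  qed
  then show "mean_vanishing a f \<Longrightarrow> mean_bounded a f"
    unfolding mean_vanishing_def mean_bounded_def by meson
qed

text \<open>Both terms of \<open>bump_integral_neg_laplacian\<close> are of order R^(n + 2M + 4),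
  whereas exponent \<open>M + 3\<close> is normalised by R^(n + 2M + 6): a gain of R^(-2). The
  threshold for the exponent rises by 3.\<close>

lemma mean_bounded_imp_vanishing_neg_laplacian:
  fixes f :: "real ^ 'n::finite \<Rightarrow> real"
  assumes f: "f \<in> C_space (Suc (Suc 0))" and bd: "mean_bounded a f"
  shows "mean_vanishing a (neg_laplacian f)"
proof -
  obtain M0 where M0: "\<And>M. M \<ge> M0 \<Longrightarrow> \<exists>C. \<forall>\<^sub>F R in at_top.
     \<bar>bump_integral a M f R / R ^ (CARD('n) + 2 * M)\<bar> \<le> C"
    using bd unfolding mean_bounded_def by blast
  let ?q = "\<lambda>M R. bump_integral a M f R / R ^ (CARD('n) + 2 * M)"
  have lim: "((\<lambda>R. bump_integral a (M + 3) (neg_laplacian f) R / R ^ (CARD('n) + 2 * (M + 3))) \<longlongrightarrow> 0) at_top"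
    if M: "M \<ge> M0" for M
  proof -
    obtain C where C: "\<forall>\<^sub>F R in at_top. \<bar>?q (M + 1) R\<bar> \<le> C" using M0[of "M + 1"] M by auto
    obtain D where D: "\<forall>\<^sub>F R in at_top. \<bar>?q (M + 2) R\<bar> \<le> D" using M0[of "M + 2"] M by auto
    let ?A = "2 * real (M + 3) * real (CARD('n) + 2 * M + 4)" and ?B = "4 * real (M + 3) * real (M + 2)"
    have "((\<lambda>R::real. (?A * D + ?B * C) / R\<^sup>2) \<longlongrightarrow> 0) at_top" by real_asymp
    then show ?thesis
    proof (rule Lim_null_comparison[rotated])
      show "\<forall>\<^sub>F R in at_top. norm (bump_integral a (M + 3) (neg_laplacian f) R / R ^ (CARD('n) + 2 * (M + 3)))
          \<le> (?A * D + ?B * C) / R\<^sup>2"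
        using C D eventually_gt_at_top[of 0]
      proof eventually_elim
        case (elim R)
        have R: "R > 0" using elim by simp
        have e: "bump_integral a (M + 3) (neg_laplacian f) R / R ^ (CARD('n) + 2 * (M + 3))
           = (?A * ?q (M + 2) R - ?B * ?q (M + 1) R) / R\<^sup>2"
        proof -
          have p: "R ^ (CARD('n) + 2 * (M + 3)) = R ^ (CARD('n) + 2 * (M + 1)) * (R\<^sup>2 * R\<^sup>2)"
            "R ^ (CARD('n) + 2 * (M + 2)) = R ^ (CARD('n) + 2 * (M + 1)) * R\<^sup>2"
            by (simp_all add: power_add[symmetric] del: power_Suc) (simp_all add: algebra_simps flip: power_Suc)
          show ?thesis
            unfolding p using R by (subst bump_integral_neg_laplacian[OF f]) (simp_all add: field_simps)
        qed
        have "\<bar>?A * ?q (M + 2) R - ?B * ?q (M + 1) R\<bar> \<le> \<bar>?A * ?q (M + 2) R\<bar> + \<bar>?B * ?q (M + 1) R\<bar>"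
          by (rule abs_triangle_ineq4)
        also have "\<dots> \<le> ?A * D + ?B * C"
          unfolding abs_mult using elim by (intro add_mono mult_mono) auto
        finally show ?case
          unfolding e real_norm_def abs_divide using R by (simp add: divide_right_mono)
      qed
    qed
  qed
  then have "((\<lambda>R. bump_integral a M (neg_laplacian f) R / R ^ (CARD('n) + 2 * M)) \<longlongrightarrow> 0) at_top"
    if ge: "M \<ge> M0 + 3" for M
  proof -
    obtain M' where "M = M' + 3" "M' \<ge> M0" using ge that[of "M - 3"] by simp
    then show ?thesis using lim[of M'] by simp
  qed
  then show ?thesis unfolding mean_vanishing_def by blast
qed

lemma mean_vanishing_neg_laplacian_power:
  assumes f: "f \<in> C_space (2 * i)" and "mean_vanishing a f"
  shows "mean_vanishing a ((neg_laplacian ^^ i) f)"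
  using assms
proof (induction i)
  case (Suc i)
  have "(neg_laplacian ^^ i) f \<in> C_space (Suc (Suc 0))"
    using Suc.prems(1) by (intro neg_laplacian_power_C_space) (simp add: eval_nat_numeral del: C_space.simps)
  moreover have "mean_vanishing a ((neg_laplacian ^^ i) f)"
    using Suc by (auto intro!: Suc.IH C_space_Suc_subset simp del: C_space.simps)
  ultimately show ?case
    using mean_bounded_imp_vanishing_neg_laplacian mean_vanishing_imp_bounded by auto
qed auto

lemma superharmonic_mean_vanishing_nonneg:
  fixes f :: "real ^ 'n::finite \<Rightarrow> real"
  assumes f: "f \<in> C_space (Suc (Suc 0))" and sh: "\<And>x. 0 \<le> neg_laplacian f x"
    and van: "mean_vanishing a f"
  shows "0 \<le> f a"
proof (rule ccontr)
  assume "\<not> 0 \<le> f a"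
  then have neg: "f a < 0" by simp
  obtain M where M: "((\<lambda>R. bump_integral a (M + 2) f R / R ^ (CARD('n) + 2 * (M + 2))) \<longlongrightarrow> 0) at_top"
    using van unfolding mean_vanishing_def by (meson le_add1)
  obtain c r where c: "c > 0" "\<And>R. R \<ge> r \<Longrightarrow> bump_integral a (M + 2) f R / R ^ (CARD('n) + 2 * M + 4) \<le> - c"
    using superharmonic_negative_bump_integral[OF f sh neg, of M] by blast
  have "\<forall>\<^sub>F R in at_top. bump_integral a (M + 2) f R / R ^ (CARD('n) + 2 * M + 4) \<le> - c"
    using c(2) by (auto simp: eventually_at_top_linorder)
  moreover have "((\<lambda>R. bump_integral a (M + 2) f R / R ^ (CARD('n) + 2 * M + 4)) \<longlongrightarrow> 0) at_top"
  proof -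
    have "CARD('n) + 2 * (M + 2) = CARD('n) + 2 * M + 4" by simp
    with M show ?thesis by (simp only:)
  qed
  ultimately have "0 \<le> - c"
    using tendsto_upperbound trivial_limit_at_top_linorder by blast
  then show False using c by simp
qed

text \<open>At each level two facts meet: superharmonicity comes from above, by downward induction
  starting at \<open>m\<close>, and vanishing means come from below, starting at \<open>f\<close>
  itself.\<close>

lemma neg_laplacian_power_nonneg_descent:
  fixes f :: "real ^ 'n::finite \<Rightarrow> real"
  assumes f: "f \<in> C_space (2 * m)" and van: "\<And>a. mean_vanishing a f"
    and top: "\<And>x. 0 \<le> (neg_laplacian ^^ m) f x" and "i \<le> m"
  shows "0 \<le> (neg_laplacian ^^ i) f x"
  using \<open>i \<le> m\<close>
proof (induction i arbitrary: x rule: inc_induct)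
  case base
  then show ?case by (rule top)
next
  case (step i)
  have A: "f \<in> C_space (2 * i + Suc (Suc 0))"
    by (rule C_space_mono[OF _ f]) (use step.hyps in auto)
  have B: "f \<in> C_space (2 * i)"
    by (rule C_space_mono[OF _ f]) (use step.hyps in auto)
  have "0 \<le> neg_laplacian ((neg_laplacian ^^ i) f) y" for y
    using step.IH[of y] by simp
  then show ?case
    by (rule superharmonic_mean_vanishing_nonneg[OF neg_laplacian_power_C_space[OF A] _
        mean_vanishing_neg_laplacian_power[OF B van]])
qed

section \<open>The local case\<close>

lemma integral_cball_const:
  fixes a :: "real ^ 'n::finite"
  assumes "0 \<le> R"
  shows "(LINT x|lborel. indicator (cball a R) x * c) = c * (unit_ball_vol (real CARD('n)) * R ^ CARD('n))"
    and "integrable lborel (\<lambda>x. indicator (cball a R) x * c)"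
proof -
  have "emeasure lborel (cball a R) < \<infinity>" by (rule emeasure_lborel_cball_finite)
  then show "integrable lborel (\<lambda>x. indicator (cball a R) x * c)"
    by (intro integrable_mult_left) (auto intro!: integrable_real_indicator)
  show "(LINT x|lborel. indicator (cball a R) x * c) = c * (unit_ball_vol (real CARD('n)) * R ^ CARD('n))"
    using content_cball[of R a] assms by simp
qed

text \<open>Off the unit ball about \<open>a\<close>, $u \le 1 + u^p$ and the kernel is at least $R^{-n}$ within distance \<open>R\<close>.\<close>

lemma mean_bounded_if_riesz_integrable:
  fixes u :: "real ^ 'n::finite \<Rightarrow> real"
  assumes cu: "continuous_on UNIV u" and nn: "\<And>x. 0 \<le> u x"
    and p: "1 \<le> p" and \<sigma>: "\<sigma> \<le> real CARD('n)"
    and int: "integrable lborel (riesz_integrand \<sigma> p u a)"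
  shows "mean_bounded a u"
proof -
  let ?n = "CARD('n)" and ?I = "LINT z|lborel. riesz_integrand \<sigma> p u a z"
  \<comment> \<open>The unit ball is treated by continuity, since for \<sigma> < 0 the kernel
    degenerates at \<open>a\<close> and bounds nothing there.\<close>
  obtain C where C0: "0 \<le> C" and "\<And>x. x \<in> cball a 1 \<Longrightarrow> \<bar>u x\<bar> \<le> C"
    using continuous_bounded_on_cball[OF cu, of a 1] by blast
  then have C: "\<And>x. x \<in> cball a 1 \<Longrightarrow> u x \<le> C" by force
  have ptw: "u x * bump a M R x \<le> R ^ (2 * M) * (indicator (cball a R) x * (1 + C) + R ^ ?n * riesz_integrand \<sigma> p u a x)"
    (is "_ \<le> _ * ?B") if R: "R \<ge> 1" and M: "0 < M" for M R x
  proof (cases "norm (x - a) \<ge> R")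
    case True
    then have "bump a M R x = 0" using M R by (intro bump_eq_0) auto
    then show ?thesis using R C0 by (auto simp: riesz_integrand_def intro!: mult_nonneg_nonneg add_nonneg_nonneg)
  next
    case False
    have r0: "0 \<le> R ^ ?n * riesz_integrand \<sigma> p u a x" using R by (simp add: riesz_integrand_def)
    have ind: "indicator (cball a R) x = (1::real)"
      using False by (simp add: dist_norm norm_minus_commute)
    have "u x \<le> ?B"
    proof (cases "norm (x - a) \<le> 1")
      case True
      then show ?thesis using C[of x] r0 ind by (simp add: dist_norm norm_minus_commute)
    next
      case gt: False
      let ?d = "norm (a - x)"
      have d: "1 < ?d" "?d \<le> R" using False gt by (simp_all add: norm_minus_commute)
      \<comment> \<open>Since \<open>1 < ?d\<close>, powers of \<open>?d\<close> increase with the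
        exponent; this covers negative \<sigma> as well.\<close>
      have "?d powr \<sigma> \<le> ?d powr real ?n" using d \<sigma> by (intro powr_mono) auto
      also have "\<dots> = ?d ^ ?n" by (rule powr_realpow) (use d in linarith)
      also have "\<dots> \<le> R ^ ?n" using d by (intro power_mono) auto
      finally have "?d powr \<sigma> \<le> R ^ ?n" .
      then have "u x powr p * 1 \<le> u x powr p * (R ^ ?n / ?d powr \<sigma>)"
        using d by (intro mult_left_mono) (auto simp: le_divide_eq)
      also have "\<dots> = R ^ ?n * riesz_integrand \<sigma> p u a x"
        by (simp add: riesz_integrand_def nn)
      finally have 1: "u x powr p \<le> R ^ ?n * riesz_integrand \<sigma> p u a x" by simp
      have "u x \<le> 1 + u x powr p"
      proof (cases "u x \<le> 1")
        case False
        then have "u x powr 1 \<le> u x powr p" using p by (intro powr_mono) auto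
        then show ?thesis using False by simp
      qed (simp add: add_increasing2)
      then show ?thesis using 1 C0 ind by simp
    qed
    moreover have "bump a M R x \<le> R ^ (2 * M)" by (rule bump_le)
    moreover have "0 \<le> ?B" using r0 C0 by (intro add_nonneg_nonneg) auto
    ultimately show ?thesis
      by (subst mult.commute[of "R ^ (2 * M)"]) (intro mult_mono, auto simp: bump_nonneg)
  qed
  let ?K = "(1 + C) * unit_ball_vol (real ?n) + ?I"
  have "\<forall>\<^sub>F R in at_top. \<bar>bump_integral a M u R / R ^ (?n + 2 * M)\<bar> \<le> ?K" if M: "M \<ge> 1" for M
    using eventually_ge_at_top[of 1]
  proof eventually_elim
    case (elim R)
    let ?B = "\<lambda>x. indicator (cball a R) x * (1 + C) + R ^ ?n * riesz_integrand \<sigma> p u a x"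
    have intB: "integrable lborel ?B"
      using int elim by (intro Bochner_Integration.integrable_add integral_cball_const) auto
    have "bump_integral a M u R \<le> (LINT x|lborel. R ^ (2 * M) * ?B x)"
      unfolding bump_integral_def
      using elim M ptw intB by (intro integral_mono integrable_mult_bump cu) auto
    also have "\<dots> = R ^ (2 * M) * ((1 + C) * (unit_ball_vol (real ?n) * R ^ ?n) + R ^ ?n * ?I)"
      using int elim integral_cball_const[of R a "1 + C"] by simp
    also have "\<dots> = ?K * R ^ (?n + 2 * M)"
      by (simp add: power_add algebra_simps)
    finally have "bump_integral a M u R \<le> ?K * R ^ (?n + 2 * M)" .
    moreover have "0 \<le> bump_integral a M u R"
      unfolding bump_integral_def using nn by (intro integral_nonneg_AE) (auto simp: bump_nonneg)
    ultimately show ?case using elim by (simp add: field_simps)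
  qed
  then show ?thesis unfolding mean_bounded_def by blast
qed

section \<open>Integrals of powers of the norm\<close>

lemma dyadic_scale_below:
  fixes t r :: real
  assumes "0 < t" "t \<le> r"
  obtains j :: nat where "r * (1/2) ^ Suc j < t" "t \<le> r * (1/2) ^ j"
proof -
  obtain k where "(1/2) ^ k < t / r"
    using real_arch_pow_inv[of "t / r" "1/2"] assms by auto
  then have ex: "\<exists>k. r * (1/2) ^ k < t"
    using assms by (auto simp: field_simps)
  define k where "k = (LEAST k. r * (1/2) ^ k < t)"
  have k: "r * (1/2) ^ k < t" unfolding k_def using ex by (rule LeastI_ex)
  then obtain j where j: "k = Suc j" using assms by (cases k) auto
  then have "\<not> r * (1/2) ^ j < t" using not_less_Least[of j "\<lambda>k. r * (1/2) ^ k < t"] k_def by simp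
  then show ?thesis using that[of j] k j by auto
qed

lemma dyadic_scale_above:
  fixes t r :: real
  assumes "0 < r" "r \<le> t"
  obtains j :: nat where "r * 2 ^ j \<le> t" "t < r * 2 ^ Suc j"
proof -
  obtain k where "t / r < 2 ^ k"
    using real_arch_pow[of 2 "t / r"] by auto
  then have ex: "\<exists>k. t < r * 2 ^ k"
    using assms by (auto simp: field_simps)
  define k where "k = (LEAST k. t < r * 2 ^ k)"
  have k: "t < r * 2 ^ k" unfolding k_def using ex by (rule LeastI_ex)
  then obtain j where j: "k = Suc j" using assms by (cases k) auto
  then have "\<not> t < r * 2 ^ j" using not_less_Least[of j "\<lambda>k. t < r * 2 ^ k"] k_def by simp
  then show ?thesis using that[of j] k j by auto
qed

text \<open>This takes the place of polar coordinates: \<open>f\<close> lies below the sum of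
  \<open>c j\<close> times the indicators of the balls, and the integrals of these terms form a
  geometric series.\<close>

lemma integral_le_dyadic_cover:
  fixes f :: "real ^ 'n::finite \<Rightarrow> real"
  assumes cover: "\<And>x. f x \<noteq> 0 \<Longrightarrow> \<exists>j. x \<in> cball 0 (\<rho> j) \<and> f x \<le> c j"
    and c: "\<And>j. 0 \<le> c j" and \<rho>: "\<And>j. 0 \<le> \<rho> j"
    and geo: "\<And>j. c j * \<rho> j ^ CARD('n) = A * q ^ j" and q: "0 \<le> q" "q < 1" and A: "0 \<le> A"
    and [measurable]: "f \<in> borel_measurable borel" and nn: "\<And>x. 0 \<le> f x"
  shows "integrable lborel f" "(LINT x|lborel. f x) \<le> unit_ball_vol (real CARD('n)) * A / (1 - q)"
proof -
  let ?V = "unit_ball_vol (real CARD('n))"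
  have V: "0 \<le> ?V" by simp
  have "(\<integral>\<^sup>+ x. ennreal (f x) \<partial>lborel) \<le> (\<integral>\<^sup>+ (x::real^'n). (\<Sum>j. ennreal (c j) * indicator (cball 0 (\<rho> j)) x) \<partial>lborel)"
  proof (rule nn_integral_mono)
    fix x :: "real ^ 'n"
    show "ennreal (f x) \<le> (\<Sum>j. ennreal (c j) * indicator (cball 0 (\<rho> j)) x)"
    proof (cases "f x = 0")
      case False
      then obtain j where j: "x \<in> cball 0 (\<rho> j)" "f x \<le> c j" using cover by blast
      then have "ennreal (f x) \<le> (\<Sum>j\<in>{j}. ennreal (c j) * indicator (cball 0 (\<rho> j)) x)"
        by (simp add: ennreal_leI)
      also have "\<dots> \<le> (\<Sum>j. ennreal (c j) * indicator (cball 0 (\<rho> j)) x)"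
        by (rule sum_le_suminf) auto
      finally show ?thesis .
    qed simp
  qed
  also have "\<dots> = (\<Sum>j. ennreal (c j) * emeasure lborel (cball (0::real^'n) (\<rho> j)))"
    proof (subst nn_integral_suminf)
    show "(\<lambda>x::real^'n. ennreal (c j) * indicator (cball 0 (\<rho> j)) x) \<in> borel_measurable lborel" for j
    proof -
      have [measurable]: "cball (0::real^'n) (\<rho> j) \<in> sets borel" by simp
      show ?thesis by measurable
    qed
  qed (simp add: nn_integral_cmult_indicator)
  also have "\<dots> = (\<Sum>j. ennreal (?V * A * q ^ j))"
  proof (intro arg_cong[of _ _ suminf] ext)
    fix j
    have "ennreal (c j) * emeasure lborel (cball (0::real^'n) (\<rho> j)) = ennreal (c j * (?V * \<rho> j ^ CARD('n)))"
      using c \<rho> by (simp add: emeasure_cball ennreal_mult)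
    also have "c j * (?V * \<rho> j ^ CARD('n)) = ?V * A * q ^ j"
      using geo[of j] by (simp add: mult_ac)
    finally show "ennreal (c j) * emeasure lborel (cball (0::real^'n) (\<rho> j)) = ennreal (?V * A * q ^ j)" .
  qed
  also have "\<dots> = ennreal (\<Sum>j. ?V * A * q ^ j)"
    using q A by (intro suminf_ennreal2) (auto intro!: summable_mult summable_geometric)
  also have "(\<Sum>j. ?V * A * q ^ j) = ?V * A / (1 - q)"
    using q by (subst suminf_mult) (auto simp: suminf_geometric summable_geometric)
  finally have bd: "(\<integral>\<^sup>+ x. ennreal (f x) \<partial>lborel) \<le> ennreal (?V * A / (1 - q))" .
  show int: "integrable lborel f"
  proof (rule integrableI_nonneg)
    show "(\<integral>\<^sup>+ x. ennreal (f x) \<partial>lborel) < \<infinity>"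
      using bd by (rule order.strict_trans1) simp
  qed (use nn in auto)
  have "ennreal (LINT x|lborel. f x) \<le> ennreal (?V * A / (1 - q))"
    using bd nn int by (subst nn_integral_eq_integral[symmetric]) auto
  then show "(LINT x|lborel. f x) \<le> ?V * A / (1 - q)"
    using q A by (subst (asm) ennreal_le_iff) auto
qed

text \<open>The point is the scaling in \<open>r\<close> with a constant independent of
  \<open>r\<close>; the radius of the test function is inserted for \<open>r\<close> later. The
  shells r/2^(j+1) < |x| \<le> r/2^j supply the dyadic cover.\<close>

lemma integral_norm_powr_ball:
  assumes t: "t \<le> 0" "- real CARD('n::finite) < t"
  shows "\<exists>C. \<forall>r>0. integrable lborel (\<lambda>x::real^'n. indicator (cball 0 r) x * norm x powr t) \<and>
     (LINT x|lborel. indicator (cball 0 r) (x::real^'n) * norm x powr t) \<le> C * r powr (real CARD('n) + t)"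
proof -
  let ?n = "CARD('n)" and ?f = "\<lambda>r x::real^'n. indicator (cball 0 r) x * norm x powr t"
  \<comment> \<open>Passing to the next shell multiplies the value by 2^(-t) and the volume by
    2^(-n); the ratio is below 1 because n + t > 0.\<close>
  define q where "q = (1/2::real) powr (real ?n + t)"
  let ?C = "unit_ball_vol (real ?n) * (1/2) powr t / (1 - q)"
  have q: "0 \<le> q" "q < 1"
    using t powr_less_mono2[of "real ?n + t" "1/2" 1] by (auto simp: q_def)
  have "integrable lborel (?f r) \<and> (LINT x|lborel. ?f r x) \<le> ?C * r powr (real ?n + t)" if r: "r > 0" for r
  proof -
    let ?\<rho> = "\<lambda>j. r * (1/2) ^ j" and ?c = "\<lambda>j. (r * (1/2) ^ Suc j) powr t"
    have cover: "\<exists>j. x \<in> cball 0 (?\<rho> j) \<and> ?f r x \<le> ?c j" if "?f r x \<noteq> 0" for x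
    proof -
      \<comment> \<open>The origin drops out since \<open>0 powr t = 0\<close>.\<close>
      from that have x: "0 < norm x" "norm x \<le> r" by (auto simp: indicator_def split: if_splits)
      then obtain j where j: "r * (1/2) ^ Suc j < norm x" "norm x \<le> r * (1/2) ^ j"
        by (rule dyadic_scale_below)
      have "norm x powr t \<le> ?c j"
        using j r t by (intro powr_mono2') auto
      then show ?thesis using j x by (intro exI[of _ j]) auto
    qed
    have geo: "?c j * ?\<rho> j ^ ?n = ((1/2) powr t * r powr (real ?n + t)) * q ^ j" for j
    proof -
      have "?c j * ?\<rho> j ^ ?n = (r * (1/2) ^ Suc j) powr t * (r * (1/2) ^ j) powr real ?n"
        using r by (simp add: powr_realpow)
      also have "\<dots> = (r * (1/2) * (1/2) ^ j) powr t * (r * (1/2) ^ j) powr real ?n"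
        by simp
      also have "\<dots> = (r powr t * (1/2) powr t * ((1/2) ^ j) powr t) * (r powr real ?n * ((1/2) ^ j) powr real ?n)"
        by (simp only: powr_mult)
      also have "\<dots> = (1/2) powr t * r powr (real ?n + t) * ((1/2) ^ j) powr (real ?n + t)"
        by (simp add: powr_add mult_ac)
      also have "((1/2::real) ^ j) powr (real ?n + t) = q ^ j"
        unfolding q_def by (simp add: powr_realpow[symmetric] powr_powr mult.commute)
      finally show ?thesis .
    qed
    have meas: "?f r \<in> borel_measurable borel"
      by (intro borel_measurable_times borel_measurable_divide powr_real_measurable
          borel_measurable_indicator borel_measurable_const borel_measurable_norm) simp_all
    note * = integral_le_dyadic_cover[of "?f r", OF cover _ _ geo q]
    have "integrable lborel (?f r)"
      by (rule *(1)) (use r meas in simp_all)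
    moreover have "(LINT x|lborel. ?f r x) \<le> unit_ball_vol (real ?n) * ((1/2) powr t * r powr (real ?n + t)) / (1 - q)"
      by (rule *(2)) (use r meas in simp_all)
    ultimately show ?thesis by (simp add: mult_ac)
  qed
  then show ?thesis by blast
qed

lemma integral_norm_powr_tail:
  assumes s: "real CARD('n::finite) < s"
  shows "\<exists>C. \<forall>r>0. integrable lborel (\<lambda>x::real^'n. indicator {x. r \<le> norm x} x / norm x powr s) \<and>
     (LINT x|lborel. indicator {x. r \<le> norm x} (x::real^'n) / norm x powr s) \<le> C * r powr (real CARD('n) - s)"
proof -
  let ?n = "CARD('n)" and ?f = "\<lambda>r x::real^'n. indicator {x. r \<le> norm x} x / norm x powr s"
  \<comment> \<open>The shells now grow outwards: volume times 2^n, value times 2^(-s).\<close>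
  define q where "q = (2::real) powr (real ?n - s)"
  let ?C = "unit_ball_vol (real ?n) * 2 powr real ?n / (1 - q)"
  have q: "0 \<le> q" "q < 1"
    using s by (auto simp: q_def powr_less_one)
  have "integrable lborel (?f r) \<and> (LINT x|lborel. ?f r x) \<le> ?C * r powr (real ?n - s)" if r: "r > 0" for r
  proof -
    let ?\<rho> = "\<lambda>j. r * 2 ^ Suc j" and ?c = "\<lambda>j. (r * 2 ^ j) powr (- s)"
    have cover: "\<exists>j. x \<in> cball 0 (?\<rho> j) \<and> ?f r x \<le> ?c j" if "?f r x \<noteq> 0" for x
    proof -
      from that have x: "r \<le> norm x" by (auto simp: indicator_def split: if_splits)
      then obtain j where j: "r * 2 ^ j \<le> norm x" "norm x < r * 2 ^ Suc j"
        by (rule dyadic_scale_above[OF r])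
      have "norm x powr (- s) \<le> ?c j"
        using j r s by (intro powr_mono2') auto
      then show ?thesis using j x by (intro exI[of _ j]) (auto simp: powr_minus_divide)
    qed
    have geo: "?c j * ?\<rho> j ^ ?n = (2 powr real ?n * r powr (real ?n - s)) * q ^ j" for j
    proof -
      have "?c j * ?\<rho> j ^ ?n = (r * 2 ^ j) powr (- s) * (r * 2 ^ Suc j) powr real ?n"
        using r by (simp add: powr_realpow)
      also have "\<dots> = (r powr (- s) * (2 ^ j) powr (- s)) * (r powr real ?n * 2 powr real ?n * (2 ^ j) powr real ?n)"
        using r by (simp add: powr_mult)
      also have "\<dots> = 2 powr real ?n * r powr (real ?n - s) * (2 ^ j) powr (real ?n - s)"
        by (simp add: powr_add mult_ac diff_conv_add_uminus del: add_uminus_conv_diff)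
      also have "((2::real) ^ j) powr (real ?n - s) = q ^ j"
        unfolding q_def by (simp add: powr_realpow[symmetric] powr_powr mult.commute)
      finally show ?thesis .
    qed
    have meas: "?f r \<in> borel_measurable borel"
      by (intro borel_measurable_times borel_measurable_divide powr_real_measurable
          borel_measurable_indicator borel_measurable_const borel_measurable_norm) simp_all
    note * = integral_le_dyadic_cover[of "?f r", OF cover _ _ geo q]
    have "integrable lborel (?f r)"
      by (rule *(1)) (use r meas in simp_all)
    moreover have "(LINT x|lborel. ?f r x) \<le> unit_ball_vol (real ?n) * (2 powr real ?n * r powr (real ?n - s)) / (1 - q)"
      by (rule *(2)) (use r meas in simp_all)
    ultimately show ?thesis by (simp add: mult_ac)
  qed
  then show ?thesis by blast
qed

section \<open>The weight of the tail space\<close>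

definition tail_weight :: "real \<Rightarrow> real ^ 'n::finite \<Rightarrow> real" where
  "tail_weight s x = 1 / (1 + norm x powr s)"

lemma tail_weight_pos: "0 < tail_weight s x"
  by (simp add: tail_weight_def add_pos_nonneg)

lemma tail_weight_nonneg [simp]: "0 \<le> tail_weight s x"
  by (rule less_imp_le[OF tail_weight_pos])

lemma tail_weight_minus [simp]: "tail_weight s (- x) = tail_weight s x"
  by (simp add: tail_weight_def)

lemma borel_measurable_tail_weight [measurable]: "tail_weight s \<in> borel_measurable borel"
  unfolding tail_weight_def by measurable

lemma inverse_norm_powr_le_tail_weight:
  assumes "0 < r" "r \<le> norm z" "0 < s"
  shows "1 / norm z powr s \<le> (1 + 1 / r powr s) * tail_weight s z"
proof -
  have "r powr s \<le> norm z powr s" using assms by (intro powr_mono2) auto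
  moreover have "0 < r powr s" using assms by simp
  ultimately have z: "0 < norm z powr s" "1 / norm z powr s \<le> 1 / r powr s"
    by (auto intro!: divide_left_mono mult_pos_pos)
  then have "(1 / norm z powr s) * (1 + norm z powr s) \<le> 1 + 1 / r powr s"
    by (simp add: field_simps)
  then show ?thesis using z(1)
    by (simp add: tail_weight_def pos_le_divide_eq add_pos_pos)
qed

text \<open>Since |y| is at most twice the larger of |y - x| and r, moving the centre costs only a
  constant, uniformly for x in a ball. Membership in the tail space thereby controls integrals
  centred at any point.\<close>

lemma tail_weight_shift:
  assumes s: "0 < s" and x: "norm x \<le> r"
  shows "tail_weight s (y - x) \<le> (1 + 2 powr s * r powr s + 2 powr s) * tail_weight s y"
proof -
  let ?C = "1 + 2 powr s * r powr s + 2 powr s" and ?m = "max (norm (y - x)) r"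
  have "norm y \<le> norm (y - x) + norm x" using norm_triangle_ineq[of "y - x" x] by simp
  then have "norm y \<le> 2 * ?m" using x by linarith
  then have "norm y powr s \<le> (2 * ?m) powr s" using s by (intro powr_mono2) auto
  also have "\<dots> = 2 powr s * ?m powr s" using order_trans[OF norm_ge_zero x] by (simp add: powr_mult)
  also have "?m powr s \<le> norm (y - x) powr s + r powr s"
    by (simp add: max_def)
  finally have "1 + norm y powr s \<le> 1 + 2 powr s * (norm (y - x) powr s + r powr s)" by simp
  also have "\<dots> \<le> ?C * (1 + norm (y - x) powr s)"
    by (simp add: algebra_simps)
  finally have "1 + norm y powr s \<le> ?C * (1 + norm (y - x) powr s)" .
  moreover have "0 < 1 + norm y powr s" "0 < 1 + norm (y - x) powr s"
    by (auto intro: add_pos_nonneg)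
  ultimately show ?thesis
    by (simp add: tail_weight_def field_simps)
qed

lemma integrable_tail_weight:
  assumes "real CARD('n::finite) < s"
  shows "integrable lborel (tail_weight s :: real ^ 'n \<Rightarrow> real)"
proof (rule Bochner_Integration.integrable_bound)
  let ?h = "\<lambda>x::real^'n. indicator (cball 0 1) x * 1 + indicator {x. 1 \<le> norm x} x / norm x powr s"
  show "integrable lborel ?h"
    using integral_norm_powr_tail[OF assms]
    by (intro Bochner_Integration.integrable_add integral_cball_const) (auto dest!: spec[of _ 1])
  show "AE x in lborel. norm (tail_weight s x) \<le> norm (?h x)"
  proof (rule AE_I2)
    fix x :: "real ^ 'n"
    have "tail_weight s x \<le> ?h x"
    proof (cases "norm x \<le> 1")
      case True
      then show ?thesis by (auto simp: tail_weight_def indicator_def field_simps add_pos_nonneg intro: add_increasing2)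
    next
      case False
      then have "0 < norm x powr s" by auto
      then have "1 / (1 + norm x powr s) \<le> 1 / norm x powr s" by (intro divide_left_mono) (auto simp: add_pos_pos)
      then show ?thesis using False by (simp add: tail_weight_def)
    qed
    then show "norm (tail_weight s x) \<le> norm (?h x)" by simp
  qed
qed simp

lemma L_space_iff: "u \<in> L_space \<alpha> \<longleftrightarrow>
    integrable lborel (\<lambda>x. \<bar>u x\<bar> * tail_weight (real CARD('n) + \<alpha>) (x :: real ^ 'n::finite))"
  by (simp add: L_space_def tail_weight_def)

lemma lborel_distr_reflect:
  fixes c :: "'a::euclidean_space"
  shows "distr lborel borel (\<lambda>x. c - x) = lborel"
  using lborel_affine[of "-1" c] by (simp add: density_1)

lemma lborel_integral_reflect:
  fixes f :: "'a::euclidean_space \<Rightarrow> real"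
  assumes [measurable]: "f \<in> borel_measurable borel"
  shows "(LINT x|lborel. f (c - x)) = (LINT x|lborel. f x)"
proof -
  have "(LINT x|lborel. f x) = (LINT x|distr lborel borel (\<lambda>x. c - x). f x)"
    by (simp add: lborel_distr_reflect)
  also have "\<dots> = (LINT x|lborel. f (c - x))"
    by (rule integral_distr) auto
  finally show ?thesis by simp
qed

lemma lborel_integrable_reflect:
  fixes f :: "'a::euclidean_space \<Rightarrow> real"
  assumes "integrable lborel f"
  shows "integrable lborel (\<lambda>x. f (c - x))"
proof -
  have "integrable (distr lborel borel (\<lambda>x. c - x)) f"
    by (simp add: lborel_distr_reflect assms)
  then show ?thesis
    by (subst (asm) integrable_distr_eq) (use assms in auto)
qed

lemma tail_weight_convolution:
  fixes u :: "real ^ 'n::finite \<Rightarrow> real"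
  assumes s: "0 < s" and x: "norm x \<le> r"
    and int: "integrable lborel (\<lambda>x. \<bar>u x\<bar> * tail_weight s x)"
    and [measurable]: "u \<in> borel_measurable borel"
  defines "C \<equiv> 1 + 2 powr s * r powr s + 2 powr s"
  shows "integrable lborel (\<lambda>z. tail_weight s z * \<bar>u (x + z)\<bar>)"
    and "integrable lborel (\<lambda>z. tail_weight s z * \<bar>u (x - z)\<bar>)"
    and "(LINT z|lborel. tail_weight s z * \<bar>u (x + z)\<bar>) \<le> C * (LINT y|lborel. \<bar>u y\<bar> * tail_weight s y)"
    and "(LINT z|lborel. tail_weight s z * \<bar>u (x - z)\<bar>) \<le> C * (LINT y|lborel. \<bar>u y\<bar> * tail_weight s y)"
proof -
  let ?g = "\<lambda>y. tail_weight s (y - x) * \<bar>u y\<bar>"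
  have le: "?g y \<le> C * (\<bar>u y\<bar> * tail_weight s y)" for y
    using mult_right_mono[OF tail_weight_shift[OF s x, of y], of "\<bar>u y\<bar>"] by (simp add: C_def mult_ac)
  have intC: "integrable lborel (\<lambda>y. C * (\<bar>u y\<bar> * tail_weight s y))" using int by simp
  have g: "integrable lborel ?g"
    by (rule Bochner_Integration.integrable_bound[OF intC])
       (use le in \<open>auto intro!: AE_I2 intro: order_trans[OF _ abs_ge_self]\<close>)
  have gle: "(LINT y|lborel. ?g y) \<le> C * (LINT y|lborel. \<bar>u y\<bar> * tail_weight s y)"
    using integral_mono[OF g intC le] by simp
  have p: "(\<lambda>z. tail_weight s z * \<bar>u (x + z)\<bar>) = (\<lambda>z. ?g (z + x))" by (simp add: add.commute)
  have m: "(\<lambda>z. tail_weight s z * \<bar>u (x - z)\<bar>) = (\<lambda>z. ?g (x - z))" by simp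
  have gm: "?g \<in> borel_measurable borel" by simp
  show "integrable lborel (\<lambda>z. tail_weight s z * \<bar>u (x + z)\<bar>)"
    unfolding p by (rule lborel_integrable_translate[OF g])
  show "integrable lborel (\<lambda>z. tail_weight s z * \<bar>u (x - z)\<bar>)"
    unfolding m by (rule lborel_integrable_reflect[OF g])
  show "(LINT z|lborel. tail_weight s z * \<bar>u (x + z)\<bar>) \<le> C * (LINT y|lborel. \<bar>u y\<bar> * tail_weight s y)"
    unfolding p by (subst lborel_integral_translate[OF gm]) (rule gle)
  show "(LINT z|lborel. tail_weight s z * \<bar>u (x - z)\<bar>) \<le> C * (LINT y|lborel. \<bar>u y\<bar> * tail_weight s y)"
    unfolding m by (subst lborel_integral_reflect[OF gm]) (rule gle)
qed

section \<open>The fractional Laplacian as an absolutely convergent integral\<close>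

definition second_diff :: "('a::real_normed_vector \<Rightarrow> real) \<Rightarrow> 'a \<Rightarrow> 'a \<Rightarrow> real" where
  "second_diff f x z = 2 * f x - f (x + z) - f (x - z)"

text \<open>One condition for both regimes \<alpha> < 1 and \<alpha> \<ge> 1: any \<delta> >
  \<alpha> makes the second difference integrable against |z|^(-n-\<alpha>) near the origin, whether
  or not \<open>f\<close> is differentiable.\<close>

definition second_diff_Hoelder :: "real \<Rightarrow> (real ^ 'n::finite \<Rightarrow> real) \<Rightarrow> bool" where
  "second_diff_Hoelder \<delta> f \<longleftrightarrow> continuous_on UNIV f \<and>
     (\<forall>r. \<exists>C\<ge>0. \<forall>x\<in>cball 0 r. \<forall>z\<in>cball 0 1. \<bar>second_diff f x z\<bar> \<le> C * norm z powr \<delta>)"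

lemma second_diff_zero [simp]: "second_diff f x 0 = 0"
  by (simp add: second_diff_def)

lemma borel_measurable_second_diff [measurable]:
  fixes f :: "'a::euclidean_space \<Rightarrow> real"
  assumes [measurable]: "f \<in> borel_measurable borel"
  shows "second_diff f x \<in> borel_measurable borel"
  unfolding second_diff_def by measurable

text \<open>Inside the unit ball the integrand is bounded by a multiple of |z|^(\<delta>-s), with
  \<delta> - s > -n; outside, the tail weight takes over. The upper bound on \<delta> makes this
  exponent nonpositive, as \<open>integral_norm_powr_ball\<close> expects. The uniformity in x
  serves the Fubini argument later on.\<close>

lemma second_diff_integrable:
  fixes u :: "real ^ 'n::finite \<Rightarrow> real"
  assumes \<alpha>: "0 < \<alpha>" "\<alpha> < \<delta>" "\<delta> \<le> real CARD('n) + \<alpha>"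
    and u: "second_diff_Hoelder \<delta> u" "u \<in> L_space \<alpha>"
  defines "s \<equiv> real CARD('n) + \<alpha>"
  shows "\<exists>C. \<forall>x\<in>cball 0 r. integrable lborel (\<lambda>z. second_diff u x z / norm z powr s) \<and>
     (LINT z|lborel. \<bar>second_diff u x z / norm z powr s\<bar>) \<le> C"
proof (cases "0 \<le> r")
  case False
  then have "cball (0::real^'n) r = {}" by simp
  then show ?thesis by blast
next
  case r: True
  have s: "0 < s" "real CARD('n) < s" using \<alpha> by (auto simp: s_def)
  have cu: "continuous_on UNIV u" using u(1) by (simp add: second_diff_Hoelder_def)
  then have [measurable]: "u \<in> borel_measurable borel" by (rule borel_measurable_continuous_onI)
  have uL: "integrable lborel (\<lambda>x. \<bar>u x\<bar> * tail_weight s x)"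
    using u(2) by (simp add: L_space_iff s_def)
  obtain C where C0: "0 \<le> C" and C: "\<And>x z. x \<in> cball 0 r \<Longrightarrow> z \<in> cball 0 1 \<Longrightarrow> \<bar>second_diff u x z\<bar> \<le> C * norm z powr \<delta>"
    using u(1) unfolding second_diff_Hoelder_def by meson
  obtain U where U0: "0 \<le> U" and U: "\<And>x. x \<in> cball 0 r \<Longrightarrow> \<bar>u x\<bar> \<le> U"
    using continuous_bounded_on_cball[OF cu, of 0 r] by blast
  let ?k = "\<lambda>z::real^'n. indicator (cball 0 1) z * norm z powr (\<delta> - s)"
  define H where "H x z = C * ?k z + 2 * (2 * U * tail_weight s z
      + tail_weight s z * \<bar>u (x + z)\<bar> + tail_weight s z * \<bar>u (x - z)\<bar>)" for x z
  have le: "\<bar>second_diff u x z / norm z powr s\<bar> \<le> H x z" if x: "x \<in> cball 0 r" for x z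
  proof -
    have n1: "0 \<le> C * ?k z" using C0 by simp
    have n2: "0 \<le> 2 * (2 * U * tail_weight s z
      + tail_weight s z * \<bar>u (x + z)\<bar> + tail_weight s z * \<bar>u (x - z)\<bar>)"
      using U0 by (intro mult_nonneg_nonneg add_nonneg_nonneg) auto
    show ?thesis
    proof (cases "z \<in> cball 0 1")
      case True
      have "\<bar>second_diff u x z / norm z powr s\<bar> \<le> C * norm z powr \<delta> / norm z powr s"
        using C[OF x True] by (simp add: abs_divide divide_right_mono)
      also have "\<dots> = C * ?k z" using True by (simp add: powr_diff)
      finally show ?thesis unfolding H_def using n2 by linarith
    next
      case False
      have "1 / norm z powr s \<le> 2 * tail_weight s z"
        using inverse_norm_powr_le_tail_weight[of 1 z s] False s by simp
      moreover have "\<bar>second_diff u x z\<bar> \<le> 2 * U + \<bar>u (x + z)\<bar> + \<bar>u (x - z)\<bar>"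
        using U[OF x] unfolding second_diff_def by linarith
      ultimately have "\<bar>second_diff u x z\<bar> * (1 / norm z powr s) \<le>
          (2 * U + \<bar>u (x + z)\<bar> + \<bar>u (x - z)\<bar>) * (2 * tail_weight s z)"
        by (intro mult_mono) auto
      then have "\<bar>second_diff u x z / norm z powr s\<bar> \<le> 2 * (2 * U * tail_weight s z
          + tail_weight s z * \<bar>u (x + z)\<bar> + tail_weight s z * \<bar>u (x - z)\<bar>)"
        by (simp add: abs_divide algebra_simps)
      then show ?thesis unfolding H_def using n1 by linarith
    qed
  qed
  have k: "integrable lborel ?k"
    using integral_norm_powr_ball[of "\<delta> - s", where 'n = 'n] \<alpha> by (auto simp: s_def)
  have w: "integrable lborel (tail_weight s :: real ^ 'n \<Rightarrow> real)" by (rule integrable_tail_weight[OF s(2)])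
  let ?c = "1 + 2 powr s * r powr s + 2 powr s" and ?I = "LINT y|lborel. \<bar>u y\<bar> * tail_weight s y"
  let ?B = "C * (LINT z|lborel. ?k z) + 2 * (2 * U * (LINT z::real^'n|lborel. tail_weight s z) + ?c * ?I + ?c * ?I)"
  have "integrable lborel (\<lambda>z. second_diff u x z / norm z powr s) \<and>
     (LINT z|lborel. \<bar>second_diff u x z / norm z powr s\<bar>) \<le> ?B" if x: "x \<in> cball 0 r" for x
  proof -
    have nx: "norm x \<le> r" using x by simp
    note conv = tail_weight_convolution[OF s(1) nx uL]
    have H: "integrable lborel (H x)"
      unfolding H_def using k w conv(1,2) by (intro Bochner_Integration.integrable_add integrable_mult_right) simp_all
    have int: "integrable lborel (\<lambda>z. second_diff u x z / norm z powr s)"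
      by (rule Bochner_Integration.integrable_bound[OF H])
         (use le[OF x] in \<open>auto intro!: AE_I2 intro: order_trans[OF _ abs_ge_self]\<close>)
    have "(LINT z|lborel. \<bar>second_diff u x z / norm z powr s\<bar>) \<le> (LINT z|lborel. H x z)"
      using le[OF x] by (intro integral_mono H integrable_abs int)
    also have "\<dots> = C * (LINT z|lborel. ?k z) + 2 * (2 * U * (LINT z::real^'n|lborel. tail_weight s z)
        + (LINT z|lborel. tail_weight s z * \<bar>u (x + z)\<bar>) + (LINT z|lborel. tail_weight s z * \<bar>u (x - z)\<bar>))"
      unfolding H_def using k w conv(1,2) by simp
    also have "\<dots> \<le> ?B" by (intro add_mono mult_left_mono conv(3,4) order_refl) simp_all
    finally show ?thesis using int by blast
  qed
  then show ?thesis by blast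
qed

lemma truncated_difference_integrable:
  fixes u :: "real ^ 'n::finite \<Rightarrow> real"
  assumes \<alpha>: "0 < \<alpha>" and cu: "continuous_on UNIV u" and u: "u \<in> L_space \<alpha>" and e: "0 < e"
  defines "s \<equiv> real CARD('n) + \<alpha>"
  shows "integrable lborel (\<lambda>z. indicator {z. e \<le> norm z} z * ((u x - u (x + z)) / norm z powr s))"
    and "integrable lborel (\<lambda>z. indicator {z. e \<le> norm z} z * ((u x - u (x - z)) / norm z powr s))"
proof -
  have s: "0 < s" "real CARD('n) < s" using \<alpha> by (auto simp: s_def)
  have [measurable]: "u \<in> borel_measurable borel" using cu by (rule borel_measurable_continuous_onI)
  have uL: "integrable lborel (\<lambda>x. \<bar>u x\<bar> * tail_weight s x)"
    using u by (simp add: L_space_iff s_def)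
  note conv = tail_weight_convolution[OF s(1) order_refl[of "norm x"] uL]
  let ?c = "1 + 1 / e powr s"
  have c0: "0 \<le> ?c" by simp
  have bd: "\<bar>indicator {z. e \<le> norm z} z * ((u x - v) / norm z powr s)\<bar> \<le>
     ?c * (\<bar>u x\<bar> * tail_weight s z + tail_weight s z * \<bar>v\<bar>)" for v z
  proof (cases "e \<le> norm z")
    case True
    have "\<bar>u x - v\<bar> * (1 / norm z powr s) \<le> (\<bar>u x\<bar> + \<bar>v\<bar>) * (?c * tail_weight s z)"
      using inverse_norm_powr_le_tail_weight[OF e True s(1)] by (intro mult_mono) auto
    then show ?thesis using True by (simp add: abs_divide algebra_simps add_divide_distrib)
  next
    case False
    have "0 \<le> ?c * (\<bar>u x\<bar> * tail_weight s z + tail_weight s z * \<bar>v\<bar>)"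
      using c0 by (intro mult_nonneg_nonneg add_nonneg_nonneg) auto
    then show ?thesis using False by simp
  qed
  have w: "integrable lborel (tail_weight s :: real ^ 'n \<Rightarrow> real)" by (rule integrable_tail_weight[OF s(2)])
  have H: "integrable lborel (\<lambda>z. ?c * (\<bar>u x\<bar> * tail_weight s z + tail_weight s z * \<bar>u (x + z)\<bar>))"
    "integrable lborel (\<lambda>z. ?c * (\<bar>u x\<bar> * tail_weight s z + tail_weight s z * \<bar>u (x - z)\<bar>))"
    using w conv(1,2) by (intro integrable_mult_right Bochner_Integration.integrable_add; simp)+
  show "integrable lborel (\<lambda>z. indicator {z. e \<le> norm z} z * ((u x - u (x + z)) / norm z powr s))"
    by (rule Bochner_Integration.integrable_bound[OF H(1)])
       (use bd in \<open>auto intro!: AE_I2 simp del: abs_mult intro: order_trans[OF _ abs_ge_self]\<close>)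
  show "integrable lborel (\<lambda>z. indicator {z. e \<le> norm z} z * ((u x - u (x - z)) / norm z powr s))"
    by (rule Bochner_Integration.integrable_bound[OF H(2)])
       (use bd in \<open>auto intro!: AE_I2 simp del: abs_mult intro: order_trans[OF _ abs_ge_self]\<close>)
qed

text \<open>Averaging the truncated integral with its reflection about \<open>x\<close> turns the principal value
  into an absolutely convergent integral.\<close>

lemma frac_laplacian_eq_integral:
  fixes u :: "real ^ 'n::finite \<Rightarrow> real"
  assumes \<alpha>: "0 < \<alpha>" "\<alpha> < 2" "\<alpha> < \<delta>" "\<delta> \<le> real CARD('n) + \<alpha>"
    and u: "second_diff_Hoelder \<delta> u" "u \<in> L_space \<alpha>"
  shows "frac_laplacian \<alpha> u x = frac_laplacian_const TYPE('n) \<alpha> / 2 *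
     (LINT z|lborel. second_diff u x z / norm z powr (real CARD('n) + \<alpha>))"
proof -
  let ?s = "real CARD('n) + \<alpha>"
  let ?A = "\<lambda>e. {z::real^'n. e \<le> norm z}"
  let ?J = "\<lambda>z. second_diff u x z / norm z powr ?s"
  have cu: "continuous_on UNIV u" using u(1) by (simp add: second_diff_Hoelder_def)
  then have [measurable]: "u \<in> borel_measurable borel" by (rule borel_measurable_continuous_onI)
  have J: "integrable lborel ?J"
    using second_diff_integrable[OF \<alpha>(1,3,4) u, of "norm x"] by auto
  let ?P = "\<lambda>e. LINT y:{y. e \<le> norm (y - x)}|lborel. (u x - u y) / norm (x - y) powr ?s"
  have P: "?P e = (1/2) * (LINT z|lborel. indicator (?A e) z * ?J z)" if e: "0 < e" for e
  proof -
    let ?f = "\<lambda>y. indicator {y. e \<le> norm (y - x)} y * ((u x - u y) / norm (x - y) powr ?s)"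
    let ?p = "\<lambda>z. indicator (?A e) z * ((u x - u (x + z)) / norm z powr ?s)"
    let ?m = "\<lambda>z. indicator (?A e) z * ((u x - u (x - z)) / norm z powr ?s)"
    have [measurable]: "?f \<in> borel_measurable borel" by measurable
    have f: "?P e = (LINT y|lborel. ?f y)"
      by (simp add: set_lebesgue_integral_def)
    have "(LINT y|lborel. ?f y) = (LINT z|lborel. ?f (z + x))"
      by (rule lborel_integral_translate[symmetric]) simp
    also have "(\<lambda>z. ?f (z + x)) = ?p"
      by (auto simp: fun_eq_iff indicator_def add.commute)
    finally have p: "?P e = (LINT z|lborel. ?p z)" using f by simp
    have "(LINT y|lborel. ?f y) = (LINT z|lborel. ?f (x - z))"
      by (rule lborel_integral_reflect[symmetric]) simp
    also have "(\<lambda>z. ?f (x - z)) = ?m"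
      by (auto simp: fun_eq_iff indicator_def)
    finally have m: "?P e = (LINT z|lborel. ?m z)" using f by simp
    have "(LINT z|lborel. ?p z) + (LINT z|lborel. ?m z) = (LINT z|lborel. ?p z + ?m z)"
      using truncated_difference_integrable[OF \<alpha>(1) cu u(2) e] by simp
    also have "(\<lambda>z. ?p z + ?m z) = (\<lambda>z. indicator (?A e) z * ?J z)"
      by (auto simp: fun_eq_iff second_diff_def diff_divide_distrib add_divide_distrib indicator_def)
    finally show ?thesis using p m by simp
  qed
  have lim: "((\<lambda>e. (1/2) * (LINT z|lborel. indicator (?A e) z * ?J z)) \<longlongrightarrow> (1/2) * (LINT z|lborel. ?J z)) (at_right 0)"
  proof (intro tendsto_mult_left)
    show "((\<lambda>e. LINT z|lborel. indicator (?A e) z * ?J z) \<longlongrightarrow> (LINT z|lborel. ?J z)) (at_right 0)"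
      unfolding tendsto_at_iff_sequentially comp_def
    proof (intro allI impI)
      fix X :: "nat \<Rightarrow> real" assume X: "\<forall>i. X i \<in> {0<..} - {0}" "X \<longlonglongrightarrow> 0"
      show "(\<lambda>k. LINT z|lborel. indicator (?A (X k)) z * ?J z) \<longlonglongrightarrow> (LINT z|lborel. ?J z)"
      proof (rule integral_dominated_convergence[where w = "\<lambda>z. \<bar>?J z\<bar>"])
        show "AE z in lborel. (\<lambda>k. indicator (?A (X k)) z * ?J z) \<longlonglongrightarrow> ?J z"
        proof (rule AE_I2)
          fix z
          show "(\<lambda>k. indicator (?A (X k)) z * ?J z) \<longlonglongrightarrow> ?J z"
          \<comment> \<open>Each z other than 0 is eventually outside the removed ball; at z = 0 the
            second difference vanishes.\<close>
          proof (cases "z = 0")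
            case False
            then have "\<forall>\<^sub>F k in sequentially. X k < norm z"
              using order_tendstoD(2)[OF X(2), of "norm z"] by simp
            then have "\<forall>\<^sub>F k in sequentially. indicator (?A (X k)) z * ?J z = ?J z"
              by (rule eventually_mono) (auto simp: indicator_def)
            then show ?thesis by (rule tendsto_eventually)
          qed simp
        qed
        show "AE z in lborel. norm (indicator (?A (X k)) z * ?J z) \<le> \<bar>?J z\<bar>" for k
          by (auto simp: indicator_def)
      qed (use J integrable_abs[OF J] in \<open>auto simp del: abs_divide\<close>)
    qed
  qed
  have "(?P \<longlongrightarrow> (1/2) * (LINT z|lborel. ?J z)) (at_right 0)"
    by (rule Lim_transform_eventually[OF lim])
       (use P in \<open>auto simp: eventually_at_right_field intro!: exI[of _ 1]\<close>)
  then have "Lim (at_right 0) ?P = (1/2) * (LINT z|lborel. ?J z)"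
    by (intro tendsto_Lim) auto
  then show ?thesis using \<alpha>(2) by (simp add: frac_laplacian_def)
qed

section \<open>The fractional Laplacian of a test function\<close>

text \<open>Two mean value steps express the second difference by \<open>h'\<close> at one point in
  (0, 1) and one in (-1, 0). These are less than 2 apart, whence the factor 2 in the third
  step.\<close>

lemma second_diff_le_of_second_deriv:
  fixes h h' h'' :: "real \<Rightarrow> real"
  assumes h: "\<And>t. (h has_field_derivative h' t) (at t)"
    and h': "\<And>t. (h' has_field_derivative h'' t) (at t)"
    and B: "\<And>t. \<bar>h'' t\<bar> \<le> B"
  shows "\<bar>2 * h 0 - h 1 - h (-1)\<bar> \<le> 2 * B"
proof -
  obtain a where a: "0 < a" "a < 1" "h 1 - h 0 = (1 - 0) * h' a"
    using MVT2[of 0 1 h h'] h by auto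
  obtain b where b: "-1 < b" "b < 0" "h 0 - h (-1) = (0 - (-1)) * h' b"
    using MVT2[of "-1" 0 h h'] h by auto
  obtain c where c: "b < c" "c < a" "h' a - h' b = (a - b) * h'' c"
    using MVT2[of b a h' h''] h' a b by auto
  have "2 * h 0 - h 1 - h (-1) = - ((a - b) * h'' c)" using a b c by simp
  also have "\<bar>\<dots>\<bar> \<le> 2 * B"
    unfolding abs_minus_cancel abs_mult using a b B[of c] by (intro mult_mono) auto
  finally show ?thesis .
qed

lemma has_field_derivative_bump_line:
  fixes a :: "real ^ 'n::finite"
  shows "((\<lambda>t. bump a (Suc (Suc M)) R (x + t *\<^sub>R z)) has_field_derivative
     (- 2 * real (Suc (Suc M))) * (((x - a + t *\<^sub>R z) \<bullet> z) * bump a (Suc M) R (x + t *\<^sub>R z))) (at t)"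
proof -
  have e: "(norm (x + t *\<^sub>R z - a))\<^sup>2 = (norm (x - a))\<^sup>2 + 2 * t * ((x - a) \<bullet> z) + t\<^sup>2 * (norm z)\<^sup>2" for t
    unfolding power2_norm_eq_inner
    by (simp add: inner_left_distrib inner_right_distrib inner_diff_left inner_diff_right inner_commute
        algebra_simps power2_eq_square)
  let ?g = "\<lambda>t. R\<^sup>2 - ((norm (x - a))\<^sup>2 + 2 * t * ((x - a) \<bullet> z) + t\<^sup>2 * (norm z)\<^sup>2)"
  have g: "(?g has_field_derivative - 2 * ((x - a + t *\<^sub>R z) \<bullet> z)) (at t)"
    by (auto intro!: derivative_eq_intros simp: inner_left_distrib power2_norm_eq_inner)
  have "((\<lambda>t. max 0 (?g t) ^ Suc (Suc M)) has_field_derivative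
      (real (Suc (Suc M)) * max 0 (?g t) ^ Suc M) * (- 2 * ((x - a + t *\<^sub>R z) \<bullet> z))) (at t)"
    by (rule DERIV_chain2[OF has_field_derivative_pos_part_power g])
  then show ?thesis
    unfolding bump_def e by (rule DERIV_cong) (simp only: mult_ac)
qed

text \<open>The second derivative along the line through x in direction z has two terms. On the
  support |x - a + tz| < R, so the squared inner product is at most R^2 |z|^2, and both terms have
  order R^(2(M+2)) |z|^2.\<close>

lemma second_diff_bump_le:
  fixes a :: "real ^ 'n::finite"
  assumes R: "0 \<le> R"
  shows "\<bar>second_diff (bump a (M + 3) R) x z\<bar> \<le>
     (4 * real (M + 3) * (2 * real (M + 3))) * (R ^ (2 * (M + 2)) * (norm z)\<^sup>2)"
proof -
  let ?k = "real (Suc (Suc (Suc M)))" and ?l = "real (Suc (Suc M))"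
  let ?y = "\<lambda>t. x - a + t *\<^sub>R z" and ?b = "\<lambda>M t. bump a M R (x + t *\<^sub>R z)"
  let ?h'' = "\<lambda>t. (- 2 * ?k) * ((norm z)\<^sup>2 * ?b (Suc (Suc M)) t
     + (?y t \<bullet> z) * ((- 2 * ?l) * ((?y t \<bullet> z) * ?b (Suc M) t)))"
  let ?B = "(2 * ?k) * (R ^ (2 * (M + 2)) * (norm z)\<^sup>2 + 2 * ?l * (R ^ (2 * (M + 2)) * (norm z)\<^sup>2))"
  have d1: "((\<lambda>t. ?b (Suc (Suc (Suc M))) t) has_field_derivative (- 2 * ?k) * ((?y t \<bullet> z) * ?b (Suc (Suc M)) t)) (at t)" for t
    by (rule has_field_derivative_bump_line)
  have d2: "((\<lambda>t. (- 2 * ?k) * ((?y t \<bullet> z) * ?b (Suc (Suc M)) t)) has_field_derivative ?h'' t) (at t)" for t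
  proof (rule DERIV_cmult)
    have "((\<lambda>t. ?y t \<bullet> z) has_field_derivative (norm z)\<^sup>2) (at t)"
      unfolding inner_left_distrib by (auto intro!: derivative_eq_intros simp: power2_norm_eq_inner)
    from DERIV_mult[OF this has_field_derivative_bump_line[of a M R x z t]]
    show "((\<lambda>t. (?y t \<bullet> z) * ?b (Suc (Suc M)) t) has_field_derivative
        ((norm z)\<^sup>2 * ?b (Suc (Suc M)) t + (?y t \<bullet> z) * ((- 2 * ?l) * ((?y t \<bullet> z) * ?b (Suc M) t)))) (at t)"
      by (rule DERIV_cong) (simp add: mult_ac)
  qed
  have bd: "\<bar>?h'' t\<bar> \<le> ?B" for t
  proof -
    have b1: "?b (Suc (Suc M)) t \<le> R ^ (2 * (M + 2))"
      using bump_le[of a "M + 2" R "x + t *\<^sub>R z"] by simp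
    have "(?y t \<bullet> z)\<^sup>2 * ?b (Suc M) t \<le> R ^ (2 * (M + 2)) * (norm z)\<^sup>2"
    proof (cases "R \<le> norm (?y t)")
      case True
      then have "?b (Suc M) t = 0"
        using R by (intro bump_eq_0) (auto simp: algebra_simps)
      then show ?thesis using R by simp
    next
      case False
      have "(?y t \<bullet> z)\<^sup>2 \<le> (norm (?y t) * norm z)\<^sup>2"
        using Cauchy_Schwarz_ineq2[of "?y t" z] by (intro abs_le_square_iff[THEN iffD1]) simp
      also have "\<dots> \<le> (R * norm z)\<^sup>2"
        using False by (intro power_mono mult_right_mono) auto
      finally have "(?y t \<bullet> z)\<^sup>2 * ?b (Suc M) t \<le> (R * norm z)\<^sup>2 * R ^ (2 * Suc M)"
        by (intro mult_mono bump_le) (auto simp: bump_nonneg)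
      also have "\<dots> = R ^ (2 * (M + 2)) * (norm z)\<^sup>2"
        by (simp add: power_mult_distrib power_add power2_eq_square)
      finally show ?thesis .
    qed
    then have b2: "(?y t \<bullet> z) * ((?y t \<bullet> z) * ?b (Suc M) t) \<le> R ^ (2 * (M + 2)) * (norm z)\<^sup>2"
      by (simp add: power2_eq_square mult_ac)
    have b3: "0 \<le> (?y t \<bullet> z) * ((?y t \<bullet> z) * ?b (Suc M) t)"
      unfolding mult.assoc[symmetric] power2_eq_square[symmetric] by (simp add: bump_nonneg)
    have "?h'' t = (- 2 * ?k) * ((norm z)\<^sup>2 * ?b (Suc (Suc M)) t
        - (2 * ?l) * ((?y t \<bullet> z) * ((?y t \<bullet> z) * ?b (Suc M) t)))"
      by (simp add: algebra_simps)
    then have "\<bar>?h'' t\<bar> = (2 * ?k) * \<bar>(norm z)\<^sup>2 * ?b (Suc (Suc M)) t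
        - (2 * ?l) * ((?y t \<bullet> z) * ((?y t \<bullet> z) * ?b (Suc M) t))\<bar>"
      by (simp only: abs_mult)
    also have "\<dots> \<le> (2 * ?k) * ((norm z)\<^sup>2 * ?b (Suc (Suc M)) t
        + (2 * ?l) * ((?y t \<bullet> z) * ((?y t \<bullet> z) * ?b (Suc M) t)))"
      using b3 by (intro mult_left_mono order_trans[OF abs_triangle_ineq4]) (auto simp: bump_nonneg abs_mult)
    also have "\<dots> \<le> (2 * ?k) * ((norm z)\<^sup>2 * R ^ (2 * (M + 2)) + (2 * ?l) * (R ^ (2 * (M + 2)) * (norm z)\<^sup>2))"
      using b1 b2 by (intro mult_left_mono add_mono) auto
    finally show ?thesis by (simp add: mult_ac)
  qed
  have "\<bar>2 * ?b (Suc (Suc (Suc M))) 0 - ?b (Suc (Suc (Suc M))) 1 - ?b (Suc (Suc (Suc M))) (-1)\<bar> \<le> 2 * ?B"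
    by (rule second_diff_le_of_second_deriv[OF d1 d2 bd])
  also have "2 * ?B \<le> (4 * real (M + 3) * (2 * real (M + 3))) * (R ^ (2 * (M + 2)) * (norm z)\<^sup>2)"
  proof -
    let ?Z = "R ^ (2 * (M + 2)) * (norm z)\<^sup>2"
    have "2 * ?B = (4 * ?k) * ((1 + 2 * ?l) * ?Z)" by (simp add: algebra_simps)
    \<comment> \<open>\<open>?k = ?l + 1\<close>, hence
      \<open>1 + 2 * ?l \<le> 2 * ?k\<close>.\<close>
    also have "\<dots> \<le> (4 * ?k) * ((2 * ?k) * ?Z)"
      using R by (intro mult_left_mono mult_right_mono) auto
    finally show ?thesis by (simp add: numeral_eq_Suc mult_ac)
  qed
  finally show ?thesis by (simp add: second_diff_def numeral_eq_Suc)
qed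

lemma second_diff_bump_le_const: "0 \<le> R \<Longrightarrow> \<bar>second_diff (bump a M R) x z\<bar> \<le> 4 * R ^ (2 * M)"
  using bump_le[of a M R x] bump_le[of a M R "x + z"] bump_le[of a M R "x - z"]
    bump_nonneg[of a M R x] bump_nonneg[of a M R "x + z"] bump_nonneg[of a M R "x - z"]
  unfolding second_diff_def by linarith

lemma integral_bump_le:
  fixes a :: "real ^ 'n::finite"
  assumes "0 < M" "0 \<le> R"
  shows "integrable lborel (bump a M R)"
    and "(LINT x|lborel. bump a M R x) \<le> unit_ball_vol (real CARD('n)) * R ^ (2 * M + CARD('n))"
proof -
  show int: "integrable lborel (bump a M R)"
    using integrable_mult_bump[of "\<lambda>x. 1" M R a] assms by auto
  have "(LINT x|lborel. bump a M R x) \<le> (LINT x|lborel. indicator (cball a R) x * R ^ (2 * M))"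
  proof (intro integral_mono int integral_cball_const)
    show "bump a M R x \<le> indicator (cball a R) x * R ^ (2 * M)" for x
    proof (cases "x \<in> cball a R")
      case False
      then have "bump a M R x = 0" using assms by (intro bump_eq_0) (auto simp: dist_norm norm_minus_commute)
      then show ?thesis using assms by (simp add: indicator_def)
    qed (simp add: bump_le)
  qed (use assms in simp)
  also have "\<dots> = unit_ball_vol (real CARD('n)) * R ^ (2 * M + CARD('n))"
    by (subst integral_cball_const(1)) (use assms in \<open>simp_all add: power_add mult_ac\<close>)
  finally show "(LINT x|lborel. bump a M R x) \<le> unit_ball_vol (real CARD('n)) * R ^ (2 * M + CARD('n))" .
qed

text \<open>One formula for two regimes: order R^(N-s) for |x - a| < 2R and R^N |x - a|^(-s) beyond,
  where N = 2(M+3) + n. Far away the second difference vanishes for |z| \<le> |x - a|/2, so the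
  kernel is at most (2/|x - a|)^s and only the mass of the bump remains. Nearby the integral is
  split at |z| = R between the quadratic bound and the uniform one.\<close>

lemma second_diff_bump_potential_le:
  fixes a :: "real ^ 'n::finite"
  assumes \<alpha>: "0 < \<alpha>" "\<alpha> < 2" and n: "2 \<le> CARD('n)"
  defines "s \<equiv> real CARD('n) + \<alpha>"
  shows "\<exists>C\<ge>0. \<forall>R>0. \<forall>x. integrable lborel (\<lambda>z. second_diff (bump a (M + 3) R) x z / norm z powr s) \<and>
    (LINT z|lborel. \<bar>second_diff (bump a (M + 3) R) x z / norm z powr s\<bar>)
       \<le> C * R ^ (2 * (M + 3) + CARD('n)) / (R powr s + norm (x - a) powr s)"
proof -
  let ?n = "CARD('n)"
  let ?N = "2 * (M + 3) + ?n" and ?V = "unit_ball_vol (real ?n)"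
  \<comment> \<open>The exponent \<open>2 - s\<close> governs the near part: it is above -n because
    \<alpha> < 2, and nonpositive because n \<ge> 2.\<close>
  have s: "0 < s" "real ?n < s" "2 - s \<le> 0" "- real ?n < 2 - s" using \<alpha> n by (auto simp: s_def)
  obtain C1 where C1: "\<And>r. r > 0 \<Longrightarrow> integrable lborel (\<lambda>x::real^'n. indicator (cball 0 r) x * norm x powr (2 - s))"
    "\<And>r. r > 0 \<Longrightarrow> (LINT x|lborel. indicator (cball 0 r) (x::real^'n) * norm x powr (2 - s)) \<le> C1 * r powr (real ?n + (2 - s))"
    using integral_norm_powr_ball[OF s(3,4)] by blast
  obtain C2 where C2: "\<And>r. r > 0 \<Longrightarrow> integrable lborel (\<lambda>x::real^'n. indicator {x. r \<le> norm x} x / norm x powr s)"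
     "\<And>r. r > 0 \<Longrightarrow> (LINT x|lborel. indicator {x. r \<le> norm x} (x::real^'n) / norm x powr s) \<le> C2 * r powr (real ?n - s)"
    using integral_norm_powr_tail[OF s(2)] by blast
  have C10: "0 \<le> C1"
  proof -
    have "0 \<le> (LINT x|lborel. indicator (cball 0 1) (x::real^'n) * norm x powr (2 - s))" by (intro integral_nonneg_AE) auto
    from order_trans[OF this C1(2)[of 1]] show ?thesis by simp
  qed
  have C20: "0 \<le> C2"
  proof -
    have "0 \<le> (LINT x|lborel. indicator {x. 1 \<le> norm x} (x::real^'n) / norm x powr s)" by (intro integral_nonneg_AE) auto
    from order_trans[OF this C2(2)[of 1]] show ?thesis by simp
  qed
  define E where "E = 4 * real (M + 3) * (2 * real (M + 3))"
  have E0: "0 \<le> E" by (simp add: E_def)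
  \<comment> \<open>In \<open>?Cfar\<close> one factor 2 counts the two translates of the bump, the
    other comes from |x - a|^(-s) \<le> 2/(R^s + |x - a|^s). In \<open>?Cnear\<close> the factor 1 +
    2^s compares R^(-s) with the same denominator when |x - a| < 2R.\<close>
  let ?Cfar = "2 * 2 * 2 powr s * ?V" and ?Cnear = "(E * C1 + 4 * C2) * (1 + 2 powr s)"
  have Cf0: "0 \<le> ?Cfar" by simp
  have Cn0: "0 \<le> ?Cnear" using E0 C10 C20 by (intro mult_nonneg_nonneg add_nonneg_nonneg) auto
  have main: "integrable lborel (\<lambda>z. second_diff (bump a (M + 3) R) x z / norm z powr s) \<and>
    (LINT z|lborel. \<bar>second_diff (bump a (M + 3) R) x z / norm z powr s\<bar>)
       \<le> (?Cfar + ?Cnear) * R ^ ?N / (R powr s + norm (x - a) powr s)" if R: "R > 0" for R x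
  proof -
    let ?b = "bump a (M + 3) R" and ?d = "norm (x - a)"
    let ?J = "\<lambda>z. second_diff ?b x z / norm z powr s"
    let ?W = "R powr s + ?d powr s"
    have W: "0 < ?W" using R by (intro add_pos_nonneg) auto
    have Rp: "R ^ k = R powr real k" for k using R by (simp add: powr_realpow)
    have mJ: "?J \<in> borel_measurable borel" by measurable
    have reduce: "integrable lborel ?J \<and> (LINT z|lborel. \<bar>?J z\<bar>) \<le> (?Cfar + ?Cnear) * R ^ ?N / ?W"
      if H: "integrable lborel H" "\<And>z. \<bar>?J z\<bar> \<le> H z"
        and D: "0 \<le> D" "D \<le> ?Cfar + ?Cnear" "(LINT z|lborel. H z) \<le> D * R ^ ?N / ?W" for H D
    proof -
      have int: "integrable lborel ?J"
        by (rule Bochner_Integration.integrable_bound[OF H(1)])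
           (use H(2) in \<open>auto intro!: AE_I2 intro: order_trans[OF _ abs_ge_self]\<close>)
      have "(LINT z|lborel. \<bar>?J z\<bar>) \<le> (LINT z|lborel. H z)"
        using H by (intro integral_mono integrable_abs int) auto
      also have "\<dots> \<le> D * R ^ ?N / ?W" by (rule D)
      also have "\<dots> \<le> (?Cfar + ?Cnear) * R ^ ?N / ?W"
        using D R W by (intro divide_right_mono mult_right_mono) auto
      finally show ?thesis using int by blast
    qed
    show ?thesis
    proof (cases "2 * R \<le> ?d")
      case True
      then have d: "0 < ?d" using R by linarith
      let ?c = "(2 / ?d) powr s"
      let ?H = "\<lambda>z. ?c * (?b (x + z) + ?b (x - z))"
      have intb: "integrable lborel (\<lambda>z. ?b (x + z))" "integrable lborel (\<lambda>z. ?b (x - z))"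
        using lborel_integrable_translate[of ?b x] lborel_integrable_reflect[of ?b x] integral_bump_le(1)[of "M + 3" R a] R
        by (auto simp: add.commute)
      have "(LINT z|lborel. ?b (x + z)) = (LINT z|lborel. ?b z)"
        using lborel_integral_translate[of ?b x] by (simp add: add.commute)
      moreover have "(LINT z|lborel. ?b (x - z)) = (LINT z|lborel. ?b z)"
        using lborel_integral_reflect[of ?b x] by simp
      ultimately have "(LINT z|lborel. ?H z) = ?c * (2 * (LINT z|lborel. ?b z))"
        using intb by simp
      also have "\<dots> \<le> ?c * (2 * (?V * R ^ ?N))"
        using integral_bump_le(2)[of "M + 3" R a] R by (intro mult_left_mono) auto
      also have "?c * (2 * (?V * R ^ ?N)) \<le> (2 powr s * (2 / ?W)) * (2 * (?V * R ^ ?N))"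
      proof (rule mult_right_mono)
        have "R powr s \<le> ?d powr s" using True R s by (intro powr_mono2) auto
        moreover have "0 < ?d powr s" using d by simp
        ultimately have "1 / ?d powr s \<le> 2 / ?W" using W by (simp add: field_simps)
        then have "2 powr s * (1 / ?d powr s) \<le> 2 powr s * (2 / ?W)"
          by (intro mult_left_mono) auto
        then show "?c \<le> 2 powr s * (2 / ?W)" by (simp add: powr_divide)
      qed (use R in simp)
      finally have HI: "(LINT z|lborel. ?H z) \<le> ?Cfar * R ^ ?N / ?W" by (simp add: mult_ac)
      have Hle: "\<bar>?J z\<bar> \<le> ?H z" for z
      proof -
        have bx: "?b x = 0" using True R by (intro bump_eq_0) auto
        have D: "\<bar>second_diff ?b x z\<bar> = ?b (x + z) + ?b (x - z)"
          using bump_nonneg[of a "M + 3" R "x + z"] bump_nonneg[of a "M + 3" R "x - z"]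
          by (simp add: second_diff_def bx)
        show ?thesis
        proof (cases "norm z \<le> ?d / 2")
          case small: True
          \<comment> \<open>With |x - a| \<ge> 2R, a shift by at most half this distance cannot
            enter the ball of radius R.\<close>
          have "R \<le> norm (x + z - a)" "R \<le> norm (x - z - a)"
            using norm_triangle_ineq4[of "x + z - a" z] norm_triangle_ineq[of "x - z - a" z] small True
            by (simp_all add: algebra_simps)
          then have "?b (x + z) = 0" "?b (x - z) = 0" using R by (auto intro!: bump_eq_0)
          then show ?thesis using D by simp
        next
          case False
          have "1 / norm z powr s \<le> 1 / (?d / 2) powr s"
            using False d s by (intro divide_left_mono powr_mono2 mult_pos_pos) auto
          also have "\<dots> = ?c" using d by (simp add: powr_divide)
          finally have "(?b (x + z) + ?b (x - z)) * (1 / norm z powr s) \<le> (?b (x + z) + ?b (x - z)) * ?c"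
            by (intro mult_left_mono) (auto simp: bump_nonneg)
          then show ?thesis by (simp add: abs_divide D mult_ac)
        qed
      qed
      show ?thesis
        by (rule reduce[OF _ Hle Cf0 _ HI]) (use intb Cn0 in auto)
    next
      case False
      let ?k1 = "\<lambda>z::real^'n. indicator (cball 0 R) z * norm z powr (2 - s)"
      let ?k2 = "\<lambda>z::real^'n. indicator {z. R \<le> norm z} z / norm z powr s"
      let ?H = "\<lambda>z. (E * R ^ (2 * (M + 2))) * ?k1 z + (4 * R ^ (2 * (M + 3))) * ?k2 z"
      have "(LINT z|lborel. ?H z) = (E * R ^ (2 * (M + 2))) * (LINT z|lborel. ?k1 z)
          + (4 * R ^ (2 * (M + 3))) * (LINT z|lborel. ?k2 z)"
        using Bochner_Integration.integral_add[OF integrable_mult_right[OF C1(1)[OF R]] integrable_mult_right[OF C2(1)[OF R]]]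
        by (simp only: integral_mult_right_zero)
      also have "\<dots> \<le> (E * R ^ (2 * (M + 2))) * (C1 * R powr (real ?n + (2 - s)))
          + (4 * R ^ (2 * (M + 3))) * (C2 * R powr (real ?n - s))"
        using C1(2)[OF R] C2(2)[OF R] E0 R by (intro add_mono mult_left_mono) auto
      also have "\<dots> = (E * C1 + 4 * C2) * (R ^ ?N / R powr s)"
      proof -
        have "R ^ (2 * (M + 2)) * R powr (real ?n + (2 - s)) = R ^ ?N / R powr s"
        proof -
          have *: "real (2 * (M + 2)) + (real ?n + (2 - s)) = real ?N - s" by simp
          show ?thesis by (simp only: Rp powr_add[symmetric] *) (simp only: powr_diff)
        qed
        moreover have "R ^ (2 * (M + 3)) * R powr (real ?n - s) = R ^ ?N / R powr s"
        proof -
          have *: "real (2 * (M + 3)) + (real ?n - s) = real ?N - s" by simp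
          show ?thesis by (simp only: Rp powr_add[symmetric] *) (simp only: powr_diff)
        qed
        ultimately show ?thesis by (simp add: distrib_right mult_ac add_divide_distrib)
      qed
      also have "\<dots> \<le> (E * C1 + 4 * C2) * ((1 + 2 powr s) * (R ^ ?N / ?W))"
      proof (rule mult_left_mono)
        have "?d powr s \<le> (2 * R) powr s" using False s by (intro powr_mono2) auto
        also have "\<dots> = 2 powr s * R powr s" by (simp add: powr_mult)
        finally have w: "?W \<le> (1 + 2 powr s) * R powr s" by (simp add: distrib_right)
        have "0 < R powr s" using R by simp
        then have "1 / R powr s \<le> (1 + 2 powr s) / ?W"
          using w W by (simp add: field_simps)
        then have "R ^ ?N * (1 / R powr s) \<le> R ^ ?N * ((1 + 2 powr s) / ?W)"
          using R by (intro mult_left_mono) auto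
        then show "R ^ ?N / R powr s \<le> (1 + 2 powr s) * (R ^ ?N / ?W)" by (simp add: mult_ac)
      qed (use E0 C10 C20 in simp)
      finally have HI: "(LINT z|lborel. ?H z) \<le> ?Cnear * R ^ ?N / ?W"
        by (simp only: mult.assoc times_divide_eq_right)
      have Hle: "\<bar>?J z\<bar> \<le> ?H z" for z
      proof (cases "norm z < R")
        case True
        have "\<bar>?J z\<bar> \<le> E * (R ^ (2 * (M + 2)) * (norm z)\<^sup>2) / norm z powr s"
          using second_diff_bump_le[of R a M x z] R by (simp add: abs_divide divide_right_mono E_def)
        also have "\<dots> = (E * R ^ (2 * (M + 2))) * ?k1 z"
        proof (cases "z = 0")
          case False
          then have "(norm z)\<^sup>2 = norm z powr 2" by simp
          then show ?thesis using True by (simp add: powr_diff)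
        qed simp
        finally show ?thesis using True by (simp add: indicator_def)
      next
        case False
        have "\<bar>?J z\<bar> \<le> 4 * R ^ (2 * (M + 3)) / norm z powr s"
          using second_diff_bump_le_const[of R a "M + 3" x z] R by (simp add: abs_divide divide_right_mono)
        also have "\<dots> = (4 * R ^ (2 * (M + 3))) * ?k2 z" using False by (simp add: indicator_def)
        also have "\<dots> \<le> ?H z" using E0 R by auto
        finally show ?thesis .
      qed
      show ?thesis
      proof (rule reduce[OF _ Hle Cn0 _ HI])
        show "integrable lborel ?H"
          by (intro Bochner_Integration.integrable_add integrable_mult_right C1(1)[OF R] C2(1)[OF R])
      qed (use Cf0 in auto)
    qed
  qed
  show ?thesis by (rule exI[of _ "?Cfar + ?Cnear"]) (use main Cf0 Cn0 in auto)
qed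

section \<open>Means of the fractional Laplacian\<close>

text \<open>For fixed z the second difference is a symmetric operator: translation carries each
  shift from \<open>u\<close> to the bump, with the shifts by z and -z exchanging their
  roles.\<close>

lemma bump_integral_second_diff_swap:
  fixes u :: "real ^ 'n::finite \<Rightarrow> real"
  assumes cu: "continuous_on UNIV u" and M: "0 < M" and R: "0 \<le> R"
  shows "(LINT x|lborel. second_diff u x z * bump a M R x) = (LINT x|lborel. u x * second_diff (bump a M R) x z)"
proof -
  let ?b = "bump a M R"
  have [measurable]: "u \<in> borel_measurable borel" using cu by (rule borel_measurable_continuous_onI)
  have cs: "continuous_on UNIV (\<lambda>x. u (x + c))" for c
    by (rule continuous_on_compose2[OF cu]) (auto intro!: continuous_intros)
  have i: "integrable lborel (\<lambda>x. u (x + c) * ?b x)" for c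
    by (rule integrable_mult_bump[OF cs M R])
  have j: "integrable lborel (\<lambda>x. u x * ?b (x - c))" for c
    using lborel_integrable_translate[OF i[of c], of "- c"] by simp
  have t: "(LINT x|lborel. u (x + c) * ?b x) = (LINT x|lborel. u x * ?b (x - c))" for c
    using lborel_integral_translate[of "\<lambda>x. u (x + c) * ?b x" "- c"] by simp
  have "(LINT x|lborel. second_diff u x z * ?b x)
     = (LINT x|lborel. 2 * (u x * ?b x) - u (x + z) * ?b x - u (x + (- z)) * ?b x)"
    by (simp add: second_diff_def algebra_simps)
  also have "\<dots> = 2 * (LINT x|lborel. u x * ?b x) - (LINT x|lborel. u (x + z) * ?b x) - (LINT x|lborel. u (x + (- z)) * ?b x)"
    using i[of 0] i[of z] i[of "- z"] by simp
  also have "\<dots> = 2 * (LINT x|lborel. u x * ?b x) - (LINT x|lborel. u x * ?b (x - z)) - (LINT x|lborel. u x * ?b (x - (- z)))"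
    unfolding t ..
  also have "\<dots> = (LINT x|lborel. 2 * (u x * ?b x) - u x * ?b (x - z) - u x * ?b (x - (- z)))"
    using i[of 0] j[of z] j[of "- z"] by simp
  also have "\<dots> = (LINT x|lborel. u x * second_diff ?b x z)"
    by (simp add: second_diff_def algebra_simps)
  finally show ?thesis .
qed

text \<open>Symmetry is available only for fixed z, so the z-integral is moved outside and, after
  the swap, back inside. Each move needs integrability on the product space: before the swap from
  the bound that is uniform on the support of the bump, after it from \<open>bb\<close>.\<close>

lemma bump_integral_nonlocal_swap:
  fixes u :: "real ^ 'n::finite \<Rightarrow> real"
  assumes \<alpha>: "0 < \<alpha>" "\<alpha> < \<delta>" "\<delta> \<le> real CARD('n) + \<alpha>"
    and u: "second_diff_Hoelder \<delta> u" "u \<in> L_space \<alpha>" and M: "0 < M" and R: "0 \<le> R"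
  defines "s \<equiv> real CARD('n) + \<alpha>"
  assumes bi: "\<And>x. integrable lborel (\<lambda>z. second_diff (bump a M R) x z / norm z powr s)"
    and bb: "integrable lborel (\<lambda>x. u x * (LINT z|lborel. \<bar>second_diff (bump a M R) x z / norm z powr s\<bar>))"
  shows "bump_integral a M (\<lambda>x. LINT z|lborel. second_diff u x z / norm z powr s) R
    = (LINT x|lborel. u x * (LINT z|lborel. second_diff (bump a M R) x z / norm z powr s))"
proof -
  let ?b = "bump a M R"
  have cu: "continuous_on UNIV u" using u(1) by (simp add: second_diff_Hoelder_def)
  then have [measurable]: "u \<in> borel_measurable borel" by (rule borel_measurable_continuous_onI)
  \<comment> \<open>The ball of radius |a| + R about the origin contains the support of the
    bump.\<close>
  obtain C where C: "\<And>x. x \<in> cball 0 (norm a + R) \<Longrightarrow> integrable lborel (\<lambda>z. second_diff u x z / norm z powr s) \<and>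
     (LINT z|lborel. \<bar>second_diff u x z / norm z powr s\<bar>) \<le> C"
    using second_diff_integrable[OF \<alpha> u, of "norm a + R"] unfolding s_def by blast
  have iu: "integrable lborel (\<lambda>z. second_diff u x z / norm z powr s)" for x
    using second_diff_integrable[OF \<alpha> u, of "norm x"] unfolding s_def by auto
  let ?f = "\<lambda>x z. (second_diff u x z / norm z powr s) * ?b x"
  let ?g = "\<lambda>x z. u x * (second_diff ?b x z / norm z powr s)"
  have mf: "case_prod ?f \<in> borel_measurable (lborel \<Otimes>\<^sub>M lborel)"
    unfolding second_diff_def by measurable
  have mg: "case_prod ?g \<in> borel_measurable (lborel \<Otimes>\<^sub>M lborel)"
    unfolding second_diff_def by measurable
  have f: "integrable (lborel \<Otimes>\<^sub>M lborel) (case_prod ?f)"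
  proof (rule lborel_pair.Fubini_integrable[OF mf])
    show "AE x in lborel. integrable lborel (\<lambda>z. case_prod ?f (x, z))"
      by (intro AE_I2) (simp only: prod.case integrable_mult_left[OF iu])
    have e: "(LINT z|lborel. norm (case_prod ?f (x, z))) = (LINT z|lborel. \<bar>second_diff u x z / norm z powr s\<bar>) * ?b x" for x
      by (simp only: prod.case real_norm_def abs_mult abs_of_nonneg[OF bump_nonneg] integral_mult_left_zero)
    show "integrable lborel (\<lambda>x. LINT z|lborel. norm (case_prod ?f (x, z)))"
    proof (rule Bochner_Integration.integrable_bound)
      show "integrable lborel (\<lambda>x. C * ?b x)"
        using integrable_mult_bump[of "\<lambda>x. C" M R a] M R by simp
      have "(\<lambda>(x, z). norm (case_prod ?f (x, z))) \<in> borel_measurable (lborel \<Otimes>\<^sub>M lborel)"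
        unfolding second_diff_def by measurable
      then show "(\<lambda>x. LINT z|lborel. norm (case_prod ?f (x, z))) \<in> borel_measurable lborel"
        by (intro lborel.borel_measurable_lebesgue_integral) simp
      show "AE x in lborel. norm (LINT z|lborel. norm (case_prod ?f (x, z))) \<le> norm (C * ?b x)"
      proof (rule AE_I2)
        fix x
        have i0: "0 \<le> (LINT z|lborel. \<bar>second_diff u x z / norm z powr s\<bar>)"
          by (intro integral_nonneg_AE) auto
        show "norm (LINT z|lborel. norm (case_prod ?f (x, z))) \<le> norm (C * ?b x)"
        proof (cases "R \<le> norm (x - a)")
          case True
          then have "?b x = 0" using M R by (intro bump_eq_0) auto
          then show ?thesis unfolding e by simp
        next
          case False
          then have "x \<in> cball 0 (norm a + R)"
            using norm_triangle_ineq2[of x a] by simp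
          then have "(LINT z|lborel. \<bar>second_diff u x z / norm z powr s\<bar>) \<le> C"
            using C by blast
          then have "(LINT z|lborel. \<bar>second_diff u x z / norm z powr s\<bar>) * ?b x \<le> C * ?b x"
            by (intro mult_right_mono) (auto simp: bump_nonneg)
          moreover have "0 \<le> (LINT z|lborel. \<bar>second_diff u x z / norm z powr s\<bar>) * ?b x"
            by (rule mult_nonneg_nonneg[OF i0 bump_nonneg])
          ultimately show ?thesis by (subst e) (unfold real_norm_def, linarith)
        qed
      qed
    qed
  qed
  have g: "integrable (lborel \<Otimes>\<^sub>M lborel) (case_prod ?g)"
  proof (rule lborel_pair.Fubini_integrable[OF mg])
    show "AE x in lborel. integrable lborel (\<lambda>z. case_prod ?g (x, z))"
      by (intro AE_I2) (simp only: prod.case integrable_mult_right[OF bi])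
    have e: "(LINT z|lborel. norm (case_prod ?g (x, z))) = norm (u x * (LINT z|lborel. \<bar>second_diff ?b x z / norm z powr s\<bar>))" for x
    proof -
      have "0 \<le> (LINT z|lborel. \<bar>second_diff ?b x z / norm z powr s\<bar>)"
        by (intro integral_nonneg_AE) auto
      then show ?thesis
        by (simp only: prod.case real_norm_def abs_mult integral_mult_right_zero abs_of_nonneg)
    qed
    show "integrable lborel (\<lambda>x. LINT z|lborel. norm (case_prod ?g (x, z)))"
      unfolding e by (rule integrable_norm[OF bb])
  qed
  have "bump_integral a M (\<lambda>x. LINT z|lborel. second_diff u x z / norm z powr s) R
     = (LINT x|lborel. LINT z|lborel. ?f x z)"
    unfolding bump_integral_def by (simp only: integral_mult_left_zero)
  also have "\<dots> = (LINT z|lborel. LINT x|lborel. ?f x z)"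
    by (rule lborel_pair.Fubini_integral[OF f, symmetric])
  also have "\<dots> = (LINT z|lborel. LINT x|lborel. ?g x z)"
  proof (rule Bochner_Integration.integral_cong[OF refl])
    fix z :: "real ^ 'n"
    have "(LINT x|lborel. ?f x z) = (LINT x|lborel. (1 / norm z powr s) * (second_diff u x z * ?b x))"
      by (intro Bochner_Integration.integral_cong refl) simp
    also have "\<dots> = (1 / norm z powr s) * (LINT x|lborel. u x * second_diff ?b x z)"
      by (simp only: integral_mult_right_zero bump_integral_second_diff_swap[OF cu M R])
    also have "\<dots> = (LINT x|lborel. (1 / norm z powr s) * (u x * second_diff ?b x z))"
      by (simp only: integral_mult_right_zero)
    also have "\<dots> = (LINT x|lborel. ?g x z)"
      by (intro Bochner_Integration.integral_cong refl) simp
    finally show "(LINT x|lborel. ?f x z) = (LINT x|lborel. ?g x z)" .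
  qed
  also have "\<dots> = (LINT x|lborel. LINT z|lborel. ?g x z)"
    by (rule lborel_pair.Fubini_integral[OF g])
  also have "\<dots> = (LINT x|lborel. u x * (LINT z|lborel. second_diff ?b x z / norm z powr s))"
    by (simp only: integral_mult_right_zero)
  finally show ?thesis .
qed

text \<open>After division by R^(n+2M) the potential bound leaves |u| / (R^s + |x - a|^s). For R
  \<ge> 1 this lies below a fixed multiple of |u| times the tail weight, and it tends to 0
  pointwise; dominated convergence gives the limit.\<close>

lemma mean_vanishing_frac_laplacian:
  fixes u :: "real ^ 'n::finite \<Rightarrow> real"
  assumes \<alpha>: "0 < \<alpha>" "\<alpha> < 2" "\<alpha> < \<delta>" "\<delta> \<le> real CARD('n) + \<alpha>" and n: "2 \<le> CARD('n)"
    and u: "second_diff_Hoelder \<delta> u" "u \<in> L_space \<alpha>"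
  shows "mean_vanishing a (frac_laplacian \<alpha> u)"
proof -
  define s where "s = real CARD('n) + \<alpha>"
  have s: "0 < s" using \<alpha> by (simp add: s_def)
  let ?n = "CARD('n)" and ?A = "frac_laplacian_const TYPE('n) \<alpha> / 2"
  let ?J = "\<lambda>x. LINT z|lborel. second_diff u x z / norm z powr s"
  have fl: "frac_laplacian \<alpha> u = (\<lambda>x. ?A * ?J x)"
    using frac_laplacian_eq_integral[OF \<alpha> u] by (simp add: fun_eq_iff s_def)
  have cu: "continuous_on UNIV u" using u(1) by (simp add: second_diff_Hoelder_def)
  then have [measurable]: "u \<in> borel_measurable borel" by (rule borel_measurable_continuous_onI)
  have uL: "integrable lborel (\<lambda>x. \<bar>u x\<bar> * tail_weight s x)"
    using u(2) by (simp add: L_space_iff s_def)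
  let ?q = "\<lambda>R x. \<bar>u x\<bar> / (R powr s + norm (x - a) powr s)"
  let ?c = "1 + 2 powr s * norm a powr s + 2 powr s"
  have dom: "integrable lborel (\<lambda>x. ?c * (\<bar>u x\<bar> * tail_weight s x))" using uL by simp
  have q_le: "?q R x \<le> ?c * (\<bar>u x\<bar> * tail_weight s x)" if "1 \<le> R" for R x
  proof -
    have R1: "1 \<le> R powr s" using that s by (simp add: ge_one_powr_ge_zero)
    have "?q R x \<le> \<bar>u x\<bar> / (1 + norm (x - a) powr s)"
      using R1 by (intro divide_left_mono add_right_mono mult_pos_pos add_pos_nonneg) auto
    also have "\<dots> = \<bar>u x\<bar> * tail_weight s (x - a)" by (simp add: tail_weight_def)
    also have "\<dots> \<le> \<bar>u x\<bar> * (?c * tail_weight s x)"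
      by (intro mult_left_mono tail_weight_shift s) auto
    finally show ?thesis by (simp add: mult_ac)
  qed
  have q_nn: "0 \<le> ?q R x" for R x by (intro divide_nonneg_nonneg add_nonneg_nonneg) auto
  have q_int: "integrable lborel (?q R)" if "1 \<le> R" for R
    by (rule Bochner_Integration.integrable_bound[OF dom])
       (use q_le[OF that] q_nn[of _ R] in \<open>auto intro!: AE_I2 simp del: abs_divide simp: abs_of_nonneg intro: order_trans[OF _ abs_ge_self]\<close>)
  have q_lim: "((\<lambda>R. LINT x|lborel. ?q R x) \<longlongrightarrow> (LINT x::real^'n|lborel. 0)) at_top"
  proof (rule integral_dominated_convergence_at_top)
    show "\<forall>\<^sub>F R in at_top. AE x in lborel. norm (?q R x) \<le> ?c * (\<bar>u x\<bar> * tail_weight s x)"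
      using eventually_ge_at_top[of 1]
    proof eventually_elim
      case (elim R)
      show ?case using q_le[OF elim] q_nn[of _ R] by (auto intro!: AE_I2 simp del: abs_divide simp: abs_of_nonneg)
    qed
    show "AE x in lborel. ((\<lambda>R. ?q R x) \<longlongrightarrow> 0) at_top"
    proof (rule AE_I2)
      fix x
      have "filterlim (\<lambda>R. R powr s + norm (x - a) powr s) at_top at_top"
        using s by real_asymp
      then show "((\<lambda>R. ?q R x) \<longlongrightarrow> 0) at_top"
        by (rule real_tendsto_divide_at_top[OF tendsto_const])
    qed
  qed (use dom in auto)
  have "((\<lambda>R. bump_integral a (M + 3) (frac_laplacian \<alpha> u) R / R ^ (?n + 2 * (M + 3))) \<longlongrightarrow> 0) at_top" for M
  proof -
    obtain C where C0: "C \<ge> 0" and C: "\<And>R x. R > 0 \<Longrightarrow> integrable lborel (\<lambda>z. second_diff (bump a (M + 3) R) x z / norm z powr s)"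
      "\<And>R x. R > 0 \<Longrightarrow> (LINT z|lborel. \<bar>second_diff (bump a (M + 3) R) x z / norm z powr s\<bar>)
         \<le> C * R ^ (2 * (M + 3) + ?n) / (R powr s + norm (x - a) powr s)"
      using second_diff_bump_potential_le[OF \<alpha>(1,2) n, where M = M and a = a] unfolding s_def by blast
    have "((\<lambda>R. (\<bar>?A\<bar> * C) * (LINT x|lborel. ?q R x)) \<longlongrightarrow> (\<bar>?A\<bar> * C) * (LINT x::real^'n|lborel. 0)) at_top"
      by (intro tendsto_mult_left q_lim)
    then have "((\<lambda>R. (\<bar>?A\<bar> * C) * (LINT x|lborel. ?q R x)) \<longlongrightarrow> 0) at_top" by simp
    then show ?thesis
    proof (rule Lim_null_comparison[rotated])
      show "\<forall>\<^sub>F R in at_top. norm (bump_integral a (M + 3) (frac_laplacian \<alpha> u) R / R ^ (?n + 2 * (M + 3)))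
          \<le> (\<bar>?A\<bar> * C) * (LINT x|lborel. ?q R x)"
        using eventually_ge_at_top[of 1]
      proof eventually_elim
        case (elim R)
        then have R: "0 < R" by simp
        let ?b = "bump a (M + 3) R" and ?RN = "R ^ (?n + 2 * (M + 3))"
        let ?V = "\<lambda>x. LINT z|lborel. \<bar>second_diff ?b x z / norm z powr s\<bar>"
        let ?W = "\<lambda>x. LINT z|lborel. second_diff ?b x z / norm z powr s"
        have V0: "0 \<le> ?V x" for x by (intro integral_nonneg_AE) auto
        have VW: "\<bar>?W x\<bar> \<le> ?V x" for x by (rule integral_abs_bound)
        have uV: "\<bar>u x * ?V x\<bar> \<le> (C * ?RN) * ?q R x" for x
        proof -
          have "\<bar>u x\<bar> * ?V x \<le> \<bar>u x\<bar> * (C * R ^ (2 * (M + 3) + ?n) / (R powr s + norm (x - a) powr s))"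
            using C(2)[OF R, of x] by (intro mult_left_mono) auto
          then show ?thesis using V0[of x] by (simp add: abs_mult mult_ac add_ac del: abs_divide)
        qed
        have mV: "?V \<in> borel_measurable lborel"
        proof (rule lborel.borel_measurable_lebesgue_integral)
          show "(\<lambda>(x, z). \<bar>second_diff ?b x z / norm z powr s\<bar>) \<in> borel_measurable (lborel \<Otimes>\<^sub>M lborel)"
            unfolding second_diff_def by measurable
        qed
        have bq: "integrable lborel (\<lambda>x. (C * ?RN) * ?q R x)" by (rule integrable_mult_right[OF q_int[OF elim]])
        have bb: "integrable lborel (\<lambda>x. u x * ?V x)"
          by (rule Bochner_Integration.integrable_bound[OF bq])
             (use uV mV in \<open>auto intro!: AE_I2 simp del: abs_divide abs_mult intro: order_trans[OF _ abs_ge_self]\<close>)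
        have "bump_integral a (M + 3) (frac_laplacian \<alpha> u) R = ?A * bump_integral a (M + 3) ?J R"
          unfolding fl bump_integral_def by (simp add: mult.assoc)
        also have "bump_integral a (M + 3) ?J R = (LINT x|lborel. u x * ?W x)"
          unfolding s_def by (rule bump_integral_nonlocal_swap[OF \<alpha>(1,3,4) u])
            (use R C(1)[OF R] bb in \<open>simp_all add: s_def\<close>)
        finally have e: "bump_integral a (M + 3) (frac_laplacian \<alpha> u) R = ?A * (LINT x|lborel. u x * ?W x)" .
        have "\<bar>LINT x|lborel. u x * ?W x\<bar> \<le> (LINT x|lborel. (C * ?RN) * ?q R x)"
        proof (rule integral_abs_bound_integral[OF _ bq])
          have mW: "?W \<in> borel_measurable lborel"
          proof (rule lborel.borel_measurable_lebesgue_integral)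
            show "(\<lambda>(x, z). second_diff ?b x z / norm z powr s) \<in> borel_measurable (lborel \<Otimes>\<^sub>M lborel)"
              unfolding second_diff_def by measurable
          qed
          have uW: "\<bar>u x * ?W x\<bar> \<le> (C * ?RN) * ?q R x" for x
          proof -
            have "\<bar>u x * ?W x\<bar> \<le> \<bar>u x * ?V x\<bar>"
              unfolding abs_mult using VW[of x] by (intro mult_left_mono) (auto simp del: abs_divide)
            then show ?thesis using uV[of x] by linarith
          qed
          show "integrable lborel (\<lambda>x. u x * ?W x)"
            by (rule Bochner_Integration.integrable_bound[OF bq])
               (use uW mW in \<open>auto intro!: AE_I2 simp del: abs_divide abs_mult intro: order_trans[OF _ abs_ge_self]\<close>)
          show "\<bar>u x * ?W x\<bar> \<le> (C * ?RN) * ?q R x" for x by (rule uW)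
        qed
        also have "\<dots> = (C * ?RN) * (LINT x|lborel. ?q R x)"
          by (simp only: integral_mult_right_zero)
        finally have "\<bar>?A\<bar> * \<bar>LINT x|lborel. u x * ?W x\<bar> \<le> \<bar>?A\<bar> * ((C * ?RN) * (LINT x|lborel. ?q R x))"
          by (intro mult_left_mono) auto
        then have "\<bar>?A * (LINT x|lborel. u x * ?W x)\<bar> / ?RN \<le> (\<bar>?A\<bar> * ((C * ?RN) * (LINT x|lborel. ?q R x))) / ?RN"
          unfolding abs_mult using R by (intro divide_right_mono) auto
        then show ?case using R unfolding e by simp
      qed
    qed
  qed
  note lim = this
  have "((\<lambda>R. bump_integral a M (frac_laplacian \<alpha> u) R / R ^ (?n + 2 * M)) \<longlongrightarrow> 0) at_top" if "M \<ge> 3" for M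
    using lim[of "M - 3"] that by simp
  then show ?thesis unfolding mean_vanishing_def by blast
qed

section \<open>Local Hoelder spaces\<close>

lemma partial_derivs_bounded_on_cball:
  fixes g :: "'n::finite \<Rightarrow> real ^ 'n \<Rightarrow> real"
  assumes "\<And>i. continuous_on UNIV (g i)"
  obtains C where "0 \<le> C" "\<And>i x. x \<in> cball a r \<Longrightarrow> \<bar>g i x\<bar> \<le> C"
proof -
  have "\<forall>i. \<exists>C\<ge>0. \<forall>x\<in>cball a r. \<bar>g i x\<bar> \<le> C"
    using continuous_bounded_on_cball[OF assms] by metis
  then obtain C where C: "\<And>i. 0 \<le> C i" "\<And>i x. x \<in> cball a r \<Longrightarrow> \<bar>g i x\<bar> \<le> C i"
    by metis
  have "\<bar>g i x\<bar> \<le> (\<Sum>i\<in>UNIV. C i)" if "x \<in> cball a r" for i x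
    using C(2)[OF that, of i] member_le_sum[of i UNIV C] C(1) by force
  then show ?thesis using that[of "\<Sum>i\<in>UNIV. C i"] C(1) by (simp add: sum_nonneg)
qed

lemma C1_imp_locally_Hoelder:
  fixes f :: "real ^ 'n::finite \<Rightarrow> real"
  assumes f: "f \<in> C_space (Suc 0)" and \<gamma>: "0 < \<gamma>" "\<gamma> \<le> 1"
  shows "locally_Hoelder \<gamma> f"
  unfolding locally_Hoelder_def
proof (intro allI impI)
  fix K :: "(real ^ 'n) set" assume "compact K"
  then obtain r where r: "0 < r" "\<And>x. x \<in> K \<Longrightarrow> norm x \<le> r"
    using compact_imp_bounded[of K] unfolding bounded_pos by blast
  have cg: "continuous_on UNIV (partial_deriv i f)" for i
    using C_space_SucD(2)[OF f] by simp
  \<comment> \<open>Two points of \<open>K\<close> are at most 2r apart, so points within that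
    distance of one of them have norm at most 3r.\<close>
  obtain C where C: "0 \<le> C" "\<And>i x. x \<in> cball 0 (3 * r) \<Longrightarrow> \<bar>partial_deriv i f x\<bar> \<le> C"
    by (rule partial_derivs_bounded_on_cball[where g = "\<lambda>i. partial_deriv i f" and a = 0 and r = "3 * r", OF cg]) (rule that)
  let ?C = "real CARD('n) * C * (2 * r) powr (1 - \<gamma>)"
  have "\<bar>f x - f y\<bar> \<le> ?C * norm (x - y) powr \<gamma>" if "x \<in> K" "y \<in> K" for x y
  proof -
    let ?z = "x - y"
    have z: "norm ?z \<le> 2 * r" using r(2)[OF that(1)] r(2)[OF that(2)] norm_triangle_ineq4[of x y] by linarith
    \<comment> \<open>With all \<open>c i\<close> equal to 0 the increment bound becomes a Lipschitz
      bound.\<close>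
    have "\<bar>f (y + ?z) - f y - (\<Sum>i\<in>UNIV. ?z $ i * 0)\<bar> \<le> real CARD('n) * norm ?z * C"
    proof (rule increment_bound[OF C_space_SucD(1)[OF f]])
      fix i w assume "norm (w - y) \<le> norm ?z"
      then have "norm w \<le> 3 * r" using z r(2)[OF that(2)] norm_triangle_ineq[of "w - y" y] by simp
      then show "\<bar>partial_deriv i f w - 0\<bar> \<le> C" using C(2)[of w i] by simp
    qed
    then have "\<bar>f x - f y\<bar> \<le> real CARD('n) * C * norm ?z" by (simp add: mult_ac)
    also have "real CARD('n) * C * norm ?z \<le> real CARD('n) * C * ((2 * r) powr (1 - \<gamma>) * norm ?z powr \<gamma>)"
    proof (rule mult_left_mono)
      show "norm ?z \<le> (2 * r) powr (1 - \<gamma>) * norm ?z powr \<gamma>"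
      proof (cases "x = y")
        case False
        then have "norm ?z = norm ?z powr (1 - \<gamma>) * norm ?z powr \<gamma>"
          by (simp add: powr_add[symmetric])
        also have "\<dots> \<le> (2 * r) powr (1 - \<gamma>) * norm ?z powr \<gamma>"
          using z \<gamma> by (intro mult_right_mono powr_mono2) auto
        finally show ?thesis .
      qed simp
    qed (use C(1) in simp)
    finally show ?thesis by (simp only: mult.assoc)
  qed
  then show "\<exists>C. \<forall>x\<in>K. \<forall>y\<in>K. \<bar>f x - f y\<bar> \<le> C * norm (x - y) powr \<gamma>" by blast
qed

lemma Hoelder_loc_space_partial_deriv:
  assumes "f \<in> Hoelder_loc_space (Suc k) \<gamma>"
  shows "partial_deriv i f \<in> Hoelder_loc_space k \<gamma>"
proof -
  \<comment> \<open>\<open>foldr\<close> applies the last list element first, so appending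
    \<open>i\<close> at the end takes the derivative in direction \<open>i\<close> before all
    others.\<close>
  have "locally_Hoelder \<gamma> (foldr partial_deriv (is @ [i]) f)" if "length is = k" for "is"
    using assms that unfolding Hoelder_loc_space_def by (auto simp del: foldr_append)
  then show ?thesis
    using assms unfolding Hoelder_loc_space_def by auto
qed

lemma Hoelder_loc_space_imp_locally_Hoelder:
  assumes "f \<in> Hoelder_loc_space k \<gamma>" "0 < \<gamma>" "\<gamma> \<le> 1"
  shows "locally_Hoelder \<gamma> f"
proof (cases k)
  case 0
  then show ?thesis using assms by (auto simp: Hoelder_loc_space_def)
next
  case (Suc l)
  then have "f \<in> C_space (Suc 0)"
    using assms(1) by (intro C_space_mono[of "Suc 0" k]) (auto simp: Hoelder_loc_space_def simp del: C_space.simps)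
  then show ?thesis using assms by (intro C1_imp_locally_Hoelder)
qed

lemma locally_Hoelder_cball:
  assumes "locally_Hoelder \<gamma> f"
  obtains C where "0 \<le> C" "\<And>x y. x \<in> cball 0 r \<Longrightarrow> y \<in> cball 0 r \<Longrightarrow> \<bar>f x - f y\<bar> \<le> C * norm (x - y) powr \<gamma>"
proof -
  obtain C where C: "\<And>x y. x \<in> cball 0 r \<Longrightarrow> y \<in> cball 0 r \<Longrightarrow> \<bar>f x - f y\<bar> \<le> C * norm (x - y) powr \<gamma>"
    using assms compact_cball[of 0 r] unfolding locally_Hoelder_def by metis
  have "C * norm (x - y) powr \<gamma> \<le> max 0 C * norm (x - y) powr \<gamma>" for x y
    by (intro mult_right_mono) auto
  then show ?thesis using C by (intro that[of "max 0 C"]) (simp, rule order_trans)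
qed

lemma second_diff_Hoelder_of_Hoelder:
  fixes f :: "real ^ 'n::finite \<Rightarrow> real"
  assumes "continuous_on UNIV f" "locally_Hoelder \<gamma> f"
  shows "second_diff_Hoelder \<gamma> f"
  unfolding second_diff_Hoelder_def
proof (intro conjI allI assms(1))
  fix r :: real
  obtain C where C: "0 \<le> C" "\<And>x y. x \<in> cball 0 (r + 1) \<Longrightarrow> y \<in> cball 0 (r + 1) \<Longrightarrow> \<bar>f x - f y\<bar> \<le> C * norm (x - y) powr \<gamma>"
    using locally_Hoelder_cball[OF assms(2), of "r + 1"] by blast
  have "\<bar>second_diff f x z\<bar> \<le> (2 * C) * norm z powr \<gamma>" if x: "x \<in> cball 0 r" and z: "z \<in> cball 0 1" for x z
  proof -
    have "x \<in> cball 0 (r + 1)" "x + z \<in> cball 0 (r + 1)" "x - z \<in> cball 0 (r + 1)"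
      using x z norm_triangle_ineq[of x z] norm_triangle_ineq4[of x z] by auto
    then have "\<bar>f x - f (x + z)\<bar> \<le> C * norm z powr \<gamma>" "\<bar>f x - f (x - z)\<bar> \<le> C * norm z powr \<gamma>"
      using C(2)[of x "x + z"] C(2)[of x "x - z"] by auto
    then show ?thesis unfolding second_diff_def by linarith
  qed
  then show "\<exists>C\<ge>0. \<forall>x\<in>cball 0 r. \<forall>z\<in>cball 0 1. \<bar>second_diff f x z\<bar> \<le> C * norm z powr \<gamma>"
    using C(1) by (intro exI[of _ "2 * C"]) auto
qed

text \<open>The linear terms of the increments by z and -z cancel in the second difference. What
  remains is the oscillation of the gradient times |z|, which adds one to the exponent.\<close>

lemma second_diff_Hoelder_of_C1_Hoelder:
  fixes f :: "real ^ 'n::finite \<Rightarrow> real"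
  assumes f: "f \<in> C_space (Suc 0)" and h: "\<And>i. locally_Hoelder \<gamma> (partial_deriv i f)" and \<gamma>: "0 < \<gamma>"
  shows "second_diff_Hoelder (1 + \<gamma>) f"
  unfolding second_diff_Hoelder_def
proof (intro conjI allI)
  show "continuous_on UNIV f" by (rule C_space_continuous[OF f])
  fix r :: real
  have "\<forall>i. \<exists>C\<ge>0. \<forall>x\<in>cball 0 (r + 1). \<forall>y\<in>cball 0 (r + 1).
      \<bar>partial_deriv i f x - partial_deriv i f y\<bar> \<le> C * norm (x - y) powr \<gamma>"
    using locally_Hoelder_cball[OF h, of "r + 1"] by metis
  then obtain C' where C': "\<And>i. 0 \<le> C' i" "\<And>i x y. x \<in> cball 0 (r + 1) \<Longrightarrow> y \<in> cball 0 (r + 1) \<Longrightarrow>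
      \<bar>partial_deriv i f x - partial_deriv i f y\<bar> \<le> C' i * norm (x - y) powr \<gamma>"
    by metis
  define C where "C = (\<Sum>i\<in>UNIV. C' i)"
  have C0: "0 \<le> C" using C'(1) by (simp add: C_def sum_nonneg)
  have C'C: "C' i \<le> C" for i
    unfolding C_def using C'(1) by (intro member_le_sum) auto
  have "\<bar>second_diff f x z\<bar> \<le> (2 * real CARD('n) * C) * norm z powr (1 + \<gamma>)"
    if x: "x \<in> cball 0 r" and z: "z \<in> cball 0 1" for x z
  proof -
    let ?d = "\<lambda>i. partial_deriv i f x"
    have bd: "\<bar>partial_deriv i f y - ?d i\<bar> \<le> C * norm z powr \<gamma>" if "norm (y - x) \<le> norm z" for i y
    proof -
      have "y \<in> cball 0 (r + 1)" "x \<in> cball 0 (r + 1)"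
        using that x z norm_triangle_ineq[of "y - x" x] by auto
      then have "\<bar>partial_deriv i f y - ?d i\<bar> \<le> C' i * norm (y - x) powr \<gamma>" by (rule C'(2))
      also have "\<dots> \<le> C * norm z powr \<gamma>"
        using that \<gamma> C'C[of i] C0 by (intro mult_mono powr_mono2) auto
      finally show ?thesis .
    qed
    have 1: "\<bar>f (x + z) - f x - (\<Sum>i\<in>UNIV. z $ i * ?d i)\<bar> \<le> real CARD('n) * norm z * (C * norm z powr \<gamma>)"
      by (rule increment_bound[OF C_space_SucD(1)[OF f] bd])
    have "\<bar>f (x + (- z)) - f x - (\<Sum>i\<in>UNIV. (- z) $ i * ?d i)\<bar> \<le> real CARD('n) * norm (- z) * (C * norm z powr \<gamma>)"
      by (rule increment_bound[OF C_space_SucD(1)[OF f]]) (use bd in simp)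
    then have 2: "\<bar>f (x - z) - f x + (\<Sum>i\<in>UNIV. z $ i * ?d i)\<bar> \<le> real CARD('n) * norm z * (C * norm z powr \<gamma>)"
      by (simp add: sum_negf)
    have "\<bar>second_diff f x z\<bar> \<le> 2 * (real CARD('n) * norm z * (C * norm z powr \<gamma>))"
      using 1 2 unfolding second_diff_def by linarith
    also have "\<dots> = (2 * real CARD('n) * C) * norm z powr (1 + \<gamma>)"
      by (simp add: powr_add mult_ac)
    finally show ?thesis .
  qed
  then show "\<exists>C\<ge>0. \<forall>x\<in>cball 0 r. \<forall>z\<in>cball 0 1. \<bar>second_diff f x z\<bar> \<le> C * norm z powr (1 + \<gamma>)"
    using C0 by (intro exI[of _ "2 * real CARD('n) * C"]) auto
qed

text \<open>Derivatives up to order \<open>k\<close> with one and the same second difference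
  exponent: exactly what is required to differentiate the singular integral \<open>k\<close> times,
  with the integer and fractional parts of \<alpha> no longer visible.\<close>

primrec second_diff_space :: "nat \<Rightarrow> real \<Rightarrow> (real ^ 'n::finite \<Rightarrow> real) set" where
  "second_diff_space 0 \<delta> = {f. second_diff_Hoelder \<delta> f}"
| "second_diff_space (Suc k) \<delta> =
     {f. second_diff_Hoelder \<delta> f \<and> (\<forall>i. \<exists>g \<in> second_diff_space k \<delta>. has_pd i f g)}"

lemma second_diff_spaceD: "f \<in> second_diff_space k \<delta> \<Longrightarrow> second_diff_Hoelder \<delta> f"
  by (cases k) auto

lemma Hoelder_loc_space_second_diff_Hoelder:
  assumes "f \<in> Hoelder_loc_space (k + l) \<gamma>" "l \<le> 1" "0 < \<gamma>" "\<gamma> < 1"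
  shows "second_diff_Hoelder (real l + \<gamma>) f"
proof (cases "l = 0")
  case True
  then show ?thesis
    using assms Hoelder_loc_space_imp_locally_Hoelder[of f "k + l" \<gamma>]
    by (auto intro!: second_diff_Hoelder_of_Hoelder simp: Hoelder_loc_space_def C_space_continuous)
next
  case False
  with assms(2) have l: "l = 1" by simp
  have "f \<in> C_space (Suc 0)"
    using assms(1) l by (intro C_space_mono[of "Suc 0" "k + l"]) (auto simp: Hoelder_loc_space_def simp del: C_space.simps)
  moreover have "locally_Hoelder \<gamma> (partial_deriv i f)" for i
    using assms l by (intro Hoelder_loc_space_imp_locally_Hoelder[of _ k] Hoelder_loc_space_partial_deriv) auto
  ultimately show ?thesis
    using second_diff_Hoelder_of_C1_Hoelder[of f \<gamma>] assms(3) l by simp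
qed

lemma Hoelder_loc_space_subset_second_diff_space:
  assumes "f \<in> Hoelder_loc_space (k + l) \<gamma>" "l \<le> 1" "0 < \<gamma>" "\<gamma> < 1"
  shows "f \<in> second_diff_space k (real l + \<gamma>)"
  using assms(1)
proof (induction k arbitrary: f)
  case 0
  then show ?case using Hoelder_loc_space_second_diff_Hoelder[OF 0 assms(2-4)] by simp
next
  case (Suc k)
  have "f \<in> C_space (Suc (k + l))" using Suc.prems by (simp add: Hoelder_loc_space_def)
  then have "has_pd i f (partial_deriv i f)" for i by (rule C_space_SucD)
  moreover have "partial_deriv i f \<in> second_diff_space k (real l + \<gamma>)" for i
    using Suc.prems by (intro Suc.IH Hoelder_loc_space_partial_deriv) simp
  ultimately show ?case
    using Hoelder_loc_space_second_diff_Hoelder[OF Suc.prems assms(2-4)] by auto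
qed

section \<open>The singular part of the kernel\<close>

context
  fixes \<kappa> :: "real ^ 'n::finite \<Rightarrow> real" and \<delta> :: real
  assumes supp: "\<And>z. norm z > 1 \<Longrightarrow> \<kappa> z = 0"
    and meas [measurable]: "\<kappa> \<in> borel_measurable borel"
    and int: "integrable lborel (\<lambda>z. \<bar>\<kappa> z\<bar> * norm z powr \<delta>)"
begin

text \<open>Only values of \<open>f\<close> within distance 1 of x enter. Derivatives of u can
  therefore be inserted for \<open>f\<close> although nothing is known about their growth.\<close>

lemma singular_part_dominated:
  assumes "second_diff_Hoelder \<delta> f"
  shows "\<exists>h. integrable lborel h \<and> (\<forall>x\<in>cball 0 r. \<forall>z. \<bar>\<kappa> z * second_diff f x z\<bar> \<le> h z)"
proof -
  obtain C where C: "\<And>x z. x \<in> cball 0 r \<Longrightarrow> z \<in> cball 0 1 \<Longrightarrow> \<bar>second_diff f x z\<bar> \<le> C * norm z powr \<delta>"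
    using assms unfolding second_diff_Hoelder_def by meson
  have "\<bar>\<kappa> z * second_diff f x z\<bar> \<le> C * (\<bar>\<kappa> z\<bar> * norm z powr \<delta>)" if "x \<in> cball 0 r" for x z
  proof (cases "norm z > 1")
    case False
    then have "\<bar>\<kappa> z\<bar> * \<bar>second_diff f x z\<bar> \<le> \<bar>\<kappa> z\<bar> * (C * norm z powr \<delta>)"
      using that by (intro mult_left_mono C) auto
    then show ?thesis by (simp add: abs_mult mult_ac)
  qed (simp add: supp)
  moreover have "integrable lborel (\<lambda>z. C * (\<bar>\<kappa> z\<bar> * norm z powr \<delta>))" using int by simp
  ultimately show ?thesis by blast
qed

lemma singular_part_continuous:
  assumes f: "second_diff_Hoelder \<delta> f"
  shows "continuous_on UNIV (\<lambda>x. LINT z|lborel. \<kappa> z * second_diff f x z)"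
proof (rule continuous_on_integral_dominated)
  have cf: "continuous_on UNIV f" using f by (simp add: second_diff_Hoelder_def)
  then have [measurable]: "f \<in> borel_measurable borel" by (rule borel_measurable_continuous_onI)
  show "(\<lambda>z. \<kappa> z * second_diff f x z) \<in> borel_measurable lborel" for x by simp
  show "continuous_on UNIV (\<lambda>x. \<kappa> z * second_diff f x z)" for z
    unfolding second_diff_def
    by (intro continuous_intros continuous_on_compose2[OF cf]) auto
  fix x0 :: "real ^ 'n"
  have "ball x0 1 \<subseteq> cball 0 (norm x0 + 1)"
  proof
    fix y assume "y \<in> ball x0 1"
    then show "y \<in> cball 0 (norm x0 + 1)"
      using norm_triangle_ineq[of "y - x0" x0] by (simp add: dist_norm norm_minus_commute)
  qed
  then show "\<exists>h. integrable lborel h \<and> (\<forall>x\<in>ball x0 1. \<forall>z. \<bar>\<kappa> z * second_diff f x z\<bar> \<le> h z)"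
    using singular_part_dominated[OF f, of "norm x0 + 1"] by blast
qed

text \<open>The kernel depends on z alone, and differentiating \<open>second_diff f x z\<close> in x
  gives \<open>second_diff g x z\<close>; the dominating function is that of
  \<open>g\<close>.\<close>

lemma singular_part_has_pd:
  assumes f: "second_diff_Hoelder \<delta> f" and g: "second_diff_Hoelder \<delta> g" and pd: "has_pd i f g"
  shows "has_pd i (\<lambda>x. LINT z|lborel. \<kappa> z * second_diff f x z) (\<lambda>x. LINT z|lborel. \<kappa> z * second_diff g x z)"
  unfolding has_pd_def
proof
  fix x :: "real ^ 'n"
  have [measurable]: "f \<in> borel_measurable borel"
    using f by (auto simp: second_diff_Hoelder_def intro: borel_measurable_continuous_onI)
  let ?e = "\<lambda>t::real. x + t *\<^sub>R axis i 1"
  have inball: "?e t \<in> cball 0 (norm x + 1)" if "\<bar>t\<bar> < 1" for t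
    using that norm_triangle_ineq[of x "t *\<^sub>R axis i 1"] by simp
  obtain h where h: "integrable lborel h" "\<And>y z. y \<in> cball 0 (norm x + 1) \<Longrightarrow> \<bar>\<kappa> z * second_diff g y z\<bar> \<le> h z"
    using singular_part_dominated[OF g, of "norm x + 1"] by blast
  obtain h' where h': "integrable lborel h'" "\<And>y z. y \<in> cball 0 (norm x + 1) \<Longrightarrow> \<bar>\<kappa> z * second_diff f y z\<bar> \<le> h' z"
    using singular_part_dominated[OF f, of "norm x + 1"] by blast
  have "((\<lambda>t. LINT z|lborel. \<kappa> z * second_diff f (?e t) z) has_field_derivative
      (LINT z|lborel. \<kappa> z * second_diff g (?e 0) z)) (at 0)"
  proof (rule has_field_derivative_integral(1)[where d = 1 and h = h])
    show "integrable lborel (\<lambda>z. \<kappa> z * second_diff f (?e t) z)" if "\<bar>t\<bar> < 1" for t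
      by (rule Bochner_Integration.integrable_bound[OF h'(1)])
         (use h'(2)[OF inball[OF that]] in \<open>auto intro!: AE_I2 simp del: abs_mult intro: order_trans[OF _ abs_ge_self]\<close>)
    have "((\<lambda>t. f (?e t + w)) has_field_derivative g (?e t + w)) (at t)" for t w
      using has_pd_along[OF pd, of "x + w" t] by (simp add: algebra_simps)
    from this[of 0] this[of z for z] this[of "- z" for z]
    show "((\<lambda>t. \<kappa> z * second_diff f (?e t) z) has_field_derivative \<kappa> z * second_diff g (?e t) z) (at t)" for t z
      unfolding second_diff_def by (auto intro!: derivative_eq_intros)
    show "\<bar>\<kappa> z * second_diff g (?e t) z\<bar> \<le> h z" if "\<bar>t\<bar> < 1" for t z
      by (rule h(2)[OF inball[OF that]])
  qed (use h in auto)
  then show "((\<lambda>t. LINT z|lborel. \<kappa> z * second_diff f (?e t) z) has_field_derivative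
      (LINT z|lborel. \<kappa> z * second_diff g x z)) (at 0)" by simp
qed

lemma singular_part_C_space:
  "f \<in> second_diff_space k \<delta> \<Longrightarrow> (\<lambda>x. LINT z|lborel. \<kappa> z * second_diff f x z) \<in> C_space k"
proof (induction k arbitrary: f)
  case 0
  then show ?case using singular_part_continuous by simp
next
  case (Suc k)
  show ?case
  proof (rule C_space_SucI)
    show "continuous_on UNIV (\<lambda>x. LINT z|lborel. \<kappa> z * second_diff f x z)"
      by (rule singular_part_continuous[OF second_diff_spaceD[OF Suc.prems]])
    fix i
    obtain g where g: "g \<in> second_diff_space k \<delta>" "has_pd i f g" using Suc.prems by auto
    then show "\<exists>G\<in>C_space k. has_pd i (\<lambda>x. LINT z|lborel. \<kappa> z * second_diff f x z) G"
      using Suc.IH[OF g(1)] singular_part_has_pd[OF second_diff_spaceD[OF Suc.prems] second_diff_spaceD[OF g(1)] g(2)]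
      by blast
  qed
qed

end

section \<open>The regular part of the kernel\<close>

text \<open>All derivatives are measured by the same weight, without recording their faster decay:
  integrability of u against this weight is what each differentiation under the integral
  uses.\<close>

primrec tail_kernel_space :: "nat \<Rightarrow> real \<Rightarrow> (real ^ 'n::finite \<Rightarrow> real) set" where
  "tail_kernel_space 0 s = {k. continuous_on UNIV k \<and> (\<exists>C. \<forall>z. \<bar>k z\<bar> \<le> C * tail_weight s z)}"
| "tail_kernel_space (Suc j) s = {k. continuous_on UNIV k \<and> (\<exists>C. \<forall>z. \<bar>k z\<bar> \<le> C * tail_weight s z) \<and>
     (\<forall>i. \<exists>k' \<in> tail_kernel_space j s. has_pd i k k')}"

lemma tail_kernel_spaceD:
  assumes "k \<in> tail_kernel_space j s"
  shows "continuous_on UNIV k" "\<exists>C. \<forall>z. \<bar>k z\<bar> \<le> C * tail_weight s z"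
  using assms by (cases j; auto)+

lemma tail_kernel_space_add:
  "k \<in> tail_kernel_space j s \<Longrightarrow> l \<in> tail_kernel_space j s \<Longrightarrow> (\<lambda>z. k z + l z) \<in> tail_kernel_space j s"
proof (induction j arbitrary: k l)
  case (0 k l)
  obtain C D where "\<And>z. \<bar>k z\<bar> \<le> C * tail_weight s z" "\<And>z. \<bar>l z\<bar> \<le> D * tail_weight s z"
    using 0 by auto
  then have "\<bar>k z + l z\<bar> \<le> (C + D) * tail_weight s z" for z
    using abs_triangle_ineq[of "k z" "l z"] by (simp add: distrib_right) (meson add_mono order_trans)
  then show ?case using 0 by (auto intro: continuous_intros)
next
  case (Suc j k l)
  obtain C D where "\<And>z. \<bar>k z\<bar> \<le> C * tail_weight s z" "\<And>z. \<bar>l z\<bar> \<le> D * tail_weight s z"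
    using Suc.prems by auto
  then have "\<bar>k z + l z\<bar> \<le> (C + D) * tail_weight s z" for z
    using abs_triangle_ineq[of "k z" "l z"] by (simp add: distrib_right) (meson add_mono order_trans)
  moreover have "\<exists>m\<in>tail_kernel_space j s. has_pd i (\<lambda>z. k z + l z) m" for i
  proof -
    obtain k' l' where "k' \<in> tail_kernel_space j s" "has_pd i k k'" "l' \<in> tail_kernel_space j s" "has_pd i l l'"
      using Suc.prems by simp blast
    then show ?thesis using Suc.IH has_pd_add by blast
  qed
  ultimately show ?case using Suc.prems by (auto intro: continuous_intros)
qed

definition regular_part :: "(real ^ 'n::finite \<Rightarrow> real) \<Rightarrow> (real ^ 'n \<Rightarrow> real) \<Rightarrow> real ^ 'n \<Rightarrow> real" where
  "regular_part k u x = (LINT y|lborel. k (y - x) * u y)"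

context
  fixes u :: "real ^ 'n::finite \<Rightarrow> real" and s :: real
  assumes s: "0 < s" and u_meas [measurable]: "u \<in> borel_measurable borel"
    and u_int: "integrable lborel (\<lambda>x. \<bar>u x\<bar> * tail_weight s x)"
begin

lemma regular_part_dominated:
  assumes C: "\<And>z. \<bar>k z\<bar> \<le> C * tail_weight s z"
  shows "\<exists>h. integrable lborel h \<and> (\<forall>x\<in>cball 0 r. \<forall>y. \<bar>k (y - x) * u y\<bar> \<le> h y)"
proof -
  let ?c = "1 + 2 powr s * r powr s + 2 powr s"
  have C0: "0 \<le> C" using order_trans[OF abs_ge_zero C[of 0]] tail_weight_pos[of s 0]
    by (metis zero_le_mult_iff not_less)
  have "\<bar>k (y - x) * u y\<bar> \<le> C * (?c * (\<bar>u y\<bar> * tail_weight s y))" if x: "x \<in> cball 0 r" for x y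
  proof -
    have "\<bar>k (y - x)\<bar> \<le> C * (?c * tail_weight s y)"
      using x by (intro order_trans[OF C] mult_left_mono tail_weight_shift s C0) simp
    then have "\<bar>k (y - x)\<bar> * \<bar>u y\<bar> \<le> (C * (?c * tail_weight s y)) * \<bar>u y\<bar>"
      by (rule mult_right_mono) simp
    then show ?thesis by (simp add: abs_mult mult_ac)
  qed
  moreover have "integrable lborel (\<lambda>y. C * (?c * (\<bar>u y\<bar> * tail_weight s y)))"
    by (intro integrable_mult_right u_int)
  ultimately show ?thesis by blast
qed

lemma regular_part_integrable:
  assumes "k \<in> tail_kernel_space j s"
  shows "integrable lborel (\<lambda>y. k (y - x) * u y)"
proof -
  have [measurable]: "k \<in> borel_measurable borel"
    using tail_kernel_spaceD(1)[OF assms] by (rule borel_measurable_continuous_onI)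
  obtain C where "\<And>z. \<bar>k z\<bar> \<le> C * tail_weight s z"
    using tail_kernel_spaceD(2)[OF assms] by blast
  then obtain h where h: "integrable lborel h" "\<And>y. \<bar>k (y - x) * u y\<bar> \<le> h y"
    using regular_part_dominated[of k C "norm x"] by auto
  show ?thesis
    by (rule Bochner_Integration.integrable_bound[OF h(1)])
       (use h(2) in \<open>auto intro!: AE_I2 simp del: abs_mult intro: order_trans[OF _ abs_ge_self]\<close>)
qed

lemma regular_part_continuous:
  assumes k: "k \<in> tail_kernel_space j s"
  shows "continuous_on UNIV (regular_part k u)"
  unfolding regular_part_def
proof (rule continuous_on_integral_dominated)
  note ck = tail_kernel_spaceD(1)[OF k]
  show "(\<lambda>y. k (y - x) * u y) \<in> borel_measurable lborel" for x
    using regular_part_integrable[OF k] by simp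
  show "continuous_on UNIV (\<lambda>x. k (y - x) * u y)" for y
    by (intro continuous_intros continuous_on_compose2[OF ck]) auto
  fix x0 :: "real ^ 'n"
  have "ball x0 1 \<subseteq> cball 0 (norm x0 + 1)"
  proof
    fix y assume "y \<in> ball x0 1"
    then show "y \<in> cball 0 (norm x0 + 1)"
      using norm_triangle_ineq[of "y - x0" x0] by (simp add: dist_norm norm_minus_commute)
  qed
  moreover obtain C where "\<And>z. \<bar>k z\<bar> \<le> C * tail_weight s z"
    using tail_kernel_spaceD(2)[OF k] by blast
  ultimately show "\<exists>h. integrable lborel h \<and> (\<forall>x\<in>ball x0 1. \<forall>y. \<bar>k (y - x) * u y\<bar> \<le> h y)"
    using regular_part_dominated[of k C "norm x0 + 1"] by blast
qed

text \<open>The variable x occurs only in the kernel, with a minus sign; hence the factor -1, and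
  hence no derivative of u.\<close>

lemma regular_part_has_pd:
  assumes k: "k \<in> tail_kernel_space j s" and k': "k' \<in> tail_kernel_space j' s" and pd: "has_pd i k k'"
  shows "has_pd i (regular_part k u) (\<lambda>x. - 1 * regular_part k' u x)"
  unfolding has_pd_def
proof
  fix x :: "real ^ 'n"
  let ?e = "\<lambda>t::real. x + t *\<^sub>R axis i 1"
  have inball: "?e t \<in> cball 0 (norm x + 1)" if "\<bar>t\<bar> < 1" for t
    using that norm_triangle_ineq[of x "t *\<^sub>R axis i 1"] by simp
  obtain C where "\<And>z. \<bar>k' z\<bar> \<le> C * tail_weight s z"
    using tail_kernel_spaceD(2)[OF k'] by blast
  then obtain h where h: "integrable lborel h" "\<And>w y. w \<in> cball 0 (norm x + 1) \<Longrightarrow> \<bar>k' (y - w) * u y\<bar> \<le> h y"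
    using regular_part_dominated[of k' C "norm x + 1"] by blast
  have "((\<lambda>t. LINT y|lborel. k (y - ?e t) * u y) has_field_derivative
      (LINT y|lborel. - 1 * (k' (y - ?e 0) * u y))) (at 0)"
  proof (rule has_field_derivative_integral(1)[where d = 1 and h = h])
    show "integrable lborel (\<lambda>y. k (y - ?e t) * u y)" for t
      by (rule regular_part_integrable[OF k])
    show "((\<lambda>t. k (y - ?e t) * u y) has_field_derivative - 1 * (k' (y - ?e t) * u y)) (at t)" for t y
    proof -
      have "((\<lambda>r. k (y - x + r *\<^sub>R axis i 1)) has_field_derivative k' (y - x + (- t) *\<^sub>R axis i 1)) (at (- t))"
        by (rule has_pd_along[OF pd])
      then have "((\<lambda>t. k (y - x + (- t) *\<^sub>R axis i 1)) has_field_derivative k' (y - x + (- t) *\<^sub>R axis i 1) * (- 1)) (at t)"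
        by (rule DERIV_chain2) (auto intro!: derivative_eq_intros)
      then have "((\<lambda>t. k (y - ?e t)) has_field_derivative k' (y - ?e t) * (- 1)) (at t)"
        by (simp add: algebra_simps)
      from DERIV_cmult_right[OF this, of "u y"] show ?thesis
        by (rule DERIV_cong) simp
    qed
    show "\<bar>- 1 * (k' (y - ?e t) * u y)\<bar> \<le> h y" if "\<bar>t\<bar> < 1" for t y
      using h(2)[OF inball[OF that]] by simp
  qed (use h in auto)
  then show "((\<lambda>t. regular_part k u (?e t)) has_field_derivative - 1 * regular_part k' u x) (at 0)"
    unfolding regular_part_def by simp
qed

lemma regular_part_C_space: "k \<in> tail_kernel_space j s \<Longrightarrow> regular_part k u \<in> C_space j"
proof (induction j arbitrary: k)
  case 0
  then show ?case using regular_part_continuous[OF 0] by simp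
next
  case (Suc j)
  show ?case
  proof (rule C_space_SucI)
    show "continuous_on UNIV (regular_part k u)" by (rule regular_part_continuous[OF Suc.prems])
    fix i
    obtain k' where k': "k' \<in> tail_kernel_space j s" "has_pd i k k'" using Suc.prems by auto
    have "(\<lambda>x. - 1 * regular_part k' u x) \<in> C_space j"
      by (rule C_space_cmult[OF Suc.IH[OF k'(1)]])
    then show "\<exists>g\<in>C_space j. has_pd i (regular_part k u) g"
      using regular_part_has_pd[OF Suc.prems k'] by blast
  qed
qed

end

section \<open>A smooth kernel that agrees with the singular one off the unit ball\<close>

lemma has_field_derivative_glue:
  fixes f g :: "real \<Rightarrow> real"
  assumes f: "(f has_field_derivative D) (at c)" and g: "(g has_field_derivative D) (at c)" and fg: "f c = g c"
  shows "((\<lambda>t. if t \<le> c then f t else g t) has_field_derivative D) (at c)"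
proof -
  let ?h = "\<lambda>t. if t \<le> c then f t else g t"
  have "((\<lambda>y. (?h y - ?h c) / (y - c)) \<longlongrightarrow> D) (at_left c)"
  proof (rule Lim_transform_eventually)
    show "((\<lambda>y. (f y - f c) / (y - c)) \<longlongrightarrow> D) (at_left c)"
      using has_field_derivative_at_within[OF f, of "{..<c}"] by (simp add: has_field_derivative_iff)
    show "\<forall>\<^sub>F y in at_left c. (f y - f c) / (y - c) = (?h y - ?h c) / (y - c)"
      by (auto simp: eventually_at_filter)
  qed
  moreover have "((\<lambda>y. (?h y - ?h c) / (y - c)) \<longlongrightarrow> D) (at_right c)"
  proof (rule Lim_transform_eventually)
    show "((\<lambda>y. (g y - g c) / (y - c)) \<longlongrightarrow> D) (at_right c)"
      using has_field_derivative_at_within[OF g, of "{c<..}"] by (simp add: has_field_derivative_iff)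
    show "\<forall>\<^sub>F y in at_right c. (g y - g c) / (y - c) = (?h y - ?h c) / (y - c)"
      using fg by (auto simp: eventually_at_filter)
  qed
  ultimately show ?thesis
    by (simp add: has_field_derivative_iff filterlim_split_at_real)
qed

text \<open>The falling factorial of -b: for t > 0, the a-th derivative of
  \<open>t powr (- b)\<close> is this coefficient times \<open>t powr (- b - a)\<close>.\<close>

definition powr_deriv_coeff :: "real \<Rightarrow> nat \<Rightarrow> real" where
  "powr_deriv_coeff b a = (\<Prod>l<a. - b - real l)"

text \<open>The \<open>a\<close>-th derivative of the function that is \<open>t powr (- b)\<close> for \<open>t > 1\<close> and is
  continued to \<open>t \<le> 1\<close> by its Taylor polynomial of degree \<open>a + r\<close> at \<open>1\<close>.\<close>

definition taylor_powr :: "real \<Rightarrow> nat \<Rightarrow> nat \<Rightarrow> real \<Rightarrow> real" where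
  "taylor_powr b a r t = (if t \<le> 1 then \<Sum>l\<le>r. powr_deriv_coeff b (a + l) * ((t - 1) ^ l / fact l)
     else powr_deriv_coeff b a * t powr (- b - real a))"

text \<open>Differentiating a Taylor polynomial gives the Taylor polynomial of the derivative with
  one degree less, so \<open>r\<close> counts the derivatives still available. At t = 1 the constant
  term of the polynomial agrees with the power, which glues the values and the slopes.\<close>

lemma has_field_derivative_taylor_powr:
  "(taylor_powr b a (Suc r) has_field_derivative taylor_powr b (Suc a) r t) (at t)"
proof -
  let ?c = "powr_deriv_coeff b"
  let ?T = "\<lambda>a r t. \<Sum>l\<le>r. ?c (a + l) * ((t - 1) ^ l / fact l)"
  let ?P = "\<lambda>a t. ?c a * t powr (- b - real a)"
  have T: "(?T a (Suc r) has_field_derivative ?T (Suc a) r t) (at t)" for t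
  proof -
    have "((\<lambda>t. (t - 1) ^ Suc l / fact (Suc l)) has_field_derivative (t - 1) ^ l / fact l) (at t)" for l
    proof -
      have "((\<lambda>t. (t - 1) ^ Suc l / fact (Suc l)) has_field_derivative
          (real (Suc l) * (t - 1) ^ l) / fact (Suc l)) (at t)"
        by (auto intro!: derivative_eq_intros DERIV_cdivide simp del: power_Suc fact_Suc)
      then show ?thesis
        by (rule DERIV_cong) (simp add: fact_Suc del: of_nat_Suc)
    qed
    then have "((\<lambda>t. ?c (a + 0) * ((t - 1) ^ 0 / fact 0) + (\<Sum>l\<le>r. ?c (a + Suc l) * ((t - 1) ^ Suc l / fact (Suc l))))
        has_field_derivative 0 + (\<Sum>l\<le>r. ?c (a + Suc l) * ((t - 1) ^ l / fact l))) (at t)"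
      by (intro DERIV_add DERIV_sum DERIV_cmult) auto
    then show ?thesis
      unfolding sum.atMost_Suc_shift by simp
  qed
  have P: "(?P a has_field_derivative ?P (Suc a) t) (at t)" if "0 < t" for t
  proof -
    have c: "?c (Suc a) = ?c a * (- b - real a)" by (simp add: powr_deriv_coeff_def)
    have "((\<lambda>t. t powr (- b - real a)) has_field_derivative (- b - real a) * t powr (- b - real a - 1)) (at t)"
      using that by (intro has_real_derivative_powr)
    from DERIV_cmult[OF this, of "?c a"] show ?thesis
      by (rule DERIV_cong) (simp add: c diff_diff_eq add.commute)
  qed
  have T1: "?T a r 1 = ?c a" for a r
    by (subst sum.remove[of _ 0]) (auto intro!: sum.neutral)
  consider "t < 1" | "t = 1" | "1 < t" by linarith
  then show ?thesis
  proof cases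
    case 1
    have "(taylor_powr b a (Suc r) has_field_derivative ?T (Suc a) r t) (at t)"
      by (rule has_field_derivative_transform_within_open[OF T, of "{..<1}"])
         (use 1 in \<open>auto simp: taylor_powr_def\<close>)
    then show ?thesis using 1 by (simp add: taylor_powr_def)
  next
    case 2
    have "((\<lambda>t. if t \<le> 1 then ?T a (Suc r) t else ?P a t) has_field_derivative ?T (Suc a) r 1) (at 1)"
    proof (rule has_field_derivative_glue)
      show "(?T a (Suc r) has_field_derivative ?T (Suc a) r 1) (at 1)" by (rule T)
      show "(?P a has_field_derivative ?T (Suc a) r 1) (at 1)"
        using P[of 1] unfolding T1 by simp
      show "?T a (Suc r) 1 = ?P a 1" unfolding T1 by simp
    qed
    then show ?thesis using 2 by (simp add: taylor_powr_def[abs_def])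
  next
    case 3
    have "(taylor_powr b a (Suc r) has_field_derivative ?P (Suc a) t) (at t)"
      by (rule has_field_derivative_transform_within_open[OF P, of _ "{1<..}"])
         (use 3 in \<open>auto simp: taylor_powr_def\<close>)
    then show ?thesis using 3 by (simp add: taylor_powr_def)
  qed
qed

lemma continuous_on_taylor_powr: "continuous_on UNIV (taylor_powr b a r)"
  unfolding taylor_powr_def[abs_def]
proof (rule continuous_on_cases_1)
  have "(\<Sum>l\<le>r. powr_deriv_coeff b (a + l) * ((1 - 1) ^ l / fact l)) = powr_deriv_coeff b a"
    by (subst sum.remove[of _ 0]) (auto intro!: sum.neutral)
  then show "(\<Sum>l\<le>r. powr_deriv_coeff b (a + l) * ((1 - 1) ^ l / fact l)) = powr_deriv_coeff b a * 1 powr (- b - real a)"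
    by simp
qed (auto intro!: continuous_intros)

text \<open>Polynomials of degree at most \<open>L\<close>. The inductive form yields closure under
  partial derivatives, continuity and the growth bound by rule induction, with no bookkeeping of
  coefficients.\<close>

inductive polynomial_le :: "nat \<Rightarrow> (real ^ 'n::finite \<Rightarrow> real) \<Rightarrow> bool" where
  const: "polynomial_le L (\<lambda>z. c)"
| comp: "polynomial_le L p \<Longrightarrow> polynomial_le (Suc L) (\<lambda>z. z $ i * p z)"
| add: "polynomial_le L p \<Longrightarrow> polynomial_le L q \<Longrightarrow> polynomial_le L (\<lambda>z. p z + q z)"

lemma polynomial_le_Suc: "polynomial_le L p \<Longrightarrow> polynomial_le (Suc L) p"
  by (induction rule: polynomial_le.induct) (auto intro: polynomial_le.intros)

lemma polynomial_le_continuous: "polynomial_le L p \<Longrightarrow> continuous_on UNIV p"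
  by (induction rule: polynomial_le.induct) (auto intro!: continuous_intros)

lemma polynomial_le_has_pd: "polynomial_le L p \<Longrightarrow> \<exists>p'. has_pd i p p' \<and> polynomial_le L p'"
proof (induction rule: polynomial_le.induct)
  case (const L c)
  then show ?case using has_pd_const polynomial_le.const by blast
next
  case (comp L p j)
  then obtain p' where p': "has_pd i p p'" "polynomial_le L p'" by blast
  have "has_pd i (\<lambda>z. z $ j) (\<lambda>x. if i = j then 1 else 0)"
    using has_pd_component[of i 0 j] by simp
  from has_pd_mult[OF this p'(1)]
  have "has_pd i (\<lambda>z. z $ j * p z) (\<lambda>z. (if i = j then p z else 0) + z $ j * p' z)"
    by (cases "i = j") simp_all
  moreover have "polynomial_le (Suc L) (\<lambda>z. (if i = j then p z else 0) + z $ j * p' z)"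
  proof (rule polynomial_le.add)
    show "polynomial_le (Suc L) (\<lambda>z. if i = j then p z else 0)"
      using comp polynomial_le_Suc polynomial_le.const by (cases "i = j") auto
  qed (rule polynomial_le.comp[OF p'(2)])
  ultimately show ?case by blast
next
  case (add L p q)
  then show ?case using has_pd_add polynomial_le.add by blast
qed

lemma polynomial_le_bound: "polynomial_le L p \<Longrightarrow> \<exists>C\<ge>0. \<forall>z. \<bar>p z\<bar> \<le> C * max 1 (norm z) ^ L"
proof (induction rule: polynomial_le.induct)
  case (const L c)
  have "\<bar>c\<bar> * 1 \<le> \<bar>c\<bar> * max 1 (norm z) ^ L" for z :: "real ^ 'a"
    by (intro mult_left_mono one_le_power) auto
  then show ?case by (intro exI[of _ "\<bar>c\<bar>"]) auto
next
  case (comp L p i)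
  then obtain C where C: "0 \<le> C" "\<And>z. \<bar>p z\<bar> \<le> C * max 1 (norm z) ^ L" by blast
  have "\<bar>z $ i * p z\<bar> \<le> C * max 1 (norm z) ^ Suc L" for z
  proof -
    have "\<bar>z $ i\<bar> * \<bar>p z\<bar> \<le> max 1 (norm z) * (C * max 1 (norm z) ^ L)"
      using component_le_norm_cart[of z i] by (intro mult_mono C) auto
    then show ?thesis by (simp add: abs_mult mult_ac)
  qed
  then show ?case using C(1) by blast
next
  case (add L p q)
  then obtain C D where "0 \<le> C" "\<And>z. \<bar>p z\<bar> \<le> C * max 1 (norm z) ^ L"
    "0 \<le> D" "\<And>z. \<bar>q z\<bar> \<le> D * max 1 (norm z) ^ L" by blast
  then have "\<bar>p z + q z\<bar> \<le> (C + D) * max 1 (norm z) ^ L" for z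
    using abs_triangle_ineq[of "p z" "q z"] by (simp add: distrib_right) (meson add_mono order_trans)
  then show ?case using \<open>0 \<le> C\<close> \<open>0 \<le> D\<close> by (intro exI[of _ "C + D"]) auto
qed

text \<open>With argument |z|^2 and b = s/2, the a-th derivative decays like |z|^(-s-2a) off the
  unit ball. A polynomial factor of degree at most 2a uses up only the surplus and leaves
  |z|^(-s).\<close>

lemma taylor_kernel_bound:
  assumes s: "0 < s" and p: "polynomial_le L p" and L: "L \<le> 2 * a"
  shows "\<exists>C. \<forall>z::real ^ 'n::finite. \<bar>p z * taylor_powr (s / 2) a r ((norm z)\<^sup>2)\<bar> \<le> C * tail_weight s z"
proof -
  let ?G = "taylor_powr (s / 2) a r"
  obtain C where C: "0 \<le> C" "\<And>z. \<bar>p z\<bar> \<le> C * max 1 (norm z) ^ L"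
    using polynomial_le_bound[OF p] by blast
  obtain D where D: "0 \<le> D" "\<And>t. t \<in> cball 0 1 \<Longrightarrow> \<bar>?G t\<bar> \<le> D"
    by (rule continuous_bounded_on_cball[OF continuous_on_taylor_powr, of 0 1]) (rule that)
  let ?c = "\<bar>powr_deriv_coeff (s / 2) a\<bar>"
  have "\<bar>p z * ?G ((norm z)\<^sup>2)\<bar> \<le> (2 * C * (D + ?c)) * tail_weight s z" for z
  proof (cases "norm z \<le> 1")
    case True
    have "\<bar>p z\<bar> \<le> C" using C(2)[of z] by (simp add: max_absorb1[OF True])
    moreover have "(norm z)\<^sup>2 \<le> 1" using True by (simp add: power_le_one)
    then have "\<bar>?G ((norm z)\<^sup>2)\<bar> \<le> D" by (intro D(2)) simp
    ultimately have "\<bar>p z\<bar> * \<bar>?G ((norm z)\<^sup>2)\<bar> \<le> C * D" using C(1) by (intro mult_mono) auto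
    \<comment> \<open>The factor 2 in the constant compensates the weight, which is at least 1/2 on
      the unit ball.\<close>
    also have "\<dots> \<le> (2 * C * (D + ?c)) * (1 / 2)" using C(1) by (simp add: distrib_left)
    also have "\<dots> \<le> (2 * C * (D + ?c)) * tail_weight s z"
    proof (rule mult_left_mono)
      have "norm z powr s \<le> 1 powr s" using True s by (intro powr_mono2) auto
      then show "1 / 2 \<le> tail_weight s z"
        unfolding tail_weight_def by (intro divide_left_mono) (auto simp: add_pos_nonneg)
    qed (use C D in auto)
    finally show ?thesis by (simp add: abs_mult)
  next
    case False
    then have z: "1 < norm z" by simp
    have "1 < (norm z)\<^sup>2" using z by simp
    then have G: "?G ((norm z)\<^sup>2) = powr_deriv_coeff (s / 2) a * (norm z)\<^sup>2 powr (- (s / 2) - real a)"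
      by (simp add: taylor_powr_def)
    have "(norm z)\<^sup>2 = norm z powr 2" using z by simp
    then have "(norm z)\<^sup>2 powr (- (s / 2) - real a) = norm z powr (2 * (- (s / 2) - real a))"
      by (simp only: powr_powr)
    also have "2 * (- (s / 2) - real a) = - s - real (2 * a)" by (simp add: field_simps)
    finally have e: "(norm z)\<^sup>2 powr (- (s / 2) - real a) = norm z powr (- s - real (2 * a))" .
    have "\<bar>p z\<bar> \<le> C * norm z ^ L" using C(2)[of z] z by (simp add: max_def)
    also have "\<dots> \<le> C * norm z ^ (2 * a)" using C(1) z L by (intro mult_left_mono power_increasing) auto
    also have "norm z ^ (2 * a) = norm z powr real (2 * a)" by (rule powr_realpow[symmetric]) (use z in linarith)
    finally have "\<bar>p z\<bar> * \<bar>?G ((norm z)\<^sup>2)\<bar> \<le> (C * norm z powr real (2 * a)) * (?c * norm z powr (- s - real (2 * a)))"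
      unfolding G e by (intro mult_mono) (auto simp: abs_mult C)
    also have "\<dots> = C * ?c * (norm z powr real (2 * a) * norm z powr (- s - real (2 * a)))" by (simp add: mult_ac)
    also have "norm z powr real (2 * a) * norm z powr (- s - real (2 * a)) = 1 / norm z powr s"
      unfolding powr_add[symmetric] by (simp add: powr_minus_divide)
    also have "C * ?c * (1 / norm z powr s) \<le> C * ?c * (2 * tail_weight s z)"
      using inverse_norm_powr_le_tail_weight[of 1 z s] z s C(1) by (intro mult_left_mono) auto
    also have "\<dots> \<le> (2 * C * (D + ?c)) * tail_weight s z"
      using C(1) D(1) by (simp add: algebra_simps)
    finally show ?thesis by (simp add: abs_mult)
  qed
  then show ?thesis by blast
qed

text \<open>A derivative either falls on \<open>p\<close> and keeps the degree bound, or falls on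
  the profile, where it raises \<open>L\<close> and \<open>a\<close> by one each; both preserve
  \<open>L \<le> 2 * a\<close>. Each differentiation may use up one unit of
  \<open>r\<close>.\<close>

lemma taylor_kernel_in_tail_kernel_space:
  assumes s: "0 < s" and "polynomial_le L p" "L \<le> 2 * a" "j \<le> r"
  shows "(\<lambda>z::real ^ 'n::finite. p z * taylor_powr (s / 2) a r ((norm z)\<^sup>2)) \<in> tail_kernel_space j s"
  using assms(2-4)
proof (induction j arbitrary: L p a r)
  case 0
  have "continuous_on UNIV (\<lambda>z. p z * taylor_powr (s / 2) a r ((norm z)\<^sup>2))"
    by (intro continuous_intros polynomial_le_continuous[OF 0(1)]
        continuous_on_compose2[OF continuous_on_taylor_powr]) auto
  then show ?case using taylor_kernel_bound[OF s 0(1,2)] by simp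
next
  case (Suc j)
  obtain r' where r': "r = Suc r'" "j \<le> r'" using Suc.prems(3) by (cases r) auto
  have cont: "continuous_on UNIV (\<lambda>z. p z * taylor_powr (s / 2) a r ((norm z)\<^sup>2))"
    by (intro continuous_intros polynomial_le_continuous[OF Suc.prems(1)]
        continuous_on_compose2[OF continuous_on_taylor_powr]) auto
  have "\<exists>k' \<in> tail_kernel_space j s. has_pd i (\<lambda>z. p z * taylor_powr (s / 2) a r ((norm z)\<^sup>2)) k'" for i
  proof -
    obtain p' where p': "has_pd i p p'" "polynomial_le L p'"
      using polynomial_le_has_pd[OF Suc.prems(1)] by blast
    \<comment> \<open>The inner derivative 2 z_i multiplies \<open>p\<close>; the sum expresses the
      factor 2 in the form of the inductive rules.\<close>
    have q: "polynomial_le (Suc L) (\<lambda>z. z $ i * p z + z $ i * p z)"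
      by (intro polynomial_le.intros Suc.prems(1))
    have N: "has_pd i (\<lambda>z. (norm z)\<^sup>2) (\<lambda>z. 2 * z $ i)"
      using has_pd_norm_power2[of i 0] by simp
    have "has_pd i (\<lambda>z. taylor_powr (s / 2) a r ((norm z)\<^sup>2))
        (\<lambda>z. taylor_powr (s / 2) (Suc a) r' ((norm z)\<^sup>2) * (2 * z $ i))"
      unfolding r'(1) by (rule has_pd_compose[OF N has_field_derivative_taylor_powr])
    from has_pd_mult[OF p'(1) this]
    have "has_pd i (\<lambda>z. p z * taylor_powr (s / 2) a r ((norm z)\<^sup>2))
        (\<lambda>z. p' z * taylor_powr (s / 2) a r ((norm z)\<^sup>2)
          + (z $ i * p z + z $ i * p z) * taylor_powr (s / 2) (Suc a) r' ((norm z)\<^sup>2))"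
      by (simp add: algebra_simps)
    moreover have "(\<lambda>z. p' z * taylor_powr (s / 2) a r ((norm z)\<^sup>2)
          + (z $ i * p z + z $ i * p z) * taylor_powr (s / 2) (Suc a) r' ((norm z)\<^sup>2)) \<in> tail_kernel_space j s"
      using Suc.prems(2,3) r'(2)
      by (intro tail_kernel_space_add Suc.IH[OF p'(2)] Suc.IH[OF q]) auto
    ultimately show ?thesis by blast
  qed
  then show ?case using cont taylor_kernel_bound[OF s Suc.prems(1,2)] by simp
qed

section \<open>Regularity of the fractional Laplacian\<close>

lemma nonlocal_integral_C_space:
  fixes u :: "real ^ 'n::finite \<Rightarrow> real"
  assumes \<alpha>: "0 < \<alpha>" "\<alpha> < \<delta>" "\<delta> \<le> real CARD('n) + \<alpha>"
    and u: "u \<in> second_diff_space N \<delta>" "u \<in> C_space N" "u \<in> L_space \<alpha>"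
  shows "(\<lambda>x. LINT z|lborel. second_diff u x z / norm z powr (real CARD('n) + \<alpha>)) \<in> C_space N"
proof -
  define s where "s = real CARD('n) + \<alpha>"
  have s: "0 < s" "real CARD('n) < s" using \<alpha> by (auto simp: s_def)
  have cu: "continuous_on UNIV u" by (rule C_space_continuous[OF u(2)])
  then have um [measurable]: "u \<in> borel_measurable borel" by (rule borel_measurable_continuous_onI)
  have uL: "integrable lborel (\<lambda>x. \<bar>u x\<bar> * tail_weight s x)"
    using u(3) by (simp add: L_space_iff s_def)
  \<comment> \<open>Order \<open>N\<close> of the Taylor continuation provides the \<open>N\<close>
    derivatives. The factor 1 is the constant polynomial from which the family of kernels
    starts.\<close>
  define k :: "real ^ 'n \<Rightarrow> real" where "k z = 1 * taylor_powr (s / 2) 0 N ((norm z)\<^sup>2)" for z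
  have k: "k \<in> tail_kernel_space N s"
    unfolding k_def by (rule taylor_kernel_in_tail_kernel_space[OF s(1) polynomial_le.const[of 0]]) auto
  have km [measurable]: "k \<in> borel_measurable borel"
    using tail_kernel_spaceD(1)[OF k] by (rule borel_measurable_continuous_onI)
  obtain C where C: "\<And>z. \<bar>k z\<bar> \<le> C * tail_weight s z" using tail_kernel_spaceD(2)[OF k] by blast
  have C0: "0 \<le> C" using order_trans[OF abs_ge_zero C[of 0]] tail_weight_pos[of s 0]
    by (metis zero_le_mult_iff not_less)
  have k_even: "k (- z) = k z" for z by (simp add: k_def)
  have k_far: "k z = 1 / norm z powr s" if "1 < norm z" for z
  proof -
    have "1 < (norm z)\<^sup>2" using that by simp
    then have "k z = (norm z)\<^sup>2 powr (- (s / 2))" by (simp add: k_def taylor_powr_def powr_deriv_coeff_def)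
    also have "(norm z)\<^sup>2 = norm z powr 2" using that by simp
    also have "(norm z powr 2) powr (- (s / 2)) = norm z powr (2 * (- (s / 2)))" by (rule powr_powr)
    also have "2 * (- (s / 2)) = - s" by simp
    finally show ?thesis by (simp add: powr_minus_divide)
  qed
  define \<kappa> where "\<kappa> z = 1 / norm z powr s - k z" for z
  have \<kappa>m [measurable]: "\<kappa> \<in> borel_measurable borel" unfolding \<kappa>_def by measurable
  have \<kappa>_supp: "\<kappa> z = 0" if "1 < norm z" for z using k_far[OF that] by (simp add: \<kappa>_def)
  \<comment> \<open>On the unit ball |\<kappa>| is at most |z|^(-s) + C; multiplied by |z|^\<delta>
    this is the integrable power |z|^(\<delta>-s) plus a constant.\<close>
  let ?b = "\<lambda>z::real^'n. indicator (cball 0 1) z * norm z powr (\<delta> - s) + indicator (cball 0 1) z * C"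
  have b: "integrable lborel ?b"
    using integral_norm_powr_ball[of "\<delta> - s", where 'n = 'n] \<alpha>
    by (intro Bochner_Integration.integrable_add integral_cball_const) (auto simp: s_def)
  have \<kappa>_int: "integrable lborel (\<lambda>z. \<bar>\<kappa> z\<bar> * norm z powr \<delta>)"
  proof (rule Bochner_Integration.integrable_bound[OF b])
    have "\<bar>\<kappa> z\<bar> * norm z powr \<delta> \<le> ?b z" for z
    proof (cases "norm z \<le> 1")
      case True
      have "norm z powr \<delta> \<le> 1 powr \<delta>" using True \<alpha> by (intro powr_mono2) auto
      then have n1: "norm z powr \<delta> \<le> 1" by simp
      have "tail_weight s z \<le> 1" by (simp add: tail_weight_def divide_le_eq_1 add_pos_nonneg)
      then have "\<bar>k z\<bar> \<le> C * 1" using C0 by (intro order_trans[OF C] mult_left_mono)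
      then have kC: "\<bar>k z\<bar> * norm z powr \<delta> \<le> C * 1" using n1 C0 by (intro mult_mono) auto
      have "\<bar>\<kappa> z\<bar> \<le> 1 / norm z powr s + \<bar>k z\<bar>"
        unfolding \<kappa>_def using abs_triangle_ineq4[of "1 / norm z powr s" "k z"] by simp
      then have "\<bar>\<kappa> z\<bar> * norm z powr \<delta> \<le> (1 / norm z powr s + \<bar>k z\<bar>) * norm z powr \<delta>"
        by (rule mult_right_mono) simp
      also have "\<dots> = norm z powr (\<delta> - s) + \<bar>k z\<bar> * norm z powr \<delta>"
        by (simp add: distrib_right powr_diff)
      finally show ?thesis using kC True by simp
    qed (simp add: \<kappa>_supp)
    then show "AE z in lborel. norm (\<bar>\<kappa> z\<bar> * norm z powr \<delta>) \<le> norm (?b z)"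
      by (auto intro!: AE_I2 simp: abs_mult intro: order_trans[OF _ abs_ge_self])
  qed simp
  have w: "integrable lborel (tail_weight s :: real ^ 'n \<Rightarrow> real)" by (rule integrable_tail_weight[OF s(2)])
  have k_int: "integrable lborel k"
    by (rule Bochner_Integration.integrable_bound[of _ "\<lambda>z. C * tail_weight s z"])
       (use w C in \<open>auto intro!: AE_I2 intro: order_trans[OF _ abs_ge_self]\<close>)
  have k_plus: "integrable lborel (\<lambda>z. k z * u (x + z))"
    "(LINT z|lborel. k z * u (x + z)) = regular_part k u x" for x
  proof -
    have i: "integrable lborel (\<lambda>y. k (y - x) * u y)" by (rule regular_part_integrable[OF s(1) um uL k])
    show "integrable lborel (\<lambda>z. k z * u (x + z))"
      using lborel_integrable_translate[OF i, of x] by (simp add: add.commute)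
    show "(LINT z|lborel. k z * u (x + z)) = regular_part k u x"
      unfolding regular_part_def
      using lborel_integral_translate[of "\<lambda>y. k (y - x) * u y" x] by (simp add: add.commute)
  qed
  have k_minus: "integrable lborel (\<lambda>z. k z * u (x - z))"
    "(LINT z|lborel. k z * u (x - z)) = regular_part k u x" for x
    using lborel_integrable_reflect[OF k_plus(1)[of x], of 0]
      lborel_integral_reflect[of "\<lambda>z. k z * u (x + z)" 0] k_plus(2)[of x]
    by (simp_all add: k_even)
  \<comment> \<open>For the smooth kernel the three terms of the second difference may be integrated
    separately. Evenness of \<open>k\<close> makes the two shifted terms equal, which gives the
    coefficient -2.\<close>
  have split: "(LINT z|lborel. second_diff u x z / norm z powr s)
      = (LINT z|lborel. \<kappa> z * second_diff u x z) + ((2 * (LINT z|lborel. k z)) * u x + (- 2) * regular_part k u x)" for x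
  proof -
    have "second_diff_Hoelder \<delta> u" by (rule second_diff_spaceD[OF u(1)])
    then obtain h where h: "integrable lborel h" "\<And>z. \<bar>\<kappa> z * second_diff u x z\<bar> \<le> h z"
      using singular_part_dominated[OF \<kappa>_supp \<kappa>m \<kappa>_int, of u "norm x"] by auto
    have 1: "integrable lborel (\<lambda>z. \<kappa> z * second_diff u x z)"
      by (rule Bochner_Integration.integrable_bound[OF h(1)])
         (use h(2) in \<open>auto intro!: AE_I2 simp del: abs_mult intro: order_trans[OF _ abs_ge_self]\<close>)
    have 2: "integrable lborel (\<lambda>z. (2 * u x) * k z - k z * u (x + z) - k z * u (x - z))"
      by (intro Bochner_Integration.integrable_diff integrable_mult_right k_int k_plus k_minus)
    have "(\<lambda>z. second_diff u x z / norm z powr s)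
        = (\<lambda>z. \<kappa> z * second_diff u x z + ((2 * u x) * k z - k z * u (x + z) - k z * u (x - z)))"
      by (auto simp: fun_eq_iff \<kappa>_def second_diff_def algebra_simps diff_divide_distrib add_divide_distrib)
    then have "(LINT z|lborel. second_diff u x z / norm z powr s) = (LINT z|lborel. \<kappa> z * second_diff u x z)
        + (LINT z|lborel. (2 * u x) * k z - k z * u (x + z) - k z * u (x - z))"
      using 1 2 by simp
    also have "(LINT z|lborel. (2 * u x) * k z - k z * u (x + z) - k z * u (x - z))
        = (2 * u x) * (LINT z|lborel. k z) - regular_part k u x - regular_part k u x"
      using k_int k_plus[of x] k_minus[of x] by simp
    finally show ?thesis by (simp add: mult_ac)
  qed
  have "(\<lambda>x. (LINT z|lborel. \<kappa> z * second_diff u x z)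
      + ((2 * (LINT z|lborel. k z)) * u x + (- 2) * regular_part k u x)) \<in> C_space N"
    by (intro C_space_add C_space_cmult u(2) singular_part_C_space[OF \<kappa>_supp \<kappa>m \<kappa>_int u(1)]
        regular_part_C_space[OF s(1) um uL k])
  then show ?thesis unfolding split[symmetric] s_def .
qed

lemma frac_laplacian_C_space:
  fixes u :: "real ^ 'n::finite \<Rightarrow> real"
  assumes \<alpha>: "0 < \<alpha>" "\<alpha> < 2" "\<alpha> < \<delta>" "\<delta> \<le> real CARD('n) + \<alpha>"
    and u: "u \<in> second_diff_space N \<delta>" "u \<in> C_space N" "u \<in> L_space \<alpha>"
  shows "frac_laplacian \<alpha> u \<in> C_space N"
proof -
  have *: "frac_laplacian \<alpha> u = (\<lambda>x. frac_laplacian_const TYPE('n) \<alpha> / 2 *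
      (LINT z|lborel. second_diff u x z / norm z powr (real CARD('n) + \<alpha>)))"
    using frac_laplacian_eq_integral[OF \<alpha> second_diff_spaceD[OF u(1)] u(3)] by (simp add: fun_eq_iff)
  show ?thesis
    unfolding * by (rule C_space_cmult[OF nonlocal_integral_C_space[OF \<alpha>(1,3,4) u]])
qed

section \<open>The super polyharmonic property\<close>

theorem theorem1p1:
  fixes u :: "real ^ 'n \<Rightarrow> real"
    and m :: nat
    and \<alpha> \<sigma> p q :: real
  assumes "CARD('n) \<ge> 2"
    and "m \<ge> 1"
    and "0 < \<alpha>" and "\<alpha> \<le> 2"
    and "\<sigma> < real CARD('n)"
    and "0 < q"
    and "\<alpha> < 2 \<Longrightarrow> 0 < p" and "\<alpha> = 2 \<Longrightarrow> 1 \<le> p"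
    and "\<And>x. 0 \<le> u x"
    and "classical_solution m \<alpha> \<sigma> p q u"
  shows "\<forall>i<m. \<forall>x. 0 \<le> frac_laplacian_power i \<alpha> u x"
proof -
  have reg: "solution_regularity m \<alpha> u"
    and int: "integrable lborel (riesz_integrand \<sigma> p u x)"
    and eq: "frac_laplacian_power m \<alpha> u x = riesz_convolution \<sigma> p u x * u x powr q" for x
    using assms(10) by (auto simp: classical_solution_def)
  let ?u0 = "frac_laplacian \<alpha> u"
  have top: "0 \<le> (neg_laplacian ^^ m) ?u0 x" for x
  proof -
    have "0 \<le> riesz_convolution \<sigma> p u x"
      unfolding riesz_convolution_def riesz_integrand_def by (intro integral_nonneg_AE) auto
    then show ?thesis using eq[of x] by (simp add: frac_laplacian_power_def)
  qed
  \<comment> \<open>Smoothness and vanishing means are what the descent asks of \<open>?u0\<close>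
    besides the sign at level \<open>m\<close>.\<close>
  have u0: "?u0 \<in> C_space (2 * m) \<and> (\<forall>a. mean_vanishing a ?u0)"
  proof (cases "\<alpha> = 2")
    case True
    have u: "u \<in> C_space (Suc (Suc (2 * m)))"
      using reg True by (simp add: solution_regularity_def del: C_space.simps)
    have e: "?u0 = neg_laplacian u" using True by (simp add: fun_eq_iff frac_laplacian_def)
    \<comment> \<open>The means of \<open>u\<close> itself are only bounded; the Laplacian that
      leads to \<open>?u0\<close> turns boundedness into decay.\<close>
    have "mean_bounded a u" for a
      using mean_bounded_if_riesz_integrable[OF C_space_continuous[OF u] assms(9) assms(8)[OF True] _ int]
        assms(5) by simp
    moreover have "u \<in> C_space (Suc (Suc 0))" by (rule C_space_mono[OF _ u]) simp
    ultimately show ?thesis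
      unfolding e using neg_laplacian_C_space[OF u] mean_bounded_imp_vanishing_neg_laplacian by blast
  next
    case False
    with assms(4) have \<alpha>2: "\<alpha> < 2" by simp
    obtain \<epsilon> where \<epsilon>: "0 < \<epsilon>" "frac \<alpha> + \<epsilon> < 1"
      "u \<in> Hoelder_loc_space (2 * m + nat \<lfloor>\<alpha>\<rfloor>) (frac \<alpha> + \<epsilon>)" "u \<in> L_space \<alpha>"
      using reg False by (auto simp: solution_regularity_def)
    \<comment> \<open>Integer part and Hoelder exponent add up to \<alpha> + \<epsilon> on either
      side of \<alpha> = 1; this sum is the exponent \<delta> of the second differences.\<close>
    have l: "nat \<lfloor>\<alpha>\<rfloor> \<le> 1" "real (nat \<lfloor>\<alpha>\<rfloor>) + (frac \<alpha> + \<epsilon>) = \<alpha> + \<epsilon>"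
      using assms(3) \<alpha>2 by (simp_all add: frac_def) linarith
    have f0: "0 \<le> frac \<alpha>" by simp
    have "u \<in> second_diff_space (2 * m) (real (nat \<lfloor>\<alpha>\<rfloor>) + (frac \<alpha> + \<epsilon>))"
      by (rule Hoelder_loc_space_subset_second_diff_space[OF \<epsilon>(3) l(1)]) (use \<epsilon>(1,2) add_nonneg_pos[OF f0 \<epsilon>(1)] in auto)
    then have u: "u \<in> second_diff_space (2 * m) (\<alpha> + \<epsilon>)" unfolding l(2) .
    have cu: "u \<in> C_space (2 * m)"
      using \<epsilon>(3) by (intro C_space_mono[of "2 * m" "2 * m + nat \<lfloor>\<alpha>\<rfloor>"]) (auto simp: Hoelder_loc_space_def)
    have "\<epsilon> < 1" using \<epsilon>(2) f0 by linarith
    \<comment> \<open>As \<epsilon> < 1, the exponent \<alpha> + \<epsilon> stays below n +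
      \<alpha>.\<close>
    then have d: "\<alpha> < \<alpha> + \<epsilon>" "\<alpha> + \<epsilon> \<le> real CARD('n) + \<alpha>" using assms(1) \<epsilon>(1) by auto
    show ?thesis
      using frac_laplacian_C_space[OF assms(3) \<alpha>2 d u cu \<epsilon>(4)]
        mean_vanishing_frac_laplacian[OF assms(3) \<alpha>2 d assms(1) second_diff_spaceD[OF u] \<epsilon>(4)] by blast
  qed
  show ?thesis
    unfolding frac_laplacian_power_def
    using neg_laplacian_power_nonneg_descent[of ?u0 m] u0 top by (metis less_imp_le)
qed

end
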